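(* Let $H$ be a Hilbert space, let $S\subset B(H)$ be an operator system and let $A=\mathrm{C}^*(S)\subset B(H)$. Assume that $A$ is a $\mathrm{C}^*$-envelope of $S$ (that is, $(A,i)$ is a $\mathrm{C}^*$-envelope of $S$, where $i:S\to A$ is the inclusion). Then \[ \operatorname{span}\operatorname{Ab}(S)=\mathrm{C}^*\mathrm{Ex}(S)\cap\ker\theta \] for every minimal $S$-projection $\theta:B(H)\to B(H)$.
   Context: An operator system $S\subset B(H)$ is a self-adjoint subspace containing the identity; $\mathrm{C}^*(S)$ is the $\mathrm{C}^*$-subalgebra of $B(H)$ generated by $S$. A $\mathrm{C}^*$-extension of $S$ is a pair $(B,j)$ consisting of a unital $\mathrm{C}^*$-algebra $B$ and a unital completely isometric map $j:S\to B$ with $B=\mathrm{C}^*(j(S))$. A $\mathrm{C}^*$-extension $(C,j)$ is a $\mathrm{C}^*$-envelope of $S$ if for every $\mathrm{C}^*$-extension $(B,\iota)$ of $S$ there is a surjective unital $*$-homomorphism $\pi:B\to C$ with $\pi\circ\iota=j$. An $S$-projection is a unital completely positive map $\theta:B(H)\to B(H)$ with $\theta|_S=\mathrm{id}$ and $\theta\circ\theta=\theta$. The set of $S$-projections is partially ordered by: $\psi\prec\theta$ if and only if $\psi\circ\theta=\theta\circ\psi=\psi$. A minimal $S$-projection is a minimal element for this order. The set of abnormalities of $S$ is $\operatorname{Ab}(S)=\{\phi(a)-a: a\in A,\ \phi\in E\}\subset B(H)$, where $E$ is the set of unital completely positive maps $\phi:A\to B(H)$ with $\phi(s)=s$ for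 all $s\in S$. The $\mathrm{C}^*$-expanse of $S$ is $\mathrm{C}^*\mathrm{Ex}(S)=\operatorname{span}\{\theta(A)\}$, the linear span in $B(H)$ of the union of the sets $\theta(A)$ over all minimal $S$-projections $\theta:B(H)\to B(H)$. All spans are linear spans (no closure). *)

theory Defs
  imports "HOL-Analysis.Analysis" "HOL-Algebra.Module"
begin

section \<open>Complex Hilbert spaces\<close>

class complex_vector = ab_group_add +
  fixes scaleC :: "complex \<Rightarrow> 'a \<Rightarrow> 'a" (infixr \<open>*\<^sub>C\<close> 75)
  assumes scaleC_add_right: "a *\<^sub>C (x + y) = a *\<^sub>C x + a *\<^sub>C y"
    and scaleC_add_left: "(a + b) *\<^sub>C x = a *\<^sub>C x + b *\<^sub>C x"
    and scaleC_scaleC: "a *\<^sub>C b *\<^sub>C x = (a * b) *\<^sub>C x"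
    and scaleC_one: "1 *\<^sub>C x = x"

global_interpretation complex_vector: vector_space "scaleC :: complex \<Rightarrow> 'a \<Rightarrow> 'a :: complex_vector"
  defines csubspace = complex_vector.subspace
    and cspan = complex_vector.span
  by unfold_locales (simp_all add: scaleC_add_right scaleC_add_left scaleC_scaleC scaleC_one)

text \<open>The real structure (norm, topology) is the one underlying the complex one. The inner
  product is conjugate-linear in its first and linear in its second argument; its positive
  definiteness is inherited from \<^const>\<open>inner\<close>.\<close>

class complex_hilbert = complex_vector + real_inner + banach +
  fixes cinner :: "'a \<Rightarrow> 'a \<Rightarrow> complex"
  assumes scaleR_scaleC: "r *\<^sub>R x = complex_of_real r *\<^sub>C x"
    and cinner_commute: "cinner x y = cnj (cinner y x)"
    and cinner_add_right: "cinner x (y + z) = cinner x y + cinner x z"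
    and cinner_scaleC_right: "cinner x (a *\<^sub>C y) = a * cinner x y"
    and inner_eq_Re_cinner: "inner x y = Re (cinner x y)"

lemma norm_scaleC: "norm (a *\<^sub>C x) = cmod a * norm (x :: 'a :: complex_hilbert)"
proof -
  have left: "cinner (a *\<^sub>C x) y = cnj a * cinner x y" for y
    by (metis cinner_commute cinner_scaleC_right complex_cnj_mult)
  have "inner (a *\<^sub>C x) (a *\<^sub>C x) = Re ((a * cnj a) * cinner x x)"
    by (simp add: inner_eq_Re_cinner left cinner_scaleC_right mult.assoc)
  also have "\<dots> = (cmod a)\<^sup>2 * inner x x"
    by (simp add: complex_norm_square [symmetric] inner_eq_Re_cinner del: of_real_power
        flip: of_real_power)
  finally have "(norm (a *\<^sub>C x))\<^sup>2 = (cmod a * norm x)\<^sup>2"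
    by (simp add: power2_norm_eq_inner power_mult_distrib)
  then show ?thesis
    by (simp add: power2_eq_iff_nonneg)
qed


lemma bounded_linear_scaleC: "bounded_linear (\<lambda>x :: 'a :: complex_hilbert. c *\<^sub>C x)"
  by (rule bounded_linear_intro [where K = "cmod c"])
    (auto simp: scaleC_add_right scaleR_scaleC scaleC_scaleC mult.commute norm_scaleC)


section \<open>Bounded operators\<close>

typedef (overloaded) 'a bop =
  "{T :: 'a :: complex_hilbert \<Rightarrow>\<^sub>L 'a.
     \<forall>c x. blinfun_apply T (c *\<^sub>C x) = c *\<^sub>C blinfun_apply T x}"
  morphisms blinfun_of_bop Bop
  by (rule exI [of _ 0]) (simp add: complex_vector.scale_zero_right)

setup_lifting type_definition_bop

lift_definition bop_apply :: "'a :: complex_hilbert bop \<Rightarrow> 'a \<Rightarrow> 'a" (infixr \<open>$$\<close> 80)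
  is blinfun_apply .

lemma bop_eqI: "(\<And>x. S $$ x = T $$ x) \<Longrightarrow> S = T"
  by transfer (rule blinfun_eqI)

instantiation bop :: (complex_hilbert) "{complex_vector, real_normed_algebra, monoid_mult}"
begin

lift_definition zero_bop :: "'a bop" is 0
  by (simp add: complex_vector.scale_zero_right)

lift_definition one_bop :: "'a bop" is id_blinfun
  by simp

lift_definition plus_bop :: "'a bop \<Rightarrow> 'a bop \<Rightarrow> 'a bop" is "(+)"
  by (simp add: blinfun.add_left scaleC_add_right)

lift_definition minus_bop :: "'a bop \<Rightarrow> 'a bop \<Rightarrow> 'a bop" is "(-)"
  by (simp add: blinfun.diff_left complex_vector.scale_right_diff_distrib)

lift_definition uminus_bop :: "'a bop \<Rightarrow> 'a bop" is uminus
  by (simp add: blinfun.minus_left complex_vector.scale_minus_right)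

lift_definition times_bop :: "'a bop \<Rightarrow> 'a bop \<Rightarrow> 'a bop" is "(o\<^sub>L)"
  by simp

lift_definition scaleR_bop :: "real \<Rightarrow> 'a bop \<Rightarrow> 'a bop" is "(*\<^sub>R)"
  by (simp add: blinfun.scaleR_left scaleR_scaleC scaleC_scaleC mult.commute)

lift_definition scaleC_bop :: "complex \<Rightarrow> 'a bop \<Rightarrow> 'a bop"
  is "\<lambda>c T. Blinfun ((*\<^sub>C) c) o\<^sub>L T"
  by (simp add: bounded_linear_Blinfun_apply bounded_linear_scaleC scaleC_scaleC mult.commute)

lift_definition norm_bop :: "'a bop \<Rightarrow> real" is norm .

definition dist_bop :: "'a bop \<Rightarrow> 'a bop \<Rightarrow> real"
  where "dist_bop S T = norm (S - T)"

definition uniformity_bop :: "('a bop \<times> 'a bop) filter"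
  where "uniformity_bop = (INF e\<in>{0<..}. principal {(S, T). dist S T < e})"

definition open_bop :: "'a bop set \<Rightarrow> bool"
  where "open_bop U \<longleftrightarrow> (\<forall>S\<in>U. \<forall>\<^sub>F (S', T) in uniformity. S' = S \<longrightarrow> T \<in> U)"

definition sgn_bop :: "'a bop \<Rightarrow> 'a bop"
  where "sgn_bop T = inverse (norm T) *\<^sub>R T"

lemma bop_apply_simps [simp]:
  fixes S T :: "'a bop"
  shows "0 $$ x = 0" "1 $$ x = x" "(S + T) $$ x = S $$ x + T $$ x"
    "(S - T) $$ x = S $$ x - T $$ x" "(- S) $$ x = - (S $$ x)" "(S * T) $$ x = S $$ T $$ x"
    "(r *\<^sub>R S) $$ x = r *\<^sub>R (S $$ x)" "(c *\<^sub>C S) $$ x = c *\<^sub>C (S $$ x)"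
    "S $$ (x + y) = S $$ x + S $$ y" "S $$ (r *\<^sub>R x) = r *\<^sub>R (S $$ x)"
    "S $$ (c *\<^sub>C x) = c *\<^sub>C (S $$ x)"
  by (transfer, simp add: blinfun.bilinear_simps bounded_linear_Blinfun_apply
      bounded_linear_scaleC)+

instance
proof
  fix a b :: complex and r s :: real and R S T :: "'a bop" and U :: "'a bop set"
  show "R + S + T = R + (S + T)" "S + T = T + S" "0 + T = T" "- T + T = 0" "S - T = S + - T"
    "a *\<^sub>C (S + T) = a *\<^sub>C S + a *\<^sub>C T" "(a + b) *\<^sub>C T = a *\<^sub>C T + b *\<^sub>C T"
    "a *\<^sub>C b *\<^sub>C T = (a * b) *\<^sub>C T" "1 *\<^sub>C T = T"
    "r *\<^sub>R (S + T) = r *\<^sub>R S + r *\<^sub>R T" "(r + s) *\<^sub>R T = r *\<^sub>R T + s *\<^sub>R T"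
    "r *\<^sub>R s *\<^sub>R T = (r * s) *\<^sub>R T" "1 *\<^sub>R T = T"
    "R * S * T = R * (S * T)" "(R + S) * T = R * T + S * T" "R * (S + T) = R * S + R * T"
    "r *\<^sub>R S * T = r *\<^sub>R (S * T)" "S * r *\<^sub>R T = r *\<^sub>R (S * T)" "1 * T = T" "T * 1 = T"
    by (rule bop_eqI, simp add: scaleC_add_right scaleC_add_left scaleC_scaleC scaleC_one
        scaleR_add_right scaleR_add_left)+
  show "norm T = 0 \<longleftrightarrow> T = 0" "norm (S + T) \<le> norm S + norm T"
    "norm (r *\<^sub>R T) = \<bar>r\<bar> * norm T"
    by (transfer, simp add: norm_triangle_ineq)+
  show "norm (S * T) \<le> norm S * norm T"
    by transfer (rule norm_blinfun_compose)
qed (fact dist_bop_def uniformity_bop_def open_bop_def sgn_bop_def)+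

end

text \<open>The Hilbert space adjoint; it exists and is unique by the Riesz representation theorem.\<close>

definition adj :: "'a :: complex_hilbert bop \<Rightarrow> 'a bop"
  where "adj T = (THE T'. \<forall>x y. cinner (T' $$ x) y = cinner x (T $$ y))"


section \<open>Matrices over $B(H)$\<close>

text \<open>The \<open>n \<times> n\<close> matrices with entries in a set \<open>D\<close> are the functions in \<open>idx n \<rightarrow>\<^sub>E D\<close>. A matrix
  over $B(H)$ acts on $H^n$, whose elements are given by the first \<open>n\<close> values of a function
  \<^typ>\<open>nat \<Rightarrow> 'a\<close>.\<close>

abbreviation idx :: "nat \<Rightarrow> (nat \<times> nat) set"
  where "idx n \<equiv> {..<n} \<times> {..<n}"

definition mat_apply ::
    "nat \<Rightarrow> (nat \<times> nat \<Rightarrow> 'a :: complex_hilbert bop) \<Rightarrow> (nat \<Rightarrow> 'a) \<Rightarrow> nat \<Rightarrow> 'a"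
  where "mat_apply n X \<xi> i = (\<Sum>j<n. X (i, j) $$ \<xi> j)"

definition mat_norm :: "nat \<Rightarrow> (nat \<times> nat \<Rightarrow> 'a :: complex_hilbert bop) \<Rightarrow> real"
  where "mat_norm n X =
    (SUP \<xi> \<in> {\<xi>. L2_set (\<lambda>i. norm (\<xi> i)) {..<n} \<le> 1}.
      L2_set (\<lambda>i. norm (mat_apply n X \<xi> i)) {..<n})"

definition mat_pos :: "nat \<Rightarrow> (nat \<times> nat \<Rightarrow> 'a :: complex_hilbert bop) \<Rightarrow> bool"
  where "mat_pos n X \<longleftrightarrow>
    (\<forall>\<xi>. (\<Sum>i<n. cinner (\<xi> i) (mat_apply n X \<xi> i)) \<in> \<real>\<^sub>\<ge>\<^sub>0)"

abbreviation mat_map :: "nat \<Rightarrow> ('a \<Rightarrow> 'b) \<Rightarrow> (nat \<times> nat \<Rightarrow> 'a) \<Rightarrow> nat \<times> nat \<Rightarrow> 'b"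
  where "mat_map n f \<equiv> compose (idx n) f"


section \<open>Abstract unital C*-algebras\<close>

record 'b cstar = "(complex, 'b) module" +
  star :: "'b \<Rightarrow> 'b"
  cnorm :: "'b \<Rightarrow> real"

text \<open>The zero algebra, in which \<open>\<one> = \<zero>\<close>, is admitted: it is $B(H)$ for $H = 0$.\<close>

locale unital_cstar_algebra = ring B for B :: "'b cstar" (structure) +
  assumes smult_closed: "x \<in> carrier B \<Longrightarrow> a \<odot> x \<in> carrier B"
    and smult_add_right:
      "x \<in> carrier B \<Longrightarrow> y \<in> carrier B \<Longrightarrow> a \<odot> (x \<oplus> y) = a \<odot> x \<oplus> a \<odot> y"
    and smult_add_left: "x \<in> carrier B \<Longrightarrow> (a + b) \<odot> x = a \<odot> x \<oplus> b \<odot> x"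
    and smult_smult: "x \<in> carrier B \<Longrightarrow> a \<odot> (b \<odot> x) = (a * b) \<odot> x"
    and smult_one: "x \<in> carrier B \<Longrightarrow> 1 \<odot> x = x"
    and smult_mult_left:
      "x \<in> carrier B \<Longrightarrow> y \<in> carrier B \<Longrightarrow> (a \<odot> x) \<otimes> y = a \<odot> (x \<otimes> y)"
    and smult_mult_right:
      "x \<in> carrier B \<Longrightarrow> y \<in> carrier B \<Longrightarrow> x \<otimes> (a \<odot> y) = a \<odot> (x \<otimes> y)"
    and star_closed: "x \<in> carrier B \<Longrightarrow> star B x \<in> carrier B"
    and star_star: "x \<in> carrier B \<Longrightarrow> star B (star B x) = x"
    and star_add:
      "x \<in> carrier B \<Longrightarrow> y \<in> carrier B \<Longrightarrow> star B (x \<oplus> y) = star B x \<oplus> star B y"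
    and star_smult: "x \<in> carrier B \<Longrightarrow> star B (a \<odot> x) = cnj a \<odot> star B x"
    and star_mult:
      "x \<in> carrier B \<Longrightarrow> y \<in> carrier B \<Longrightarrow> star B (x \<otimes> y) = star B y \<otimes> star B x"
    and cnorm_eq_zero: "x \<in> carrier B \<Longrightarrow> cnorm B x = 0 \<longleftrightarrow> x = \<zero>"
    and cnorm_triangle:
      "x \<in> carrier B \<Longrightarrow> y \<in> carrier B \<Longrightarrow> cnorm B (x \<oplus> y) \<le> cnorm B x + cnorm B y"
    and cnorm_smult: "x \<in> carrier B \<Longrightarrow> cnorm B (a \<odot> x) = cmod a * cnorm B x"
    and cnorm_mult:
      "x \<in> carrier B \<Longrightarrow> y \<in> carrier B \<Longrightarrow> cnorm B (x \<otimes> y) \<le> cnorm B x * cnorm B y"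
    and cstar_identity: "x \<in> carrier B \<Longrightarrow> cnorm B (star B x \<otimes> x) = (cnorm B x)\<^sup>2"
    and complete:
      "(\<And>k. X k \<in> carrier B) \<Longrightarrow>
       (\<And>e. e > 0 \<Longrightarrow> \<exists>N. \<forall>k\<ge>N. \<forall>l\<ge>N. cnorm B (X k \<ominus> X l) < e) \<Longrightarrow>
       \<exists>x\<in>carrier B. (\<lambda>k. cnorm B (X k \<ominus> x)) \<longlonglongrightarrow> 0"

definition star_hom :: "'b cstar \<Rightarrow> 'c cstar \<Rightarrow> ('b \<Rightarrow> 'c) set"
  where "star_hom B C = {\<pi> \<in> ring_hom B C. \<forall>x\<in>carrier B.
    (\<forall>a. \<pi> (a \<odot>\<^bsub>B\<^esub> x) = a \<odot>\<^bsub>C\<^esub> \<pi> x) \<and> \<pi> (star B x) = star C (\<pi> x)}"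

definition cstar_subalgebra :: "'b set \<Rightarrow> 'b cstar \<Rightarrow> bool"
  where "cstar_subalgebra D B \<longleftrightarrow> D \<subseteq> carrier B \<and> \<zero>\<^bsub>B\<^esub> \<in> D \<and>
    (\<forall>x\<in>D. \<forall>y\<in>D. x \<oplus>\<^bsub>B\<^esub> y \<in> D \<and> x \<otimes>\<^bsub>B\<^esub> y \<in> D) \<and>
    (\<forall>x\<in>D. star B x \<in> D \<and> (\<forall>a. a \<odot>\<^bsub>B\<^esub> x \<in> D)) \<and>
    (\<forall>X. \<forall>x\<in>carrier B. (\<forall>k. X k \<in> D) \<and> (\<lambda>k. cnorm B (X k \<ominus>\<^bsub>B\<^esub> x)) \<longlonglongrightarrow> 0 \<longrightarrow> x \<in> D)"

definition cstar_generated :: "'b cstar \<Rightarrow> 'b set \<Rightarrow> 'b set"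
  where "cstar_generated B M = \<Inter> {D. cstar_subalgebra D B \<and> M \<subseteq> D}"

text \<open>The *-algebra $M_n(B)$, equipped with a candidate norm \<open>p\<close>.\<close>

definition mat_cstar ::
    "nat \<Rightarrow> 'b cstar \<Rightarrow> ((nat \<times> nat \<Rightarrow> 'b) \<Rightarrow> real) \<Rightarrow> (nat \<times> nat \<Rightarrow> 'b) cstar"
  where "mat_cstar n B p =
    \<lparr>carrier = idx n \<rightarrow>\<^sub>E carrier B,
     mult = (\<lambda>X Y. \<lambda>(i, k)\<in>idx n. \<Oplus>\<^bsub>B\<^esub>j\<in>{..<n}. X (i, j) \<otimes>\<^bsub>B\<^esub> Y (j, k)),
     one = (\<lambda>(i, j)\<in>idx n. if i = j then \<one>\<^bsub>B\<^esub> else \<zero>\<^bsub>B\<^esub>),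
     zero = (\<lambda>_\<in>idx n. \<zero>\<^bsub>B\<^esub>),
     add = (\<lambda>X Y. \<lambda>ij\<in>idx n. X ij \<oplus>\<^bsub>B\<^esub> Y ij),
     smult = (\<lambda>a X. \<lambda>ij\<in>idx n. a \<odot>\<^bsub>B\<^esub> X ij),
     star = (\<lambda>X. \<lambda>(i, j)\<in>idx n. star B (X (j, i))),
     cnorm = p\<rparr>"

definition bop_cstar :: "'a :: complex_hilbert bop cstar"
  where "bop_cstar =
    \<lparr>carrier = UNIV, mult = (*), one = 1, zero = 0, add = (+), smult = (*\<^sub>C), star = adj,
     cnorm = norm\<rparr>"


section \<open>Operator systems and C*-envelopes\<close>

definition operator_system :: "'a :: complex_hilbert bop set \<Rightarrow> bool"
  where "operator_system S \<longleftrightarrow> csubspace S \<and> 1 \<in> S \<and> (\<forall>s\<in>S. adj s \<in> S)"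

definition cstar_of :: "'a :: complex_hilbert bop set \<Rightarrow> 'a bop set"
  where "cstar_of S = cstar_generated bop_cstar S"

text \<open>For a C*-algebra \<open>B\<close> there is exactly one norm \<open>p\<close> turning the *-algebra $M_n(B)$ into a
  C*-algebra, so the existential quantifier below just refers to the norm of $M_n(B)$.\<close>

definition unital_complete_isometry ::
    "'a :: complex_hilbert bop set \<Rightarrow> 'b cstar \<Rightarrow> ('a bop \<Rightarrow> 'b) \<Rightarrow> bool"
  where "unital_complete_isometry S B j \<longleftrightarrow> j ` S \<subseteq> carrier B \<and> j 1 = \<one>\<^bsub>B\<^esub> \<and>
    (\<forall>s\<in>S. \<forall>t\<in>S. j (s + t) = j s \<oplus>\<^bsub>B\<^esub> j t) \<and> (\<forall>s\<in>S. \<forall>a. j (a *\<^sub>C s) = a \<odot>\<^bsub>B\<^esub> j s) \<and>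
    (\<forall>n>0. \<exists>p. unital_cstar_algebra (mat_cstar n B p) \<and>
      (\<forall>X \<in> idx n \<rightarrow>\<^sub>E S. p (mat_map n j X) = mat_norm n X))"

definition cstar_extension ::
    "'a :: complex_hilbert bop set \<Rightarrow> 'b cstar \<Rightarrow> ('a bop \<Rightarrow> 'b) \<Rightarrow> bool"
  where "cstar_extension S B j \<longleftrightarrow> unital_cstar_algebra B \<and> unital_complete_isometry S B j \<and>
    cstar_generated B (j ` S) = carrier B"

text \<open>HOL cannot quantify over all types that might carry the algebra \<open>B\<close>. It suffices to let
  the carrier of \<open>B\<close> be an arbitrary subset of the type of operators on \<open>H\<close>, with arbitrary
  algebra operations and norm on it: for any C*-extension $(B, \iota)$, the algebra $B$ is the
  closure of the *-algebra generated by the image of \<open>S\<close>, so that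
  $|B| \le |S|^{\aleph_0} \le |B(H)|^{\aleph_0} = |B(H)|$ (the last step, which holds for every
  nonzero Banach space, needs $H \ne 0$; if $H = 0$, then $B = 0$). Every C*-extension is therefore
  isomorphic to one of the kind considered here.\<close>

definition cstar_envelope ::
    "'a :: complex_hilbert bop set \<Rightarrow> 'c cstar \<Rightarrow> ('a bop \<Rightarrow> 'c) \<Rightarrow> bool"
  where "cstar_envelope S C j \<longleftrightarrow> cstar_extension S C j \<and>
    (\<forall>(B :: 'a bop cstar) \<iota>. cstar_extension S B \<iota> \<longrightarrow>
      (\<exists>\<pi> \<in> star_hom B C. \<pi> ` carrier B = carrier C \<and> (\<forall>s\<in>S. \<pi> (\<iota> s) = j s)))"


section \<open>Unital completely positive maps and minimal projections\<close>

text \<open>Positivity of a matrix over a C*-subalgebra \<open>D\<close> of $B(H)$ is positivity as an operator on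
  $H^n$.\<close>

definition ucp :: "'a :: complex_hilbert bop set \<Rightarrow> ('a bop \<Rightarrow> 'a bop) \<Rightarrow> bool"
  where "ucp D \<phi> \<longleftrightarrow> \<phi> 1 = 1 \<and>
    (\<forall>x\<in>D. \<forall>y\<in>D. \<phi> (x + y) = \<phi> x + \<phi> y) \<and> (\<forall>x\<in>D. \<forall>a. \<phi> (a *\<^sub>C x) = a *\<^sub>C \<phi> x) \<and>
    (\<forall>n>0. \<forall>X \<in> idx n \<rightarrow>\<^sub>E D. mat_pos n X \<longrightarrow> mat_pos n (mat_map n \<phi> X))"

definition S_projection ::
    "'a :: complex_hilbert bop set \<Rightarrow> ('a bop \<Rightarrow> 'a bop) \<Rightarrow> bool"
  where "S_projection S \<theta> \<longleftrightarrow> ucp UNIV \<theta> \<and> (\<forall>s\<in>S. \<theta> s = s) \<and> \<theta> \<circ> \<theta> = \<theta>"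

definition proj_le :: "('a \<Rightarrow> 'a) \<Rightarrow> ('a \<Rightarrow> 'a) \<Rightarrow> bool" (infix \<open>\<prec>\<close> 50)
  where "\<psi> \<prec> \<theta> \<longleftrightarrow> \<psi> \<circ> \<theta> = \<psi> \<and> \<theta> \<circ> \<psi> = \<psi>"

definition minimal_S_projection ::
    "'a :: complex_hilbert bop set \<Rightarrow> ('a bop \<Rightarrow> 'a bop) \<Rightarrow> bool"
  where "minimal_S_projection S \<theta> \<longleftrightarrow>
    S_projection S \<theta> \<and> (\<forall>\<psi>. S_projection S \<psi> \<and> \<psi> \<prec> \<theta> \<longrightarrow> \<psi> = \<theta>)"

definition Ab :: "'a :: complex_hilbert bop set \<Rightarrow> 'a bop set"
  where "Ab S = {\<phi> a - a | a \<phi>. a \<in> cstar_of S \<and> ucp (cstar_of S) \<phi> \<and> (\<forall>s\<in>S. \<phi> s = s)}"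

definition CstarEx :: "'a :: complex_hilbert bop set \<Rightarrow> 'a bop set"
  where "CstarEx S = cspan (\<Union>\<theta> \<in> {\<theta>. minimal_S_projection S \<theta>}. \<theta> ` cstar_of S)"

end

theory Submission
  imports Defs "HOL-Library.Function_Algebras"
begin

text \<open>Let \<open>A = C\<^sup>*(S)\<close> and let \<open>E\<close> be the set of unital completely positive maps from \<open>A\<close> to $B(H)$ that fix \<open>S\<close>.
  The theorem follows from three facts about a minimal $S$-projection \<open>\<theta>\<close>, which use that \<open>A\<close> is a
  C*-envelope (lemma \<open>envelope_abnormality\<close>).

  \<^item> \<open>\<theta>\<close> is injective on \<open>A\<close>.
  \<^item> \<open>\<theta> \<circ> \<phi> = \<theta>\<close> on \<open>A\<close> for every \<open>\<phi>\<close> in \<open>E\<close>.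
  \<^item> Every \<open>\<phi>\<close> in \<open>E\<close> is the restriction of a minimal $S$-projection.

  By the third fact, applied to \<open>\<phi>\<close> and to the inclusion of \<open>A\<close>, every abnormality \<open>\<phi>(a) - a\<close> lies in the
  expanse, and by the second it lies in the kernel of \<open>\<theta>\<close>. Conversely, minimal $S$-projections restrict
  to elements of \<open>E\<close>, so every \<open>x\<close> in the expanse differs from some \<open>a\<close> in \<open>A\<close> by a combination of abnormalities. If
  \<open>\<theta>(x) = 0\<close>, then \<open>\<theta>(a) = 0\<close>, and \<open>a = 0\<close> by the first fact.

  The three facts rest on the following results.

  Rigidity (\<open>minimal_S_projection_rigid\<close>): \<open>\<theta> \<circ> \<phi> \<circ> \<theta> = \<theta>\<close> for all unital completely positive maps \<open>\<phi>\<close> on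
  $B(H)$ that fix \<open>S\<close>. As in Hamana's construction of the injective envelope, one minimises the
  seminorms \<open>x \<mapsto> \<parallel>\<phi>(x)\<parallel>\<close> and averages powers of a minimal \<open>\<phi>\<close> to see that it is idempotent.

  Arveson's extension theorem (\<open>arveson_extension\<close>), deduced from the Hahn-Banach theorem.

  The Choi-Effros theorem: the range of \<open>\<theta>\<close> is a C*-algebra under the product \<open>\<theta>(x y)\<close>, and its subalgebra
  \<open>B\<close> generated by \<open>S\<close> is a C*-extension of \<open>S\<close> (\<open>cstar_extension_choi_effros\<close>). The envelope property
  of \<open>A\<close> gives a *-homomorphism \<open>\<pi>\<close> from \<open>B\<close> onto \<open>A\<close> that fixes \<open>S\<close>. It is completely positive
  (\<open>star_hom_ucp\<close>), since positive matrices over \<open>B\<close> have square roots for the Choi-Effros product.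
  As \<open>\<theta>\<close> is multiplicative from \<open>A\<close> to \<open>B\<close>, the map \<open>\<pi> \<circ> \<theta>\<close> is the identity on \<open>A\<close> (\<open>cstar_of_theta\<close>). For \<open>\<phi>\<close> in \<open>E\<close>,
  an extension \<open>\<psi>\<close> of \<open>\<phi> \<circ> \<pi>\<close> to $B(H)$ satisfies \<open>\<psi> \<circ> \<theta> = \<phi>\<close> on \<open>A\<close>, to which rigidity applies.\<close>

section \<open>The inner product and the Riesz representation theorem\<close>

lemma cinner_add_left: "cinner (x + y) z = cinner x z + cinner (y :: 'a :: complex_hilbert) z"
  by (metis cinner_add_right cinner_commute complex_cnj_add)

lemma cinner_scaleC_left: "cinner (a *\<^sub>C x) y = cnj a * cinner (x :: 'a :: complex_hilbert) y"
  by (metis cinner_commute cinner_scaleC_right complex_cnj_mult)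

lemma cinner_zero [simp]:
  "cinner 0 (x :: 'a :: complex_hilbert) = 0" "cinner (x :: 'a :: complex_hilbert) 0 = 0"
  using cinner_add_left [of 0 0 x] cinner_add_right [of x 0 0] by simp_all

lemma cinner_minus_right: "cinner x (- y) = - cinner (x :: 'a :: complex_hilbert) y"
  using cinner_add_right [of x y "- y"] by (simp add: eq_neg_iff_add_eq_0 add.commute)

lemma cinner_minus_left: "cinner (- x) y = - cinner (x :: 'a :: complex_hilbert) y"
  using cinner_add_left [of x "- x" y] by (simp add: eq_neg_iff_add_eq_0 add.commute)

lemma cinner_diff_right: "cinner x (y - z) = cinner x y - cinner (x :: 'a :: complex_hilbert) z"
  using cinner_add_right [of x y "- z"] by (simp add: cinner_minus_right)

lemma cinner_diff_left: "cinner (x - y) z = cinner x z - cinner (y :: 'a :: complex_hilbert) z"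
  using cinner_add_left [of x "- y" z] by (simp add: cinner_minus_left)

lemma cinner_sum_right:
  "cinner x (\<Sum>i\<in>I. f i) = (\<Sum>i\<in>I. cinner (x :: 'a :: complex_hilbert) (f i))"
  by (induction I rule: infinite_finite_induct) (simp_all add: cinner_add_right)

lemma cinner_sum_left:
  "cinner (\<Sum>i\<in>I. f i) x = (\<Sum>i\<in>I. cinner (f i) (x :: 'a :: complex_hilbert))"
  by (induction I rule: infinite_finite_induct) (simp_all add: cinner_add_left)

lemma cinner_scaleR_right:
  "cinner x (r *\<^sub>R y) = of_real r * cinner (x :: 'a :: complex_hilbert) y"
  by (simp add: scaleR_scaleC cinner_scaleC_right)

lemma cinner_scaleR_left:
  "cinner (r *\<^sub>R x) y = of_real r * cinner (x :: 'a :: complex_hilbert) y"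
  by (simp add: scaleR_scaleC cinner_scaleC_left)

lemmas cinner_simps = cinner_add_left cinner_add_right cinner_diff_left cinner_diff_right
  cinner_minus_left cinner_minus_right cinner_scaleC_left cinner_scaleC_right
  cinner_scaleR_left cinner_scaleR_right

lemma cinner_self: "cinner x x = complex_of_real ((norm (x :: 'a :: complex_hilbert))\<^sup>2)"
proof (rule complex_eqI)
  show "Re (cinner x x) = Re (complex_of_real ((norm x)\<^sup>2))"
    by (metis Re_complex_of_real inner_eq_Re_cinner power2_norm_eq_inner)
  have "Im (cinner x x) = - Im (cinner x x)"
    by (metis cinner_commute cnj.sel(2))
  then show "Im (cinner x x) = Im (complex_of_real ((norm x)\<^sup>2))"
    by simp
qed

lemma cmod_cinner_le: "cmod (cinner x y) \<le> norm x * norm (y :: 'a :: complex_hilbert)"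
proof (cases "cinner x y = 0")
  case False
  \<comment> \<open>Rotate \<open>y\<close> so that the inner product becomes real and the real Cauchy-Schwarz inequality applies.\<close>
  define c where "c = cnj (sgn (cinner x y))"
  have "c * cinner x y = of_real (cmod (cinner x y))"
    unfolding c_def using False
    by (simp add: sgn_eq complex_norm_square [symmetric] power2_eq_square mult.commute divide_simps flip: of_real_mult)
  then have "cinner x (c *\<^sub>C y) = of_real (cmod (cinner x y))"
    by (simp add: cinner_scaleC_right)
  then have "cmod (cinner x y) = inner x (c *\<^sub>C y)"
    by (simp add: inner_eq_Re_cinner)
  also have "\<dots> \<le> norm x * norm (c *\<^sub>C y)"
    by (rule norm_cauchy_schwarz)
  also have "cmod c = 1"
    using False by (simp add: c_def norm_sgn)
  then have "norm (c *\<^sub>C y) = norm y"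
    by (simp add: norm_scaleC)
  finally show ?thesis .
qed simp

lemma cinner_eqI: "(\<And>z. cinner z x = cinner z y) \<Longrightarrow> x = (y :: 'a :: complex_hilbert)"
proof -
  assume "\<And>z. cinner z x = cinner z y"
  then have "cinner (x - y) (x - y) = 0"
    by (simp add: cinner_diff_right)
  then show "x = y"
    by (simp add: cinner_self)
qed

text \<open>The representing vector minimises \<open>x \<mapsto> \<parallel>x\<parallel>\<^sup>2 - 2 f x\<close>; the parallelogram law makes minimising
  sequences Cauchy.\<close>

lemma riesz_real:
  fixes f :: "'a :: {real_inner, banach} \<Rightarrow> real"
  assumes "bounded_linear f"
  shows "\<exists>y. \<forall>x. f x = inner y x"
proof -
  interpret f: bounded_linear f by fact
  obtain K where K: "\<And>x. norm (f x) \<le> norm x * K"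
    using f.bounded by auto
  define J where "J x = (norm x)\<^sup>2 - 2 * f x" for x
  have J_ge: "J x \<ge> - K\<^sup>2" for x
  proof -
    have "f x \<le> norm x * K" using K [of x] by simp
    moreover have "0 \<le> (norm x - K)\<^sup>2" by simp
    ultimately show ?thesis unfolding J_def by (simp add: power2_diff)
  qed
  define m where "m = Inf (range J)"
  have bdd: "bdd_below (range J)"
    using J_ge by (intro bdd_belowI) auto
  have m_le: "m \<le> J x" for x
    unfolding m_def by (rule cInf_lower) (auto simp: bdd)
  have "\<exists>x. J x < m + 1 / Suc n" for n
  proof -
    have "Inf (range J) < m + 1 / Suc n" by (simp add: m_def)
    then show ?thesis by (subst (asm) cInf_less_iff) (auto simp: bdd)
  qed
  then obtain X where X: "\<And>n. J (X n) < m + 1 / Suc n"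
    by metis
  have par: "(norm (x - y))\<^sup>2 = 2 * (J x + J y) - 4 * J ((1/2) *\<^sub>R (x + y))" for x y
    by (simp add: J_def f.scaleR f.add power2_norm_eq_inner inner_simps inner_commute algebra_simps)
  have close: "(norm (X k - X l))\<^sup>2 \<le> 4 / Suc n" if "k \<ge> n" "l \<ge> n" for k l n
  proof -
    have "1 / real (Suc k) \<le> 1 / real (Suc n)" "1 / real (Suc l) \<le> 1 / real (Suc n)"
      using that by (simp_all add: frac_le)
    then have "J (X k) < m + 1 / Suc n" "J (X l) < m + 1 / Suc n"
      using X [of k] X [of l] by linarith+
    then have "2 * (J (X k) + J (X l)) - 4 * J ((1/2) *\<^sub>R (X k + X l)) \<le> 4 * (1 / Suc n)"
      using m_le [of "(1/2) *\<^sub>R (X k + X l)"] by argo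
    then show ?thesis
      unfolding par by simp
  qed
  have "Cauchy X"
  proof (rule metric_CauchyI)
    fix e :: real
    assume "e > 0"
    then obtain n where "4 / e\<^sup>2 < real n"
      using reals_Archimedean2 by blast
    then have "4 / real (Suc n) < e\<^sup>2"
      using \<open>e > 0\<close> by (simp add: field_simps) (smt (verit) zero_less_power)
    then have "(norm (X k - X l))\<^sup>2 < e\<^sup>2" if "k \<ge> n" "l \<ge> n" for k l
      using close [OF that] by linarith
    then have "norm (X k - X l) < e" if "k \<ge> n" "l \<ge> n" for k l
      using that \<open>e > 0\<close> by (meson less_imp_le power_less_imp_less_base)
    then show "\<exists>M. \<forall>k\<ge>M. \<forall>l\<ge>M. dist (X k) (X l) < e"
      unfolding dist_norm by blast
  qed
  then obtain y where y: "X \<longlonglongrightarrow> y"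
    using convergent_eq_Cauchy by blast
  have "(\<lambda>n. J (X n)) \<longlonglongrightarrow> J y"
    unfolding J_def by (intro tendsto_intros f.tendsto y)
  moreover have "(\<lambda>n. m + 1 / Suc n) \<longlonglongrightarrow> m + 0"
    by (intro tendsto_add tendsto_const LIMSEQ_Suc lim_1_over_n)
  ultimately have "J y \<le> m"
    using X by (intro LIMSEQ_le [of "\<lambda>n. J (X n)" _ "\<lambda>n. m + 1 / Suc n"]) (auto intro: less_imp_le)
  have "f z = inner y z" for z
  proof -
    have J_line: "J (y + t *\<^sub>R z) = J y + t\<^sup>2 * (norm z)\<^sup>2 + 2 * t * (inner y z - f z)" for t
    proof -
      have "(norm (y + t *\<^sub>R z))\<^sup>2 = (norm y)\<^sup>2 + t\<^sup>2 * (norm z)\<^sup>2 + 2 * t * inner y z"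
        by (simp add: power2_norm_eq_inner inner_simps inner_commute)
          (simp add: power2_eq_square algebra_simps)
      then show ?thesis
        by (simp add: J_def f.scaleR f.add algebra_simps)
    qed
    have pos: "0 \<le> t\<^sup>2 * (norm z)\<^sup>2 + 2 * t * (inner y z - f z)" for t
      using J_line [of t] m_le [of "y + t *\<^sub>R z"] \<open>J y \<le> m\<close> by linarith
    \<comment> \<open>The step \<open>t = - d / \<parallel>z\<parallel>\<^sup>2\<close> would minimise the quadratic; adding 1 to the denominator covers \<open>z = 0\<close>.\<close>
    define d where "d = inner y z - f z"
    define N where "N = (norm z)\<^sup>2 + 1"
    have "N > 0" unfolding N_def by (simp add: add_nonneg_pos)
    have "0 \<le> (- d / N)\<^sup>2 * (norm z)\<^sup>2 + 2 * (- d / N) * d"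
      using pos [of "- d / N"] by (simp add: d_def)
    also have "\<dots> \<le> (- d / N)\<^sup>2 * N + 2 * (- d / N) * d"
      by (intro add_right_mono mult_left_mono) (auto simp: N_def)
    also have "\<dots> = - d\<^sup>2 / N"
      using \<open>N > 0\<close> by (simp add: power2_eq_square field_simps)
    finally have "d\<^sup>2 \<le> 0"
      using \<open>N > 0\<close> by (simp add: field_simps)
    then show ?thesis by (simp add: d_def)
  qed
  then show ?thesis by blast
qed

text \<open>A complex-linear functional is determined by its real part, because \<open>Im (f x) = - Re (f (\<i> x))\<close>.\<close>

lemma riesz_complex:
  fixes f :: "'a :: complex_hilbert \<Rightarrow> complex"
  assumes add: "\<And>x y. f (x + y) = f x + f y" and scale: "\<And>c x. f (c *\<^sub>C x) = c * f x"
    and bound: "\<And>x. cmod (f x) \<le> K * norm x"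
  shows "\<exists>y. \<forall>x. cinner y x = f x"
proof -
  have "bounded_linear (\<lambda>x. Re (f x))"
    by (rule bounded_linear_intro [where K = K])
      (auto simp: add scale scaleR_scaleC mult.commute intro: order_trans [OF abs_Re_le_cmod bound])
  then obtain y where y: "\<And>x. Re (f x) = inner y x"
    using riesz_real by blast
  have "cinner y x = f x" for x
  proof (rule complex_eqI)
    show "Re (cinner y x) = Re (f x)"
      by (simp add: y inner_eq_Re_cinner)
    show "Im (cinner y x) = Im (f x)"
      using y [of "\<i> *\<^sub>C x"] by (simp add: scale inner_eq_Re_cinner cinner_scaleC_right)
  qed
  then show ?thesis by blast
qed


section \<open>Bounded operators on a Hilbert space\<close>

lemma norm_bop_apply_le: "norm (T $$ x) \<le> norm T * norm x"
  by transfer (rule norm_blinfun)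

lemma norm_bop_le: "0 \<le> C \<Longrightarrow> (\<And>x. norm (T $$ x) \<le> C * norm x) \<Longrightarrow> norm T \<le> C"
  by transfer (rule norm_blinfun_bound)

lemma bop_apply_zero_right [simp]: "T $$ 0 = 0"
  using bop_apply_simps(9) [of T 0 0] by simp

lemma bop_apply_minus_right [simp]: "T $$ (- x) = - (T $$ x)"
  using bop_apply_simps(9) [of T x "- x"] by (simp add: eq_neg_iff_add_eq_0 add.commute)

lemma bop_apply_diff_right [simp]: "T $$ (x - y) = T $$ x - T $$ y"
  using bop_apply_simps(9) [of T x "- y"] by simp

lemma bop_apply_sum_right: "T $$ (\<Sum>i\<in>I. f i) = (\<Sum>i\<in>I. T $$ f i)"
  by (induction I rule: infinite_finite_induct) simp_all

lemma bop_apply_sum_left: "(\<Sum>i\<in>I. f i) $$ x = (\<Sum>i\<in>I. f i $$ x)"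
  by (induction I rule: infinite_finite_induct) simp_all

lemma bop_scaleR_scaleC: "r *\<^sub>R T = complex_of_real r *\<^sub>C (T :: 'a :: complex_hilbert bop)"
  by (rule bop_eqI) (simp add: scaleR_scaleC)

lemma norm_bop_scaleC: "norm (c *\<^sub>C T) = cmod c * norm (T :: 'a :: complex_hilbert bop)"
proof (rule antisym)
  have le: "norm (c *\<^sub>C T) \<le> cmod c * norm T" for c and T :: "'a bop"
  proof (rule norm_bop_le)
    fix x
    show "norm ((c *\<^sub>C T) $$ x) \<le> cmod c * norm T * norm x"
      using mult_left_mono [OF norm_bop_apply_le [of T x] norm_ge_zero [of c]]
      by (simp add: norm_scaleC mult.assoc)
  qed simp
  show "norm (c *\<^sub>C T) \<le> cmod c * norm T" by (rule le)
  show "cmod c * norm T \<le> norm (c *\<^sub>C T)"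
  proof (cases "c = 0")
    case False
    have "norm T = norm (inverse c *\<^sub>C c *\<^sub>C T)"
      using False by (simp add: scaleC_scaleC scaleC_one)
    also have "\<dots> \<le> cmod (inverse c) * norm (c *\<^sub>C T)" by (rule le)
    finally show ?thesis
      using False by (simp add: norm_inverse norm_divide field_simps)
  qed simp
qed

lemma bop_scaleC_mult:
  fixes S T :: "'a :: complex_hilbert bop"
  shows "(c *\<^sub>C S) * T = c *\<^sub>C (S * T)" "S * (c *\<^sub>C T) = c *\<^sub>C (S * T)"
  by (rule bop_eqI, simp)+

lemma bop_exists:
  fixes T :: "'a :: complex_hilbert \<Rightarrow> 'a"
  assumes "\<And>x y. T (x + y) = T x + T y" "\<And>c x. T (c *\<^sub>C x) = c *\<^sub>C T x"
    and "\<And>x. norm (T x) \<le> K * norm x"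
  shows "\<exists>S. \<forall>x. S $$ x = T x"
proof -
  have "bounded_linear T"
    by (rule bounded_linear_intro [where K = K]) (auto simp: assms scaleR_scaleC mult.commute)
  then have "blinfun_apply (Blinfun T) x = T x" for x
    by (rule bounded_linear_Blinfun_apply [THEN fun_cong])
  then have "Bop (Blinfun T) $$ x = T x" for x
    by (simp add: bop_apply.rep_eq Bop_inverse assms)
  then show ?thesis by blast
qed

text \<open>Adjoints, weak limits of completely positive maps and extended maps are all obtained by first
  constructing the form of the operator in question.\<close>

lemma bop_of_sesquilinear:
  fixes b :: "'a :: complex_hilbert \<Rightarrow> 'a \<Rightarrow> complex"
  assumes addl: "\<And>x y z. b (x + y) z = b x z + b y z"
    and addr: "\<And>x y z. b x (y + z) = b x y + b x z"
    and scalel: "\<And>c x y. b (c *\<^sub>C x) y = cnj c * b x y"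
    and scaler: "\<And>c x y. b x (c *\<^sub>C y) = c * b x y"
    and bound: "\<And>x y. cmod (b x y) \<le> K * norm x * norm y"
  shows "\<exists>T. \<forall>x y. cinner x (T $$ y) = b x y"
proof -
  have "\<exists>w. \<forall>x. cinner w x = cnj (b x y)" for y
    by (rule riesz_complex [where K = "K * norm y"])
      (auto simp: addl scalel intro: order_trans [OF bound] simp: mult_ac)
  then obtain T where "\<And>x y. cinner (T y) x = cnj (b x y)"
    by metis
  then have T: "\<And>x y. cinner x (T y) = b x y"
    by (metis cinner_commute complex_cnj_cnj)
  have "\<exists>S. \<forall>x. S $$ x = T x"
  proof (rule bop_exists [where K = "K"])
    show "T (x + y) = T x + T y" "T (c *\<^sub>C x) = c *\<^sub>C T x" for x y c
      by (rule cinner_eqI, simp add: T cinner_simps addr scaler)+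
    show "norm (T y) \<le> K * norm y" for y
    proof (cases "T y = 0")
      case True
      have "0 \<le> K * norm y * norm y"
        using order_trans [OF norm_ge_zero bound [of y y]] by (simp add: mult_ac)
      then show ?thesis using True
        by (cases "norm y = 0") (auto simp: zero_le_mult_iff)
    next
      case False
      have "(norm (T y))\<^sup>2 \<le> K * norm (T y) * norm y"
        using bound [of "T y" y] unfolding T [symmetric] cinner_self
        by (simp del: of_real_power)
      then show ?thesis using False by (simp add: power2_eq_square mult_ac)
    qed
  qed
  then show ?thesis using T by metis
qed

lemma cinner_adj_left: "cinner (adj T $$ x) y = cinner x (T $$ y)"
proof -
  have "\<exists>S. \<forall>x y. cinner x (S $$ y) = cinner (T $$ x) y"
    by (rule bop_of_sesquilinear [where K = "norm T"])
      (auto simp: cinner_simps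
        intro!: order_trans [OF cmod_cinner_le] mult_right_mono norm_bop_apply_le)
  then obtain S where S: "\<And>x y. cinner (S $$ x) y = cinner x (T $$ y)"
    by (metis cinner_commute)
  have "adj T = S"
    unfolding adj_def
  proof (rule the_equality)
    show "\<forall>x y. cinner (S $$ x) y = cinner x (T $$ y)" using S by blast
    show "T' = S" if "\<forall>x y. cinner (T' $$ x) y = cinner x (T $$ y)" for T'
      by (rule bop_eqI, rule cinner_eqI) (metis S cinner_commute that)
  qed
  then show ?thesis using S by simp
qed

lemma cinner_adj_right: "cinner x (adj T $$ y) = cinner (T $$ x) y"
  by (metis cinner_adj_left cinner_commute)

lemma bop_eqI_cinner: "(\<And>x y. cinner x (S $$ y) = cinner x (T $$ y)) \<Longrightarrow> S = T"
  by (rule bop_eqI, rule cinner_eqI)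

lemma adj_adj [simp]: "adj (adj T) = T"
  by (rule bop_eqI_cinner) (simp add: cinner_adj_right cinner_adj_left)

lemma adj_add: "adj (S + T) = adj S + adj T"
  by (rule bop_eqI_cinner) (simp add: cinner_adj_right cinner_simps)

lemma adj_diff: "adj (S - T) = adj S - adj T"
  by (rule bop_eqI_cinner) (simp add: cinner_adj_right cinner_simps)

lemma adj_scaleC: "adj (c *\<^sub>C T) = cnj c *\<^sub>C adj T"
  by (rule bop_eqI_cinner) (simp add: cinner_adj_right cinner_simps)

lemma adj_mult: "adj (S * T) = adj T * adj S"
  by (rule bop_eqI_cinner) (simp add: cinner_adj_right)

lemma adj_one [simp]: "adj 1 = 1"
  by (rule bop_eqI_cinner) (simp add: cinner_adj_right)

lemma adj_zero [simp]: "adj 0 = 0"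
  by (rule bop_eqI_cinner) (simp add: cinner_adj_right)

lemma adj_sum: "adj (\<Sum>i\<in>I. f i) = (\<Sum>i\<in>I. adj (f i))"
  by (induction I rule: infinite_finite_induct) (simp_all add: adj_add)

lemma norm_bop_le_cinner:
  assumes "0 \<le> C" "\<And>x y. cmod (cinner x (T $$ y)) \<le> C * norm x * norm y"
  shows "norm T \<le> C"
proof (rule norm_bop_le)
  fix y
  have "(norm (T $$ y))\<^sup>2 \<le> C * norm (T $$ y) * norm y"
    using assms(2) [of "T $$ y" y] unfolding cinner_self by (simp del: of_real_power)
  then show "norm (T $$ y) \<le> C * norm y"
    using assms(1) by (cases "T $$ y = 0") (auto simp: power2_eq_square mult_ac)
qed fact

lemma cmod_cinner_bop_le: "cmod (cinner x (T $$ y)) \<le> norm T * norm x * norm y"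
  using order_trans [OF cmod_cinner_le mult_left_mono [OF norm_bop_apply_le norm_ge_zero]]
  by (simp add: mult_ac)

lemma norm_adj [simp]: "norm (adj T) = norm T"
proof -
  have le: "norm (adj T) \<le> norm T" for T :: "'a bop"
  proof (rule norm_bop_le_cinner)
    show "cmod (cinner x (adj T $$ y)) \<le> norm T * norm x * norm y" for x y
      using cmod_cinner_bop_le [of y T x]
      by (metis cinner_adj_right cinner_commute complex_mod_cnj mult.assoc mult.commute)
  qed simp
  show ?thesis using le [of T] le [of "adj T"] by simp
qed

lemma bounded_linear_adj: "bounded_linear adj"
  by (rule bounded_linear_intro [where K = 1])
    (auto simp: adj_add bop_scaleR_scaleC adj_scaleC)

lemma norm_adj_mult_self: "norm (adj T * T) = (norm T)\<^sup>2"
proof (rule antisym)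
  show "norm (adj T * T) \<le> (norm T)\<^sup>2"
    using norm_mult_ineq [of "adj T" T] by (simp add: power2_eq_square)
  have "norm T \<le> sqrt (norm (adj T * T))"
  proof (rule norm_bop_le)
    fix x
    have "(norm (T $$ x))\<^sup>2 = cmod (cinner x ((adj T * T) $$ x))"
      by (simp add: cinner_adj_right cinner_self norm_power)
    also have "\<dots> \<le> norm (adj T * T) * (norm x)\<^sup>2"
      using cmod_cinner_bop_le [of x "adj T * T" x] by (simp add: power2_eq_square mult.assoc)
    finally show "norm (T $$ x) \<le> sqrt (norm (adj T * T)) * norm x"
      by - (rule power2_le_imp_le, auto simp: power_mult_distrib)
  qed simp
  then have "(norm T)\<^sup>2 \<le> (sqrt (norm (adj T * T)))\<^sup>2"
    by (intro power_mono) auto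
  then show "(norm T)\<^sup>2 \<le> norm (adj T * T)"
    by simp
qed

text \<open>Complex linearity survives pointwise limits, so the operators that commute with complex scalars
  are closed in the Banach space of real-linear ones.\<close>

instance bop :: (complex_hilbert) banach
proof
  fix X :: "nat \<Rightarrow> 'a bop"
  assume "Cauchy X"
  have dist: "norm (blinfun_of_bop S - blinfun_of_bop T) = norm (S - T)" for S T :: "'a bop"
    by transfer simp
  have "Cauchy (\<lambda>n. blinfun_of_bop (X n))"
    using \<open>Cauchy X\<close> by (simp add: Cauchy_def dist_norm dist)
  then obtain L where L: "(\<lambda>n. blinfun_of_bop (X n)) \<longlonglongrightarrow> L"
    using convergent_eq_Cauchy by blast
  then have lim: "(\<lambda>n. X n $$ x) \<longlonglongrightarrow> blinfun_apply L x" for x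
    unfolding bop_apply.rep_eq by (intro blinfun.tendsto tendsto_const)
  have "blinfun_apply L (c *\<^sub>C x) = c *\<^sub>C blinfun_apply L x" for c x
  proof (rule LIMSEQ_unique)
    show "(\<lambda>n. X n $$ (c *\<^sub>C x)) \<longlonglongrightarrow> blinfun_apply L (c *\<^sub>C x)" by (rule lim)
    show "(\<lambda>n. X n $$ (c *\<^sub>C x)) \<longlonglongrightarrow> c *\<^sub>C blinfun_apply L x"
      using bounded_linear.tendsto [OF bounded_linear_scaleC lim [of x], of c] by simp
  qed
  then have "blinfun_of_bop (Bop L) = L"
    by (intro Bop_inverse) simp
  then have "norm (X n - Bop L) = norm (blinfun_of_bop (X n) - L)" for n
    using dist by metis
  then have "X \<longlonglongrightarrow> Bop L"
    using L by (simp add: tendsto_iff dist_norm)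
  then show "convergent X" by (rule convergentI)
qed

section \<open>Positive operator matrices and unital completely positive maps\<close>

text \<open>Arbitrary finite index sets are admitted because the block matrices used below are indexed
  most naturally by \<^typ>\<open>bool\<close> or by a disjoint sum.\<close>

abbreviation qform :: "'i set \<Rightarrow> ('i \<Rightarrow> 'i \<Rightarrow> 'a :: complex_hilbert bop) \<Rightarrow> ('i \<Rightarrow> 'a) \<Rightarrow> complex"
  where "qform I X \<xi> \<equiv> \<Sum>i\<in>I. \<Sum>j\<in>I. cinner (\<xi> i) (X i j $$ \<xi> j)"

definition pos_matrix :: "'i set \<Rightarrow> ('i \<Rightarrow> 'i \<Rightarrow> 'a :: complex_hilbert bop) \<Rightarrow> bool"
  where "pos_matrix I X \<longleftrightarrow>
    (\<forall>\<xi>. qform I X \<xi> \<in> \<real>\<^sub>\<ge>\<^sub>0)"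

lemma pos_matrixI:
  "(\<And>\<xi>. qform I X \<xi> \<in> \<real>\<^sub>\<ge>\<^sub>0) \<Longrightarrow> pos_matrix I X"
  by (simp add: pos_matrix_def)

lemma pos_matrixD:
  "pos_matrix I X \<Longrightarrow> qform I X \<xi> \<in> \<real>\<^sub>\<ge>\<^sub>0"
  by (simp add: pos_matrix_def)

lemma pos_matrix_cong:
  "(\<And>i j. i \<in> I \<Longrightarrow> j \<in> I \<Longrightarrow> X i j = Y i j) \<Longrightarrow> pos_matrix I X \<longleftrightarrow> pos_matrix I Y"
  by (simp add: pos_matrix_def cong: sum.cong)

lemma mat_pos_iff: "mat_pos n X \<longleftrightarrow> pos_matrix {..<n} (\<lambda>i j. X (i, j))"
  by (simp add: mat_pos_def pos_matrix_def mat_apply_def cinner_sum_right)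

lemma pos_matrix_reindex:
  fixes X :: "'i \<Rightarrow> 'i \<Rightarrow> 'c :: complex_hilbert bop"
  assumes "bij_betw h J I" "pos_matrix I X"
  shows "pos_matrix J (\<lambda>i j. X (h i) (h j))"
proof (rule pos_matrixI)
  fix \<xi> :: "_ \<Rightarrow> 'c"
  define \<xi>' where "\<xi>' i = \<xi> (inv_into J h i)" for i
  have \<xi>': "\<xi>' (h j) = \<xi> j" if "j \<in> J" for j
    using assms(1) that by (simp add: \<xi>'_def bij_betw_def inv_into_f_f)
  have "(\<Sum>i\<in>J. \<Sum>j\<in>J. cinner (\<xi> i) (X (h i) (h j) $$ \<xi> j)) =
      (\<Sum>i\<in>J. \<Sum>j\<in>J. cinner (\<xi>' (h i)) (X (h i) (h j) $$ \<xi>' (h j)))"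
    by (simp add: \<xi>' cong: sum.cong)
  also have "\<dots> = (\<Sum>i\<in>I. \<Sum>j\<in>I. cinner (\<xi>' i) (X i j $$ \<xi>' j))"
    by (subst sum.reindex_bij_betw [OF assms(1), symmetric])
      (simp add: sum.reindex_bij_betw [OF assms(1), symmetric])
  also have "\<dots> \<in> \<real>\<^sub>\<ge>\<^sub>0"
    using assms(2) by (rule pos_matrixD)
  finally show "(\<Sum>i\<in>J. \<Sum>j\<in>J. cinner (\<xi> i) (X (h i) (h j) $$ \<xi> j)) \<in> \<real>\<^sub>\<ge>\<^sub>0" .
qed

lemma pos_matrix_sum:
  "(\<And>k. k \<in> K \<Longrightarrow> pos_matrix I (X k)) \<Longrightarrow> pos_matrix I (\<lambda>i j. \<Sum>k\<in>K. X k i j)"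
proof (induction K rule: infinite_finite_induct)
  case (insert k K)
  then have "qform I (X k) \<xi> + qform I (\<lambda>i j. \<Sum>k\<in>K. X k i j) \<xi> \<in> \<real>\<^sub>\<ge>\<^sub>0" for \<xi>
    by (intro nonneg_Reals_add_I pos_matrixD) auto
  then show ?case
    using insert by (simp add: pos_matrix_def cinner_add_right sum.distrib)
qed (simp_all add: pos_matrix_def)

lemma pos_matrix_scaleR:
  assumes "pos_matrix I X" "0 \<le> c"
  shows "pos_matrix I (\<lambda>i j. c *\<^sub>R X i j)"
proof (rule pos_matrixI)
  fix \<xi>
  have "qform I (\<lambda>i j. c *\<^sub>R X i j) \<xi> = of_real c * qform I X \<xi>"
    by (simp add: cinner_simps sum_distrib_left)
  also have "\<dots> \<in> \<real>\<^sub>\<ge>\<^sub>0"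
    using assms pos_matrixD by (intro nonneg_Reals_mult_I) auto
  finally show "qform I (\<lambda>i j. c *\<^sub>R X i j) \<xi> \<in> \<real>\<^sub>\<ge>\<^sub>0" .
qed

lemma ucp_one: "ucp D \<phi> \<Longrightarrow> \<phi> 1 = 1"
  by (simp add: ucp_def)

lemma ucp_add: "ucp D \<phi> \<Longrightarrow> x \<in> D \<Longrightarrow> y \<in> D \<Longrightarrow> \<phi> (x + y) = \<phi> x + \<phi> y"
  by (simp add: ucp_def)

lemma ucp_scaleC: "ucp D \<phi> \<Longrightarrow> x \<in> D \<Longrightarrow> \<phi> (c *\<^sub>C x) = c *\<^sub>C \<phi> x"
  by (simp add: ucp_def)

lemma ucp_zero: "ucp D \<phi> \<Longrightarrow> 0 \<in> D \<Longrightarrow> \<phi> 0 = 0"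
  using ucp_scaleC [of D \<phi> 0 0] by simp

lemma ucp_diff:
  assumes "ucp D \<phi>" "csubspace D" "x \<in> D" "y \<in> D"
  shows "\<phi> (x - y) = \<phi> x - \<phi> y"
proof -
  have "x - y \<in> D" using assms by (simp add: complex_vector.subspace_diff)
  then have "\<phi> (x - y + y) = \<phi> (x - y) + \<phi> y"
    using assms ucp_add by blast
  then show ?thesis by simp
qed

lemma ucp_sum:
  assumes "ucp D \<phi>" "csubspace D" "\<And>i. i \<in> I \<Longrightarrow> f i \<in> D"
  shows "\<phi> (\<Sum>i\<in>I. f i) = (\<Sum>i\<in>I. \<phi> (f i))"
  using assms(3)
proof (induction I rule: infinite_finite_induct)
  case (insert i I)
  then have "(\<Sum>i\<in>I. f i) \<in> D"
    using assms(2) by (intro complex_vector.subspace_sum) auto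
  then show ?case using insert by (simp add: ucp_add [OF assms(1)])
qed (use assms in \<open>simp_all add: ucp_zero complex_vector.subspace_0\<close>)

lemma ucpI:
  assumes "\<phi> 1 = 1" "\<And>x y. x \<in> D \<Longrightarrow> y \<in> D \<Longrightarrow> \<phi> (x + y) = \<phi> x + \<phi> y"
    "\<And>x c. x \<in> D \<Longrightarrow> \<phi> (c *\<^sub>C x) = c *\<^sub>C \<phi> x"
    "\<And>n X. pos_matrix {..<n :: nat} X \<Longrightarrow> (\<And>i j. i < n \<Longrightarrow> j < n \<Longrightarrow> X i j \<in> D) \<Longrightarrow>
      pos_matrix {..<n} (\<lambda>i j. \<phi> (X i j))"
  shows "ucp D \<phi>"
  unfolding ucp_def
proof (intro conjI ballI allI impI)
  fix n :: nat and X
  assume X: "X \<in> idx n \<rightarrow>\<^sub>E D" and "mat_pos n X"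
  then have "pos_matrix {..<n} (\<lambda>i j. \<phi> (X (i, j)))"
    by (intro assms(4)) (auto simp: mat_pos_iff)
  moreover have "mat_map n \<phi> X (i, j) = \<phi> (X (i, j))" if "i < n" "j < n" for i j
    using that by (simp add: compose_def)
  ultimately show "mat_pos n (mat_map n \<phi> X)"
    unfolding mat_pos_iff by (subst pos_matrix_cong) auto
qed (use assms in auto)

lemma ucp_pos_matrix:
  assumes "ucp D \<phi>" "finite I" "pos_matrix I X" "\<And>i j. i \<in> I \<Longrightarrow> j \<in> I \<Longrightarrow> X i j \<in> D"
  shows "pos_matrix I (\<lambda>i j. \<phi> (X i j))"
proof (cases "I = {}")
  case True
  then show ?thesis by (simp add: pos_matrix_def)
next
  case False
  define n where "n = card I"
  have "n > 0" using False assms(2) by (simp add: n_def card_gt_0_iff)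
  obtain h where h: "bij_betw h {..<n} I"
    using assms(2) ex_bij_betw_nat_finite [of I] by (auto simp: n_def atLeast0LessThan)
  then have hI: "h i \<in> I" if "i < n" for i
    using that by (auto simp: bij_betw_def)
  define Y where "Y = (\<lambda>(i, j)\<in>idx n. X (h i) (h j))"
  have "Y \<in> idx n \<rightarrow>\<^sub>E D"
    by (auto simp: Y_def hI assms(4))
  moreover have "mat_pos n Y"
    unfolding mat_pos_iff using pos_matrix_reindex [OF h assms(3)]
    by (subst pos_matrix_cong [where Y = "\<lambda>i j. X (h i) (h j)"]) (auto simp: Y_def)
  ultimately have "mat_pos n (mat_map n \<phi> Y)"
    using assms(1) \<open>n > 0\<close> by (auto simp: ucp_def)
  then have "pos_matrix {..<n} (\<lambda>i j. \<phi> (X (h i) (h j)))"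
    unfolding mat_pos_iff
    by (subst (asm) pos_matrix_cong [where Y = "\<lambda>i j. \<phi> (X (h i) (h j))"])
      (auto simp: Y_def compose_def)
  from pos_matrix_reindex [OF bij_betw_inv_into [OF h] this]
  show ?thesis
    using h by (subst (asm) pos_matrix_cong [where Y = "\<lambda>i j. \<phi> (X i j)"])
      (auto simp: bij_betw_inv_into_right)
qed

lemma ucp_id: "ucp D (\<lambda>x. x)"
  by (rule ucpI) auto

lemma ucp_compose:
  assumes "ucp D \<phi>" "ucp E \<psi>" "\<And>x. x \<in> D \<Longrightarrow> \<phi> x \<in> E"
  shows "ucp D (\<lambda>x. \<psi> (\<phi> x))"
proof (rule ucpI)
  fix n :: nat and X
  assume X: "pos_matrix {..<n} X" "\<And>i j. i < n \<Longrightarrow> j < n \<Longrightarrow> X i j \<in> D"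
  then have "pos_matrix {..<n} (\<lambda>i j. \<phi> (X i j))"
    by (intro ucp_pos_matrix [OF assms(1)]) auto
  then show "pos_matrix {..<n} (\<lambda>i j. \<psi> (\<phi> (X i j)))"
    using X assms(3) by (intro ucp_pos_matrix [OF assms(2)]) auto
qed (use assms in \<open>simp_all add: ucp_one ucp_add ucp_scaleC\<close>)

lemma ucp_subset: "ucp E \<phi> \<Longrightarrow> D \<subseteq> E \<Longrightarrow> ucp D \<phi>"
  using ucp_compose [OF ucp_id, of E \<phi> D] by auto

text \<open>A Gram matrix over $B(H)$ has the form \<open>\<xi> \<mapsto> \<Sum>\<^sub>k \<parallel>\<Sum>\<^sub>i T\<^sub>k\<^sub>i \<xi>\<^sub>i\<parallel>\<^sup>2\<close>.\<close>

lemma gram_form: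
  "qform I (\<lambda>i j. \<Sum>k\<in>K. adj (T k i) * T k j) \<xi> =
    (\<Sum>k\<in>K. cinner (\<Sum>i\<in>I. T k i $$ \<xi> i) (\<Sum>i\<in>I. T k i $$ \<xi> i))"
proof -
  have "qform I (\<lambda>i j. \<Sum>k\<in>K. adj (T k i) * T k j) \<xi> =
      (\<Sum>i\<in>I. \<Sum>j\<in>I. \<Sum>k\<in>K. cinner (T k i $$ \<xi> i) (T k j $$ \<xi> j))"
    by (simp add: bop_apply_sum_left cinner_sum_right cinner_adj_right)
  also have "\<dots> = (\<Sum>i\<in>I. \<Sum>k\<in>K. \<Sum>j\<in>I. cinner (T k i $$ \<xi> i) (T k j $$ \<xi> j))"
    by (intro sum.cong refl sum.swap)
  also have "\<dots> = (\<Sum>k\<in>K. \<Sum>i\<in>I. \<Sum>j\<in>I. cinner (T k i $$ \<xi> i) (T k j $$ \<xi> j))"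
    by (rule sum.swap)
  also have "\<dots> = (\<Sum>k\<in>K. cinner (\<Sum>i\<in>I. T k i $$ \<xi> i) (\<Sum>i\<in>I. T k i $$ \<xi> i))"
    by (simp only: cinner_sum_left) (simp only: cinner_sum_right)
  finally show ?thesis .
qed

lemma pos_matrix_gram:
  "pos_matrix I (\<lambda>i j. \<Sum>k\<in>K. adj (T k i) * T k j)"
  unfolding pos_matrix_def gram_form cinner_self
  by (auto simp: complex_nonneg_Reals_iff sum_nonneg)

text \<open>Varying the phases of \<open>\<xi>\<close> and \<open>\<eta>\<close> in a nonnegative block form determines one off-diagonal
  entry from the other and bounds it by the diagonal.\<close>

lemma block_form:
  fixes b b' :: "'a :: complex_hilbert \<Rightarrow> 'a \<Rightarrow> complex"
  assumes pos: "\<And>\<xi> \<eta>. complex_of_real (c * ((norm \<xi>)\<^sup>2 + (norm \<eta>)\<^sup>2)) + b \<xi> \<eta> + b' \<eta> \<xi> \<in> \<real>\<^sub>\<ge>\<^sub>0"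
    and scale: "\<And>u x y. b x (u *\<^sub>C y) = u * b x y" "\<And>u x y. b (u *\<^sub>C x) y = cnj u * b x y"
      "\<And>u x y. b' x (u *\<^sub>C y) = u * b' x y" "\<And>u x y. b' (u *\<^sub>C x) y = cnj u * b' x y"
  shows "b' \<eta> \<xi> = cnj (b \<xi> \<eta>)" "cmod (b \<xi> \<eta>) \<le> c * norm \<xi> * norm \<eta>"
proof -
  have sym: "b' \<eta> \<xi> = cnj (b \<xi> \<eta>)" for \<xi> \<eta>
    using pos [of \<xi> \<eta>] pos [of \<xi> "\<i> *\<^sub>C \<eta>"]
    by (simp add: complex_eq_iff complex_nonneg_Reals_iff scale)
  then show "b' \<eta> \<xi> = cnj (b \<xi> \<eta>)" .
  have unit: "cmod (b \<xi> \<eta>) \<le> c" if "norm \<xi> = 1" "norm \<eta> = 1" for \<xi> \<eta>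
  proof (cases "b \<xi> \<eta> = 0")
    case True
    then show ?thesis using pos [of \<xi> \<eta>] that sym by (simp add: complex_nonneg_Reals_iff)
  next
    case False
    define u where "u = - cnj (sgn (b \<xi> \<eta>))"
    have "cmod u = 1" using False by (simp add: u_def norm_sgn)
    have u: "u * b \<xi> \<eta> = - of_real (cmod (b \<xi> \<eta>))"
      unfolding u_def using False
      by (simp add: sgn_eq complex_norm_square [symmetric] power2_eq_square mult.commute
          divide_simps flip: of_real_mult)
    have "b \<xi> (u *\<^sub>C \<eta>) = - of_real (cmod (b \<xi> \<eta>))"
      by (simp add: scale u)
    then show ?thesis
      using pos [of \<xi> "u *\<^sub>C \<eta>"] sym [of "u *\<^sub>C \<eta>" \<xi>] that \<open>cmod u = 1\<close>
      by (simp add: complex_nonneg_Reals_iff norm_scaleC)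
  qed
  show "cmod (b \<xi> \<eta>) \<le> c * norm \<xi> * norm \<eta>"
  proof (cases "\<xi> = 0 \<or> \<eta> = 0")
    case True
    then show ?thesis using scale(1) [of \<xi> 0 0] scale(2) [of 0 0 \<eta>] by auto
  next
    case False
    define \<xi>' where "\<xi>' = of_real (1 / norm \<xi>) *\<^sub>C \<xi>"
    define \<eta>' where "\<eta>' = of_real (1 / norm \<eta>) *\<^sub>C \<eta>"
    have "b \<xi>' \<eta>' = of_real (1 / norm \<xi>) * of_real (1 / norm \<eta>) * b \<xi> \<eta>"
      unfolding \<xi>'_def \<eta>'_def by (simp add: scale)
    moreover have "cmod (b \<xi>' \<eta>') \<le> c"
      using False by (intro unit) (auto simp: \<xi>'_def \<eta>'_def norm_scaleC norm_divide)
    ultimately show ?thesis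
      using False by (simp add: norm_mult norm_divide field_simps)
  qed
qed

lemma pos_matrix_bool_iff:
  "pos_matrix UNIV X \<longleftrightarrow>
    (\<forall>\<xi> \<eta>. cinner \<xi> (X False False $$ \<xi>) + cinner \<eta> (X True True $$ \<eta>) +
      cinner \<xi> (X False True $$ \<eta>) + cinner \<eta> (X True False $$ \<xi>) \<in> \<real>\<^sub>\<ge>\<^sub>0)"
  (is "_ \<longleftrightarrow> ?R")
proof -
  have sum: "(\<Sum>i\<in>UNIV. f i) = f False + f True" for f :: "bool \<Rightarrow> complex"
    by (simp add: UNIV_bool add.commute)
  show ?thesis
  proof
    assume "pos_matrix UNIV X"
    show ?R
    proof (intro allI)
      fix \<xi> \<eta>
      show "cinner \<xi> (X False False $$ \<xi>) + cinner \<eta> (X True True $$ \<eta>) +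
          cinner \<xi> (X False True $$ \<eta>) + cinner \<eta> (X True False $$ \<xi>) \<in> \<real>\<^sub>\<ge>\<^sub>0"
        using pos_matrixD [OF \<open>pos_matrix UNIV X\<close>, of "\<lambda>i. if i then \<eta> else \<xi>"]
        by (simp add: sum add_ac)
    qed
  next
    assume ?R
    then show "pos_matrix UNIV X"
      by (simp add: pos_matrix_def sum algebra_simps)
  qed
qed

text \<open>This block matrix is what lets complete positivity control adjoints and norms: its positivity is
  preserved by unital completely positive maps, and the lemma \<open>block_form\<close> reads both facts off from it.\<close>

lemma pos_matrix_norm_block:
  assumes "norm T \<le> c"
  shows "pos_matrix UNIV (\<lambda>i j. if i = j then c *\<^sub>R 1 else if j then T else adj T)"
  unfolding pos_matrix_bool_iff
proof (intro allI)
  fix \<xi> \<eta>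
  have "2 * cmod (cinner \<xi> (T $$ \<eta>)) \<le> 2 * (c * norm \<xi> * norm \<eta>)"
    using order_trans [OF cmod_cinner_bop_le [of \<xi> T \<eta>]] assms
    by (simp add: mult_right_mono)
  also have "\<dots> = c * (2 * (norm \<xi> * norm \<eta>))" by simp
  also have "\<dots> \<le> c * ((norm \<xi>)\<^sup>2 + (norm \<eta>)\<^sup>2)"
    using order_trans [OF norm_ge_zero assms] sum_squares_bound [of "norm \<xi>" "norm \<eta>"]
    by (intro mult_left_mono) auto
  finally have le: "2 * cmod (cinner \<xi> (T $$ \<eta>)) \<le> c * ((norm \<xi>)\<^sup>2 + (norm \<eta>)\<^sup>2)" .
  have "cinner \<eta> (adj T $$ \<xi>) = cnj (cinner \<xi> (T $$ \<eta>))"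
    by (metis cinner_adj_right cinner_commute)
  then show "cinner \<xi> ((if False = False then c *\<^sub>R 1 else if False then T else adj T) $$ \<xi>) +
        cinner \<eta> ((if True = True then c *\<^sub>R 1 else if True then T else adj T) $$ \<eta>) +
        cinner \<xi> ((if False = True then c *\<^sub>R 1 else if True then T else adj T) $$ \<eta>) +
        cinner \<eta> ((if True = False then c *\<^sub>R 1 else if False then T else adj T) $$ \<xi>) \<in> \<real>\<^sub>\<ge>\<^sub>0"
    using le abs_Re_le_cmod [of "cinner \<xi> (T $$ \<eta>)"]
    by (simp add: complex_nonneg_Reals_iff cinner_simps cinner_self algebra_simps
        del: of_real_power)
qed

lemma ucp_adj_norm:
  assumes "ucp D \<phi>" "operator_system D" "x \<in> D"
  shows ucp_adj: "\<phi> (adj x) = adj (\<phi> x)" and ucp_norm_le: "norm (\<phi> x) \<le> norm x"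
proof -
  have D: "csubspace D" "1 \<in> D" "adj x \<in> D"
    using assms by (auto simp: operator_system_def)
  define X where "X i j = (if i = j then norm x *\<^sub>R 1 else if j then x else adj x)" for i j
  have "pos_matrix UNIV X"
    unfolding X_def by (rule pos_matrix_norm_block) simp
  then have "pos_matrix UNIV (\<lambda>i j. \<phi> (X i j))"
    using D assms
    by (intro ucp_pos_matrix [OF assms(1) _ \<open>pos_matrix UNIV X\<close>])
      (auto simp: X_def bop_scaleR_scaleC complex_vector.subspace_scale)
  then have "cinner \<xi> (\<phi> (norm x *\<^sub>R 1) $$ \<xi>) + cinner \<eta> (\<phi> (norm x *\<^sub>R 1) $$ \<eta>) +
      cinner \<xi> (\<phi> x $$ \<eta>) + cinner \<eta> (\<phi> (adj x) $$ \<xi>) \<in> \<real>\<^sub>\<ge>\<^sub>0" for \<xi> \<eta>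
    unfolding pos_matrix_bool_iff by (simp add: X_def)
  moreover have "\<phi> (norm x *\<^sub>R 1) = norm x *\<^sub>R 1"
    using ucp_scaleC [OF assms(1) D(2)] ucp_one [OF assms(1)] by (simp add: bop_scaleR_scaleC)
  ultimately have "complex_of_real (norm x * ((norm \<xi>)\<^sup>2 + (norm \<eta>)\<^sup>2)) +
      cinner \<xi> (\<phi> x $$ \<eta>) + cinner \<eta> (\<phi> (adj x) $$ \<xi>) \<in> \<real>\<^sub>\<ge>\<^sub>0" for \<xi> \<eta>
    by (simp add: cinner_simps cinner_self distrib_left)
  note pos = this
  have "cinner \<eta> (\<phi> (adj x) $$ \<xi>) = cnj (cinner \<xi> (\<phi> x $$ \<eta>))" for \<xi> \<eta>
    by (rule block_form(1) [OF pos]) (simp_all add: cinner_simps)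
  then show "\<phi> (adj x) = adj (\<phi> x)"
    by (intro bop_eqI_cinner) (metis cinner_adj_right cinner_commute)
  have "cmod (cinner \<xi> (\<phi> x $$ \<eta>)) \<le> norm x * norm \<xi> * norm \<eta>" for \<xi> \<eta>
    by (rule block_form(2) [OF pos]) (simp_all add: cinner_simps)
  then show "norm (\<phi> x) \<le> norm x"
    by (intro norm_bop_le_cinner) auto
qed

lemma operator_system_UNIV: "operator_system UNIV"
  by (simp add: operator_system_def)

lemma ucp_bounded_linear:
  assumes "ucp UNIV \<phi>"
  shows "bounded_linear \<phi>"
  by (rule bounded_linear_intro [where K = 1])
    (use assms in \<open>auto simp: ucp_add ucp_scaleC bop_scaleR_scaleC
      intro: ucp_norm_le [OF _ operator_system_UNIV]\<close>)

text \<open>A Schwarz inequality: the Gram matrix of the rows \<open>T k\<close>, enlarged by rows of the identity, is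
  positive, and positivity of its image is tested on vectors that complete the square.\<close>

lemma ucp_schwarz:
  fixes T :: "'k \<Rightarrow> 'i \<Rightarrow> 'a :: complex_hilbert bop"
  assumes \<phi>: "ucp UNIV \<phi>" and fin: "finite I" "finite K"
  shows "pos_matrix I (\<lambda>i j. \<Sum>k\<in>K. \<phi> (adj (T k i) * T k j) - adj (\<phi> (T k i)) * \<phi> (T k j))"
proof (rule pos_matrixI)
  fix \<xi> :: "'i \<Rightarrow> 'a"
  define U :: "'k \<Rightarrow> 'i + 'k \<Rightarrow> 'a bop"
    where "U k = case_sum (T k) (\<lambda>l. if k = l then 1 else 0)" for k
  \<comment> \<open>Completing the square: on the identity rows the test vector is minus what the other rows produce.\<close>
  define z where "z l = (\<Sum>j\<in>I. \<phi> (T l j) $$ \<xi> j)" for l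
  define \<zeta> where "\<zeta> = case_sum \<xi> (\<lambda>l. - z l)"
  define G where "G i j = \<phi> (\<Sum>k\<in>K. adj (U k i) * U k j)" for i j
  define F where "F i j = cinner (\<zeta> i) (G i j $$ \<zeta> j)" for i j
  have \<phi>_sum: "\<phi> (\<Sum>k\<in>K. f k) = (\<Sum>k\<in>K. \<phi> (f k))" for f
    by (rule ucp_sum [OF \<phi>]) auto
  have \<phi>_adj: "\<phi> (adj x) = adj (\<phi> x)" for x
    using ucp_adj [OF \<phi> operator_system_UNIV] by simp
  have \<phi>_01: "\<phi> 0 = 0" "\<phi> 1 = 1"
    using \<phi> by (simp_all add: ucp_zero ucp_one)
  have "pos_matrix (I <+> K) G"
    unfolding G_def by (rule ucp_pos_matrix [OF \<phi>]) (simp_all add: fin pos_matrix_gram)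
  then have "(\<Sum>i\<in>I <+> K. \<Sum>j\<in>I <+> K. F i j) \<in> \<real>\<^sub>\<ge>\<^sub>0"
    unfolding F_def by (rule pos_matrixD)
  also have "(\<Sum>i\<in>I <+> K. \<Sum>j\<in>I <+> K. F i j) =
      (\<Sum>i\<in>I. (\<Sum>j\<in>I. F (Inl i) (Inl j)) + (\<Sum>l\<in>K. F (Inl i) (Inr l))) +
      (\<Sum>m\<in>K. (\<Sum>j\<in>I. F (Inr m) (Inl j)) + (\<Sum>l\<in>K. F (Inr m) (Inr l)))"
    using fin by (simp add: sum.Plus)
  also have "\<dots> = (\<Sum>i\<in>I. \<Sum>j\<in>I. F (Inl i) (Inl j)) + (\<Sum>i\<in>I. \<Sum>l\<in>K. F (Inl i) (Inr l)) +
      (\<Sum>m\<in>K. \<Sum>j\<in>I. F (Inr m) (Inl j)) + (\<Sum>m\<in>K. \<Sum>l\<in>K. F (Inr m) (Inr l))"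
    by (simp add: sum.distrib)
  also have "(\<Sum>i\<in>I. \<Sum>l\<in>K. F (Inl i) (Inr l)) = - (\<Sum>l\<in>K. cinner (z l) (z l))"
  proof -
    have "F (Inl i) (Inr l) = - cinner (\<phi> (T l i) $$ \<xi> i) (z l)" if "l \<in> K" for i l
    proof -
      have "(\<Sum>k\<in>K. adj (U k (Inl i)) * U k (Inr l)) = (\<Sum>k\<in>K. if k = l then adj (T k i) else 0)"
        by (rule sum.cong) (auto simp: U_def)
      also have "\<dots> = adj (T l i)"
        using that fin by simp
      finally show ?thesis
        unfolding F_def G_def by (simp add: \<zeta>_def \<phi>_adj cinner_adj_right cinner_simps)
    qed
    then have "(\<Sum>i\<in>I. \<Sum>l\<in>K. F (Inl i) (Inr l)) =
        (\<Sum>i\<in>I. \<Sum>l\<in>K. - cinner (\<phi> (T l i) $$ \<xi> i) (z l))"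
      by simp
    also have "\<dots> = (\<Sum>l\<in>K. \<Sum>i\<in>I. - cinner (\<phi> (T l i) $$ \<xi> i) (z l))"
      by (rule sum.swap)
    also have "\<dots> = - (\<Sum>l\<in>K. cinner (z l) (z l))"
      by (subst (2) z_def) (simp add: cinner_sum_left sum_negf)
    finally show ?thesis .
  qed
  also have "(\<Sum>m\<in>K. \<Sum>j\<in>I. F (Inr m) (Inl j)) = - (\<Sum>l\<in>K. cinner (z l) (z l))"
  proof -
    have "F (Inr m) (Inl j) = - cinner (z m) (\<phi> (T m j) $$ \<xi> j)" if "m \<in> K" for m j
    proof -
      have "(\<Sum>k\<in>K. adj (U k (Inr m)) * U k (Inl j)) = (\<Sum>k\<in>K. if k = m then T k j else 0)"
        by (rule sum.cong) (auto simp: U_def)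
      also have "\<dots> = T m j"
        using that fin by simp
      finally show ?thesis
        unfolding F_def G_def by (simp add: \<zeta>_def cinner_simps)
    qed
    then have "(\<Sum>m\<in>K. \<Sum>j\<in>I. F (Inr m) (Inl j)) =
        (\<Sum>m\<in>K. \<Sum>j\<in>I. - cinner (z m) (\<phi> (T m j) $$ \<xi> j))"
      by simp
    also have "\<dots> = - (\<Sum>m\<in>K. cinner (z m) (z m))"
      by (subst (3) z_def) (simp add: cinner_sum_right sum_negf)
    finally show ?thesis .
  qed
  also have "(\<Sum>m\<in>K. \<Sum>l\<in>K. F (Inr m) (Inr l)) = (\<Sum>l\<in>K. cinner (z l) (z l))"
  proof -
    have "F (Inr m) (Inr l) = (if m = l then cinner (z m) (z m) else 0)" if "m \<in> K" "l \<in> K" for m l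
    proof -
      have "(\<Sum>k\<in>K. adj (U k (Inr m)) * U k (Inr l)) = (\<Sum>k\<in>K. if k = m then if m = l then 1 else 0 else 0)"
        by (rule sum.cong) (auto simp: U_def)
      also have "\<dots> = (if m = l then 1 else 0)"
        using that fin by simp
      finally show ?thesis
        unfolding F_def G_def by (simp add: \<zeta>_def cinner_simps \<phi>_01)
    qed
    then show ?thesis using fin by simp
  qed
  also have "(\<Sum>i\<in>I. \<Sum>j\<in>I. F (Inl i) (Inl j)) + - (\<Sum>l\<in>K. cinner (z l) (z l)) +
      - (\<Sum>l\<in>K. cinner (z l) (z l)) + (\<Sum>l\<in>K. cinner (z l) (z l)) =
      (\<Sum>i\<in>I. \<Sum>j\<in>I. F (Inl i) (Inl j)) - (\<Sum>l\<in>K. cinner (z l) (z l))"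
    by simp
  also have "(\<Sum>l\<in>K. cinner (z l) (z l)) = qform I (\<lambda>i j. \<Sum>k\<in>K. adj (\<phi> (T k i)) * \<phi> (T k j)) \<xi>"
    unfolding z_def by (rule gram_form [symmetric])
  also have "(\<Sum>i\<in>I. \<Sum>j\<in>I. F (Inl i) (Inl j)) - \<dots> =
      qform I (\<lambda>i j. \<Sum>k\<in>K. \<phi> (adj (T k i) * T k j) - adj (\<phi> (T k i)) * \<phi> (T k j)) \<xi>"
    by (simp add: F_def G_def U_def \<zeta>_def \<phi>_sum sum_subtractf cinner_simps)
  finally show "qform I (\<lambda>i j. \<Sum>k\<in>K. \<phi> (adj (T k i) * T k j) - adj (\<phi> (T k i)) * \<phi> (T k j)) \<xi> \<in> \<real>\<^sub>\<ge>\<^sub>0" .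
qed

text \<open>With a vanishing corner the form is affine in the first vector; an affine function that stays
  nonnegative under real scaling of its argument is constant.\<close>

lemma pos_matrix_zero_corner:
  assumes "pos_matrix UNIV X" "X False False = 0"
  shows "X False True = 0"
proof -
  define b where "b \<xi> \<eta> = cinner \<xi> (X False True $$ \<eta>)" for \<xi> \<eta>
  define b' where "b' \<eta> \<xi> = cinner \<eta> (X True False $$ \<xi>)" for \<eta> \<xi>
  define q where "q \<eta> = cinner \<eta> (X True True $$ \<eta>)" for \<eta>
  have pos: "q \<eta> + b \<xi> \<eta> + b' \<eta> \<xi> \<in> \<real>\<^sub>\<ge>\<^sub>0" for \<xi> \<eta>
    using assms unfolding pos_matrix_bool_iff by (simp add: q_def b_def b'_def)
  have scaleR: "b (t *\<^sub>R \<xi>) \<eta> = t * b \<xi> \<eta>" "b' \<eta> (t *\<^sub>R \<xi>) = t * b' \<eta> \<xi>" for t \<xi> \<eta>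
    by (simp_all add: b_def b'_def cinner_simps)
  have "b \<xi> \<eta> + b' \<eta> \<xi> = 0" for \<xi> \<eta>
  proof (rule complex_eqI)
    define r where "r = Re (b \<xi> \<eta> + b' \<eta> \<xi>)"
    have ge: "Re (q \<eta>) + t * r \<ge> 0" for t
      using pos [of \<eta> "t *\<^sub>R \<xi>"]
      by (simp add: complex_nonneg_Reals_iff scaleR r_def algebra_simps)
    show "Re (b \<xi> \<eta> + b' \<eta> \<xi>) = Re 0"
    proof (rule ccontr)
      assume "Re (b \<xi> \<eta> + b' \<eta> \<xi>) \<noteq> Re 0"
      \<comment> \<open>At this multiple of \<open>\<xi>\<close> the affine function takes the value \<open>-1\<close>.\<close>
      then show False
        using ge [of "- (Re (q \<eta>) + 1) / r"] by (simp add: r_def)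
    qed
    show "Im (b \<xi> \<eta> + b' \<eta> \<xi>) = Im 0"
      using pos [of \<eta> \<xi>] pos [of \<eta> 0] by (simp add: complex_nonneg_Reals_iff b_def b'_def)
  qed
  then have "complex_of_real (0 * ((norm \<xi>)\<^sup>2 + (norm \<eta>)\<^sup>2)) + b \<xi> \<eta> + b' \<eta> \<xi> \<in> \<real>\<^sub>\<ge>\<^sub>0" for \<xi> \<eta>
    by simp
  then have "cmod (b \<xi> \<eta>) \<le> 0 * norm \<xi> * norm \<eta>" for \<xi> \<eta>
    by (rule block_form) (simp_all add: b_def b'_def cinner_simps)
  then show ?thesis
    by (intro bop_eqI_cinner) (simp add: b_def)
qed

section \<open>Limits of unital completely positive maps\<close>

text \<open>Tychonoff's theorem, applied to the values \<open>\<langle>\<xi>, \<phi>(x) \<eta>\<rangle>\<close>, which lie in discs that depend only on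
  \<open>x\<close>, \<open>\<xi>\<close> and \<open>\<eta>\<close>.\<close>

lemma ucp_cluster_point:
  fixes \<Phi> :: "'i \<Rightarrow> 'a :: complex_hilbert bop \<Rightarrow> 'a bop"
  assumes ucp: "\<And>i. ucp UNIV (\<Phi> i)" and "F \<noteq> bot"
  shows "\<exists>\<phi> G. ucp UNIV \<phi> \<and> G \<noteq> bot \<and> G \<le> F \<and>
    (\<forall>x \<xi> \<eta>. ((\<lambda>i. cinner \<xi> (\<Phi> i x $$ \<eta>)) \<longlongrightarrow> cinner \<xi> (\<phi> x $$ \<eta>)) G)"
proof -
  define g where "g i = (\<lambda>(x, \<xi>, \<eta>). cinner \<xi> (\<Phi> i x $$ \<eta>))" for i
  define U where "U = PiE UNIV (\<lambda>(x :: 'a bop, \<xi> :: 'a, \<eta> :: 'a).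
    cball (0 :: complex) (norm x * norm \<xi> * norm \<eta>))"
  have \<Phi>_bound: "cmod (cinner \<xi> (\<Phi> i x $$ \<eta>)) \<le> norm x * norm \<xi> * norm \<eta>" for i x \<xi> \<eta>
    using order_trans [OF cmod_cinner_bop_le [of \<xi> "\<Phi> i x" \<eta>]]
      ucp_norm_le [OF ucp operator_system_UNIV, of x i]
    by (meson UNIV_I mult_right_mono norm_ge_zero)
  have "g i \<in> U" for i
    by (auto simp: U_def g_def \<Phi>_bound)
  have "compact U"
  proof -
    have "compactin (product_topology (\<lambda>_. euclidean) UNIV) U"
      unfolding U_def compactin_PiE by auto
    then show ?thesis
      by (simp add: euclidean_product_topology)
  qed
  moreover have "filtermap g F \<noteq> bot"
    using \<open>F \<noteq> bot\<close> by (simp add: filtermap_bot_iff)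
  moreover have "eventually (\<lambda>h. h \<in> U) (filtermap g F)"
    by (simp add: eventually_filtermap \<open>\<And>i. g i \<in> U\<close>)
  ultimately obtain h where h: "h \<in> U" "inf (nhds h) (filtermap g F) \<noteq> bot"
    unfolding compact_filter by blast
  \<comment> \<open>Instead of passing to a subnet, refine the filter along which the limit is taken.\<close>
  define G where "G = inf F (filtercomap g (nhds h))"
  have "G \<noteq> bot"
  proof
    assume "G = bot"
    then have "eventually (\<lambda>_. False) G" by simp
    then obtain Q R where "eventually Q F" and R: "eventually R (filtercomap g (nhds h))"
      and QR: "\<And>i. \<not> (Q i \<and> R i)"
      unfolding G_def eventually_inf by blast
    from R obtain R' where R': "eventually R' (nhds h)" "\<And>i. R' (g i) \<Longrightarrow> R i"
      unfolding eventually_filtercomap by blast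
    have "eventually (\<lambda>y. \<not> R' y) (filtermap g F)"
      unfolding eventually_filtermap
      using \<open>eventually Q F\<close> by eventually_elim (use QR R'(2) in blast)
    then have "eventually (\<lambda>_. False) (inf (nhds h) (filtermap g F))"
      unfolding eventually_inf using R'(1) by blast
    then show False using h(2) by (simp add: trivial_limit_def)
  qed
  have lim: "((\<lambda>i. cinner \<xi> (\<Phi> i x $$ \<eta>)) \<longlongrightarrow> h (x, \<xi>, \<eta>)) G" for x \<xi> \<eta>
  proof -
    have "(g \<longlongrightarrow> h) (filtercomap g (nhds h))"
      by (simp add: filterlim_def filtermap_filtercomap)
    then have "(g \<longlongrightarrow> h) G"
      unfolding G_def by (rule filterlim_mono) auto
    from continuous_on_tendsto_compose [OF continuous_on_product_coordinates this]
    have "((\<lambda>i. g i (x, \<xi>, \<eta>)) \<longlongrightarrow> h (x, \<xi>, \<eta>)) G"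
      by simp
    then show ?thesis by (simp add: g_def)
  qed
  note uniq = tendsto_unique [OF \<open>G \<noteq> bot\<close>]
  have "\<exists>T. \<forall>\<xi> \<eta>. cinner \<xi> (T $$ \<eta>) = h (x, \<xi>, \<eta>)" for x
  proof (rule bop_of_sesquilinear [where K = "norm x"])
    show "h (x, \<xi> + \<xi>', \<eta>) = h (x, \<xi>, \<eta>) + h (x, \<xi>', \<eta>)" for \<xi> \<xi>' \<eta>
      using tendsto_add [OF lim [of \<xi> x \<eta>] lim [of \<xi>' x \<eta>]] lim [of "\<xi> + \<xi>'" x \<eta>]
      by (intro uniq) (auto simp: cinner_simps)
    show "h (x, \<xi>, \<eta> + \<eta>') = h (x, \<xi>, \<eta>) + h (x, \<xi>, \<eta>')" for \<xi> \<eta> \<eta>'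
      using tendsto_add [OF lim [of \<xi> x \<eta>] lim [of \<xi> x \<eta>']] lim [of \<xi> x "\<eta> + \<eta>'"]
      by (intro uniq) (auto simp: cinner_simps)
    show "h (x, c *\<^sub>C \<xi>, \<eta>) = cnj c * h (x, \<xi>, \<eta>)" for c \<xi> \<eta>
      using tendsto_mult_left [OF lim [of \<xi> x \<eta>], of "cnj c"] lim [of "c *\<^sub>C \<xi>" x \<eta>]
      by (intro uniq) (auto simp: cinner_simps)
    show "h (x, \<xi>, c *\<^sub>C \<eta>) = c * h (x, \<xi>, \<eta>)" for c \<xi> \<eta>
      using tendsto_mult_left [OF lim [of \<xi> x \<eta>], of c] lim [of \<xi> x "c *\<^sub>C \<eta>"]
      by (intro uniq) (auto simp: cinner_simps)
    show "cmod (h (x, \<xi>, \<eta>)) \<le> norm x * norm \<xi> * norm \<eta>" for \<xi> \<eta>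
      using h(1) by (auto simp: U_def PiE_iff dest!: spec [where x = "(x, \<xi>, \<eta>)"])
  qed
  then obtain \<phi> where \<phi>: "\<And>x \<xi> \<eta>. cinner \<xi> (\<phi> x $$ \<eta>) = h (x, \<xi>, \<eta>)"
    by metis
  note lim = lim [folded \<phi>]
  have "ucp UNIV \<phi>"
  proof (rule ucpI)
    show "\<phi> 1 = 1"
    proof (rule bop_eqI_cinner)
      show "cinner \<xi> (\<phi> 1 $$ \<eta>) = cinner \<xi> (1 $$ \<eta>)" for \<xi> \<eta>
        using lim [of \<xi> 1 \<eta>] by (intro uniq) (auto simp: ucp_one [OF ucp])
    qed
    show "\<phi> (x + y) = \<phi> x + \<phi> y" for x y
    proof (rule bop_eqI_cinner)
      show "cinner \<xi> (\<phi> (x + y) $$ \<eta>) = cinner \<xi> ((\<phi> x + \<phi> y) $$ \<eta>)" for \<xi> \<eta>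
        using lim [of \<xi> "x + y" \<eta>] tendsto_add [OF lim [of \<xi> x \<eta>] lim [of \<xi> y \<eta>]]
        by (intro uniq) (auto simp: ucp_add [OF ucp] cinner_simps)
    qed
    show "\<phi> (c *\<^sub>C x) = c *\<^sub>C \<phi> x" for x c
    proof (rule bop_eqI_cinner)
      show "cinner \<xi> (\<phi> (c *\<^sub>C x) $$ \<eta>) = cinner \<xi> ((c *\<^sub>C \<phi> x) $$ \<eta>)" for \<xi> \<eta>
        using lim [of \<xi> "c *\<^sub>C x" \<eta>] tendsto_mult_left [OF lim [of \<xi> x \<eta>], of c]
        by (intro uniq) (auto simp: ucp_scaleC [OF ucp] cinner_simps)
    qed
    fix n :: nat and X :: "nat \<Rightarrow> nat \<Rightarrow> 'a bop"
    assume X: "pos_matrix {..<n} X"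
    show "pos_matrix {..<n} (\<lambda>i j. \<phi> (X i j))"
    proof (rule pos_matrixI)
      fix \<xi>
      show "qform {..<n} (\<lambda>i j. \<phi> (X i j)) \<xi> \<in> \<real>\<^sub>\<ge>\<^sub>0"
      proof (rule Lim_in_closed_set [OF _ _ \<open>G \<noteq> bot\<close>])
        show "((\<lambda>k. \<Sum>i<n. \<Sum>j<n. cinner (\<xi> i) (\<Phi> k (X i j) $$ \<xi> j)) \<longlongrightarrow>
            qform {..<n} (\<lambda>i j. \<phi> (X i j)) \<xi>) G"
          by (intro tendsto_sum lim)
        show "eventually (\<lambda>k. qform {..<n} (\<lambda>i j. \<Phi> k (X i j)) \<xi> \<in> \<real>\<^sub>\<ge>\<^sub>0) G"
          using pos_matrixD [OF ucp_pos_matrix [OF ucp _ X]] by simp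
      qed (rule closed_nonneg_Reals_complex)
    qed
  qed
  then show ?thesis
    using \<open>G \<noteq> bot\<close> lim by (intro exI [of _ \<phi>] exI [of _ G]) (auto simp: G_def)
qed

section \<open>Minimal projections are rigid\<close>

definition ucp_fixing :: "'a :: complex_hilbert bop set \<Rightarrow> ('a bop \<Rightarrow> 'a bop) set"
  where "ucp_fixing S = {\<phi>. ucp UNIV \<phi> \<and> (\<forall>s\<in>S. \<phi> s = s)}"

lemma ucp_fixing_id: "(\<lambda>x. x) \<in> ucp_fixing S"
  by (simp add: ucp_fixing_def ucp_id)

lemma ucp_fixing_compose:
  "\<phi> \<in> ucp_fixing S \<Longrightarrow> \<psi> \<in> ucp_fixing S \<Longrightarrow> (\<lambda>x. \<phi> (\<psi> x)) \<in> ucp_fixing S"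
  by (auto simp: ucp_fixing_def intro: ucp_compose)

lemma ucp_fixing_funpow: "\<phi> \<in> ucp_fixing S \<Longrightarrow> (\<phi> ^^ k) \<in> ucp_fixing S"
proof (induction k)
  case 0
  then show ?case using ucp_fixing_id by (simp add: id_def)
next
  case (Suc k)
  then show ?case using ucp_fixing_compose [of \<phi> S "\<phi> ^^ k"] by (simp add: comp_def)
qed

lemma ucp_fixing_norm_le: "\<phi> \<in> ucp_fixing S \<Longrightarrow> norm (\<phi> x) \<le> norm x"
  using ucp_norm_le [OF _ operator_system_UNIV] by (auto simp: ucp_fixing_def)

lemma ucp_fixing_diff: "\<phi> \<in> ucp_fixing S \<Longrightarrow> \<phi> (x - y) = \<phi> x - \<phi> y"
  using ucp_diff [of UNIV \<phi> x y] by (auto simp: ucp_fixing_def)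

lemma ucp_fixing_average:
  assumes "\<And>k. k \<le> n \<Longrightarrow> f k \<in> ucp_fixing S"
  shows "(\<lambda>x. (1 / real (Suc n)) *\<^sub>R (\<Sum>k\<le>n. f k x)) \<in> ucp_fixing S"
proof -
  have f: "ucp UNIV (f k)" "\<And>s. s \<in> S \<Longrightarrow> f k s = s" if "k \<le> n" for k
    using assms [OF that] by (auto simp: ucp_fixing_def)
  have const: "(1 / real (Suc n)) *\<^sub>R (\<Sum>k\<le>n. y) = (y :: 'a bop)" for y
    by (simp add: sum_constant_scaleR)
  have "ucp UNIV (\<lambda>x. (1 / real (Suc n)) *\<^sub>R (\<Sum>k\<le>n. f k x))"
  proof (rule ucpI)
    show "(1 / real (Suc n)) *\<^sub>R (\<Sum>k\<le>n. f k 1) = 1"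
    proof -
      have "(\<Sum>k\<le>n. f k 1) = (\<Sum>k\<le>n. 1)"
        by (rule sum.cong) (auto simp: ucp_one [OF f(1)])
      then show ?thesis using const [of 1] by simp
    qed
    show "(1 / real (Suc n)) *\<^sub>R (\<Sum>k\<le>n. f k (x + y)) =
        (1 / real (Suc n)) *\<^sub>R (\<Sum>k\<le>n. f k x) + (1 / real (Suc n)) *\<^sub>R (\<Sum>k\<le>n. f k y)" for x y
      using f by (simp add: ucp_add [of UNIV] sum.distrib scaleR_add_right)
    show "(1 / real (Suc n)) *\<^sub>R (\<Sum>k\<le>n. f k (c *\<^sub>C x)) =
        c *\<^sub>C (1 / real (Suc n)) *\<^sub>R (\<Sum>k\<le>n. f k x)" for c x
      using f by (simp add: ucp_scaleC [of UNIV] bop_scaleR_scaleC scaleC_scaleC mult.commute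
          flip: complex_vector.scale_sum_right)
    fix m :: nat and X :: "nat \<Rightarrow> nat \<Rightarrow> 'a bop"
    assume X: "pos_matrix {..<m} X"
    show "pos_matrix {..<m} (\<lambda>i j. (1 / real (Suc n)) *\<^sub>R (\<Sum>k\<le>n. f k (X i j)))"
      by (rule pos_matrix_scaleR, rule pos_matrix_sum, rule ucp_pos_matrix [OF f(1) _ X]) simp_all
  qed
  then show ?thesis
    using const f(2) by (auto simp: ucp_fixing_def)
qed

text \<open>Norm bounds that hold eventually pass to weak cluster points, since the norm is a supremum of
  matrix coefficients.\<close>

lemma ucp_fixing_cluster_point:
  fixes \<Phi> :: "'i \<Rightarrow> 'a :: complex_hilbert bop \<Rightarrow> 'a bop"
  assumes \<Phi>: "\<And>i. \<Phi> i \<in> ucp_fixing S" and "F \<noteq> bot"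
  shows "\<exists>\<phi>\<in>ucp_fixing S. \<forall>x C. eventually (\<lambda>i. norm (\<Phi> i x) \<le> C) F \<longrightarrow> norm (\<phi> x) \<le> C"
proof -
  obtain \<phi> G where \<phi>: "ucp UNIV \<phi>" "G \<noteq> bot" "G \<le> F"
    and lim: "\<And>x \<xi> \<eta>. ((\<lambda>i. cinner \<xi> (\<Phi> i x $$ \<eta>)) \<longlongrightarrow> cinner \<xi> (\<phi> x $$ \<eta>)) G"
    using ucp_cluster_point [of \<Phi> F] assms by (auto simp: ucp_fixing_def)
  have "\<phi> s = s" if "s \<in> S" for s
  proof (rule bop_eqI_cinner)
    show "cinner \<xi> (\<phi> s $$ \<eta>) = cinner \<xi> (s $$ \<eta>)" for \<xi> \<eta>
      using lim [of \<xi> s \<eta>] \<Phi> that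
      by (intro tendsto_unique [OF \<phi>(2)]) (auto simp: ucp_fixing_def)
  qed
  moreover have "norm (\<phi> x) \<le> C" if ev: "eventually (\<lambda>i. norm (\<Phi> i x) \<le> C) F" for x C
  proof -
    have ev: "eventually (\<lambda>i. norm (\<Phi> i x) \<le> C) G"
      using ev \<phi>(3) by (simp add: le_filter_def)
    then have "eventually (\<lambda>i. 0 \<le> C) G"
      by eventually_elim (rule order_trans [OF norm_ge_zero])
    then have "0 \<le> C" using \<phi>(2) by simp
    then show ?thesis
    proof (rule norm_bop_le_cinner)
      fix \<xi> \<eta>
      have "eventually (\<lambda>i. cmod (cinner \<xi> (\<Phi> i x $$ \<eta>)) \<le> C * norm \<xi> * norm \<eta>) G"
        using ev
      proof eventually_elim
        case (elim i)
        then show ?case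
          using order_trans [OF cmod_cinner_bop_le]
          by (meson mult_right_mono norm_ge_zero)
      qed
      then show "cmod (cinner \<xi> (\<phi> x $$ \<eta>)) \<le> C * norm \<xi> * norm \<eta>"
        by (intro tendsto_upperbound [OF tendsto_norm [OF lim] _ \<phi>(2)])
    qed
  qed
  ultimately show ?thesis
    using \<phi>(1) by (auto simp: ucp_fixing_def)
qed

text \<open>Zorn's lemma for real functions under the pointwise order. It produces the minimal seminorms below
  and the minimal sublinear functionals of the Hahn-Banach theorem.\<close>

lemma pointwise_minimal_exists:
  fixes P :: "('x \<Rightarrow> real) set"
  assumes "p0 \<in> P"
    and lower: "\<And>C. C \<subseteq> P \<Longrightarrow> C \<noteq> {} \<Longrightarrow> (\<And>p q. p \<in> C \<Longrightarrow> q \<in> C \<Longrightarrow> p \<le> q \<or> q \<le> p) \<Longrightarrow>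
      \<exists>l\<in>P. \<forall>p\<in>C. l \<le> p"
  shows "\<exists>m\<in>P. m \<le> p0 \<and> (\<forall>p\<in>P. p \<le> m \<longrightarrow> p = m)"
proof -
  define A where "A = {p \<in> P. p \<le> p0}"
  have "\<exists>m\<in>A. \<forall>p\<in>A. p \<le> m \<longrightarrow> p = m"
  proof (rule predicate_Zorn)
    show "partial_order_on A (relation_of (\<lambda>p q. q \<le> p) A)"
      by (rule partial_order_on_relation_ofI) auto
    fix C
    assume "C \<in> Chains (relation_of (\<lambda>p q. q \<le> p) A)"
    then have C: "C \<subseteq> A" "\<And>p q. p \<in> C \<Longrightarrow> q \<in> C \<Longrightarrow> p \<le> q \<or> q \<le> p"
      by (auto simp: Chains_def relation_of_def)
    show "\<exists>u\<in>A. \<forall>a\<in>C. u \<le> a"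
    proof (cases "C = {}")
      case True
      then show ?thesis using assms(1) by (auto simp: A_def)
    next
      case False
      then obtain l where "l \<in> P" "\<forall>p\<in>C. l \<le> p"
        using lower [of C] C by (auto simp: A_def)
      moreover have "l \<le> p0"
        using False C(1) \<open>\<forall>p\<in>C. l \<le> p\<close> by (auto simp: A_def intro: order_trans)
      ultimately show ?thesis by (auto simp: A_def)
    qed
  qed
  then show ?thesis by (auto simp: A_def intro: order_trans)
qed

text \<open>Hamana's substitute for the order on projections: it compares arbitrary maps that fix \<open>S\<close>, and
  minimality forces idempotence.\<close>

definition minimal_seminorm :: "'a :: complex_hilbert bop set \<Rightarrow> ('a bop \<Rightarrow> 'a bop) \<Rightarrow> bool"
  where "minimal_seminorm S \<phi> \<longleftrightarrow> \<phi> \<in> ucp_fixing S \<and>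
    (\<forall>\<psi>\<in>ucp_fixing S. (\<forall>x. norm (\<psi> x) \<le> norm (\<phi> x)) \<longrightarrow> (\<forall>x. norm (\<psi> x) = norm (\<phi> x)))"

text \<open>Along a chain of seminorms \<open>x \<mapsto> \<parallel>\<phi> x\<parallel>\<close> the maps \<open>\<phi>\<close> need not converge, but the filter of lower tails
  of the chain has a cluster point, and its seminorm lies below the whole chain.\<close>

lemma minimal_seminorm_exists:
  fixes \<theta> :: "'a :: complex_hilbert bop \<Rightarrow> 'a bop"
  assumes "\<theta> \<in> ucp_fixing S"
  shows "\<exists>\<phi>. minimal_seminorm S \<phi> \<and> (\<forall>x. norm (\<phi> x) \<le> norm (\<theta> x))"
proof -
  define P where "P = (\<lambda>\<phi> x. norm (\<phi> x)) ` ucp_fixing S"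
  have "\<exists>m\<in>P. m \<le> (\<lambda>x. norm (\<theta> x)) \<and> (\<forall>p\<in>P. p \<le> m \<longrightarrow> p = m)"
  proof (rule pointwise_minimal_exists)
    show "(\<lambda>x. norm (\<theta> x)) \<in> P"
      using assms by (auto simp: P_def)
    fix C
    assume C: "C \<subseteq> P" "C \<noteq> {}" and chain: "\<And>p q. p \<in> C \<Longrightarrow> q \<in> C \<Longrightarrow> p \<le> q \<or> q \<le> p"
    have "\<exists>\<phi>\<in>ucp_fixing S. p \<in> C \<longrightarrow> (\<forall>x. norm (\<phi> x) = p x)" for p
    proof (cases "p \<in> C")
      case True
      then have "p \<in> P" using C by auto
      then show ?thesis by (auto simp: P_def)
    next
      case False
      then show ?thesis using assms by auto
    qed
    then obtain \<Phi> where \<Phi>: "\<And>p. \<Phi> p \<in> ucp_fixing S" "\<And>p x. p \<in> C \<Longrightarrow> norm (\<Phi> p x) = p x"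
      by metis
    define F where "F = (INF c\<in>C. principal {p \<in> C. p \<le> c})"
    have "eventually (\<lambda>p. Q p) F \<longleftrightarrow> (\<exists>c\<in>C. \<forall>p\<in>C. p \<le> c \<longrightarrow> Q p)" for Q
      unfolding F_def
    proof (subst eventually_INF_base)
      show "\<exists>x\<in>C. principal {p \<in> C. p \<le> x} \<le> inf (principal {p \<in> C. p \<le> a}) (principal {p \<in> C. p \<le> b})"
        if "a \<in> C" "b \<in> C" for a b
        using chain [OF that] that
        by (auto simp: inf_principal principal_le_iff intro: order_trans)
    qed (use C in \<open>auto simp: eventually_principal\<close>)
    then have F: "eventually Q F \<longleftrightarrow> (\<exists>c\<in>C. \<forall>p\<in>C. p \<le> c \<longrightarrow> Q p)" for Q .
    have "F \<noteq> bot"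
      unfolding trivial_limit_def F by auto
    then obtain \<phi> where \<phi>: "\<phi> \<in> ucp_fixing S"
      "\<And>x K. eventually (\<lambda>i. norm (\<Phi> i x) \<le> K) F \<Longrightarrow> norm (\<phi> x) \<le> K"
      using ucp_fixing_cluster_point [of \<Phi> S F] \<Phi>(1) by blast
    have "norm (\<phi> x) \<le> c x" if "c \<in> C" for c x
      by (rule \<phi>(2)) (use that in \<open>auto simp: F \<Phi>(2) le_fun_def\<close>)
    then show "\<exists>l\<in>P. \<forall>p\<in>C. l \<le> p"
      using \<phi>(1) by (auto simp: P_def le_fun_def)
  qed
  then show ?thesis
    unfolding minimal_seminorm_def P_def by (auto simp: le_fun_def fun_eq_iff)
qed

lemma minimal_seminorm_antimono:
  assumes "minimal_seminorm S \<phi>" "\<psi> \<in> ucp_fixing S" "\<And>x. norm (\<psi> x) \<le> norm (\<phi> x)"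
  shows "minimal_seminorm S \<psi>" "norm (\<psi> x) = norm (\<phi> x)"
  using assms unfolding minimal_seminorm_def by metis+

text \<open>A cluster point \<open>\<psi>\<close> of the averages of the powers of \<open>\<phi>\<close> annihilates \<open>x - \<phi> x\<close> by telescoping, and its
  seminorm lies below that of \<open>\<phi>\<close>. By minimality \<open>\<phi>\<close> annihilates \<open>x - \<phi> x\<close> as well.\<close>

lemma minimal_seminorm_idempotent:
  fixes \<phi> :: "'a :: complex_hilbert bop \<Rightarrow> 'a bop"
  assumes "minimal_seminorm S \<phi>"
  shows "\<phi> (\<phi> x) = \<phi> x"
proof -
  have \<phi>: "\<phi> \<in> ucp_fixing S" using assms by (simp add: minimal_seminorm_def)
  define M where "M n y = (1 / real (Suc n)) *\<^sub>R (\<Sum>k\<le>n. (\<phi> ^^ Suc k) y)" for n y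
  have M: "M n \<in> ucp_fixing S" for n
    unfolding M_def using \<phi> by (intro ucp_fixing_average ucp_fixing_funpow)
  have pow_le: "norm ((\<phi> ^^ Suc k) y) \<le> norm (\<phi> y)" for k y
    using ucp_fixing_norm_le [OF ucp_fixing_funpow [OF \<phi>], of k "\<phi> y"]
    by (simp add: funpow_swap1)
  have M_le: "norm (M n y) \<le> norm (\<phi> y)" for n y
  proof -
    have "norm (\<Sum>k\<le>n. (\<phi> ^^ Suc k) y) \<le> (\<Sum>k\<le>n. norm (\<phi> y))"
      by (intro sum_norm_le pow_le)
    also have "\<dots> = real (Suc n) * norm (\<phi> y)"
      by simp
    finally show ?thesis by (simp add: M_def field_simps)
  qed
  have M_diff: "norm (M n (x - \<phi> x)) \<le> 2 * norm (\<phi> x) / real (Suc n)" for n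
  proof -
    have step: "(\<phi> ^^ Suc k) (x - \<phi> x) = (\<phi> ^^ Suc k) x - (\<phi> ^^ Suc (Suc k)) x" for k
      using ucp_fixing_diff [OF ucp_fixing_funpow [OF \<phi>], of "Suc k" x "\<phi> x"]
      by (simp add: funpow_swap1)
    have "(\<Sum>k\<le>n. (\<phi> ^^ Suc k) (x - \<phi> x)) = (\<phi> ^^ Suc 0) x - (\<phi> ^^ Suc (Suc n)) x"
      unfolding step by (rule sum_telescope)
    also have "norm \<dots> \<le> norm ((\<phi> ^^ Suc 0) x) + norm ((\<phi> ^^ Suc (Suc n)) x)"
      by (rule norm_triangle_ineq4)
    also have "\<dots> \<le> 2 * norm (\<phi> x)"
      using pow_le [of 0 x] pow_le [of "Suc n" x] by linarith
    finally show ?thesis by (simp add: M_def divide_right_mono)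
  qed
  obtain \<psi> where \<psi>: "\<psi> \<in> ucp_fixing S"
    and \<psi>_le: "\<And>y K. eventually (\<lambda>n. norm (M n y) \<le> K) sequentially \<Longrightarrow> norm (\<psi> y) \<le> K"
    using ucp_fixing_cluster_point [of M S sequentially] M by auto
  have "norm (\<psi> (x - \<phi> x)) \<le> 0"
  proof (rule field_le_epsilon)
    fix e :: real
    assume "e > 0"
    have "(\<lambda>n. 2 * norm (\<phi> x) / real (Suc n)) \<longlonglongrightarrow> 0"
      using LIMSEQ_Suc [OF lim_const_over_n] by blast
    then have "eventually (\<lambda>n. 2 * norm (\<phi> x) / real (Suc n) < e) sequentially"
      using \<open>e > 0\<close> by (rule order_tendstoD)
    then have "eventually (\<lambda>n. norm (M n (x - \<phi> x)) \<le> e) sequentially"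
      by eventually_elim (use M_diff in \<open>meson less_imp_le order_trans\<close>)
    then show "norm (\<psi> (x - \<phi> x)) \<le> 0 + e"
      using \<psi>_le by simp
  qed
  moreover have "norm (\<psi> y) \<le> norm (\<phi> y)" for y
    by (rule \<psi>_le) (simp add: M_le)
  then have "norm (\<psi> (x - \<phi> x)) = norm (\<phi> (x - \<phi> x))"
    by (rule minimal_seminorm_antimono(2) [OF assms \<psi>])
  ultimately have "\<phi> (x - \<phi> x) = 0" by simp
  then show ?thesis by (simp add: ucp_fixing_diff [OF \<phi>])
qed

lemma S_projectionD:
  assumes "S_projection S \<theta>"
  shows "\<theta> \<in> ucp_fixing S" "\<theta> (\<theta> x) = \<theta> x"
  using assms by (auto simp: S_projection_def ucp_fixing_def fun_eq_iff)

lemma S_projectionI: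
  "\<theta> \<in> ucp_fixing S \<Longrightarrow> (\<And>x. \<theta> (\<theta> x) = \<theta> x) \<Longrightarrow> S_projection S \<theta>"
  by (auto simp: S_projection_def ucp_fixing_def fun_eq_iff)

text \<open>Let \<open>\<phi>\<close> have a minimal seminorm below that of \<open>\<theta>\<close>. Then \<open>\<phi>\<close> annihilates \<open>x - \<theta> x\<close>, so \<open>\<phi> \<theta> = \<phi>\<close> and the
  idempotent \<open>\<theta> \<phi>\<close> is an $S$-projection below \<open>\<theta>\<close>, hence equal to \<open>\<theta>\<close>.\<close>

lemma minimal_S_projection_imp_minimal_seminorm:
  assumes "minimal_S_projection S \<theta>"
  shows "minimal_seminorm S \<theta>"
proof -
  have \<theta>: "S_projection S \<theta>"
    using assms by (simp add: minimal_S_projection_def)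
  note \<theta> = S_projectionD [OF this]
  obtain \<phi> where \<phi>: "minimal_seminorm S \<phi>" "\<And>x. norm (\<phi> x) \<le> norm (\<theta> x)"
    using minimal_seminorm_exists [OF \<theta>(1)] by blast
  from \<phi>(1) have \<phi>S: "\<phi> \<in> ucp_fixing S"
    unfolding minimal_seminorm_def by blast
  have \<phi>\<theta>: "\<phi> (\<theta> x) = \<phi> x" for x
    using \<phi>(2) [of "x - \<theta> x"]
    by (simp add: ucp_fixing_diff [OF \<phi>S] ucp_fixing_diff [OF \<theta>(1)] \<theta>(2))
  define \<psi> where "\<psi> = (\<lambda>x. \<theta> (\<phi> x))"
  have \<psi>S: "\<psi> \<in> ucp_fixing S"
    unfolding \<psi>_def by (rule ucp_fixing_compose [OF \<theta>(1) \<phi>S])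
  have \<psi>: "minimal_seminorm S \<psi>"
    by (rule minimal_seminorm_antimono(1) [OF \<phi>(1) \<psi>S])
      (simp add: \<psi>_def ucp_fixing_norm_le [OF \<theta>(1)])
  have "S_projection S \<psi>"
    using \<psi>S minimal_seminorm_idempotent [OF \<psi>] by (rule S_projectionI)
  moreover have "\<psi> \<prec> \<theta>"
    by (simp add: proj_le_def fun_eq_iff \<psi>_def \<phi>\<theta> \<theta>(2))
  ultimately have "\<psi> = \<theta>"
    using assms by (simp add: minimal_S_projection_def)
  then show ?thesis using \<psi> by simp
qed

text \<open>Rigidity of the range of \<open>\<theta>\<close>: a completely positive self-map of the range that fixes \<open>S\<close> is the
  identity. The map \<open>\<theta> \<phi> \<theta>\<close> has the minimal seminorm of \<open>\<theta>\<close>, so it is idempotent and lies below \<open>\<theta>\<close>.\<close>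

lemma minimal_S_projection_rigid:
  assumes "minimal_S_projection S \<theta>" "\<phi> \<in> ucp_fixing S"
  shows "\<theta> (\<phi> (\<theta> x)) = \<theta> x"
proof -
  have "S_projection S \<theta>"
    using assms by (simp add: minimal_S_projection_def)
  note \<theta> = S_projectionD [OF this]
  define \<psi> where "\<psi> = (\<lambda>x. \<theta> (\<phi> (\<theta> x)))"
  have \<psi>S: "\<psi> \<in> ucp_fixing S"
    unfolding \<psi>_def
    by (rule ucp_fixing_compose [OF \<theta>(1) ucp_fixing_compose [OF assms(2) \<theta>(1)]])
  have "norm (\<psi> x) \<le> norm (\<theta> x)" for x
    using ucp_fixing_norm_le [OF \<theta>(1), of "\<phi> (\<theta> x)"] ucp_fixing_norm_le [OF assms(2), of "\<theta> x"]
    by (simp add: \<psi>_def)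
  then have "minimal_seminorm S \<psi>"
    by (rule minimal_seminorm_antimono(1)
        [OF minimal_S_projection_imp_minimal_seminorm [OF assms(1)] \<psi>S])
  then have "S_projection S \<psi>"
    using \<psi>S minimal_seminorm_idempotent by (blast intro: S_projectionI)
  moreover have "\<psi> \<prec> \<theta>"
    by (simp add: proj_le_def fun_eq_iff \<psi>_def \<theta>(2))
  ultimately have "\<psi> = \<theta>"
    using assms(1) by (simp add: minimal_S_projection_def)
  then show ?thesis by (simp add: \<psi>_def fun_eq_iff)
qed

section \<open>The Hahn-Banach theorem\<close>

definition sublinear_on :: "'v :: real_vector set \<Rightarrow> ('v \<Rightarrow> real) \<Rightarrow> bool"
  where "sublinear_on V q \<longleftrightarrow>
    (\<forall>x\<in>V. \<forall>y\<in>V. q (x + y) \<le> q x + q y) \<and> (\<forall>x\<in>V. \<forall>t\<ge>0. q (t *\<^sub>R x) = t * q x)"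

lemma sublinear_onD:
  assumes "sublinear_on V q" "x \<in> V"
  shows "y \<in> V \<Longrightarrow> q (x + y) \<le> q x + q y" "t \<ge> 0 \<Longrightarrow> q (t *\<^sub>R x) = t * q x"
  using assms by (auto simp: sublinear_on_def)

lemma sublinear_on_neg_le:
  assumes "subspace V" "sublinear_on V q" "x \<in> V"
  shows "- q (- x) \<le> q x"
proof -
  have "q (0 *\<^sub>R x) = 0 * q x" by (rule sublinear_onD(2) [OF assms(2,3)]) simp
  moreover have "q (x + - x) \<le> q x + q (- x)"
    by (rule sublinear_onD(1) [OF assms(2,3)]) (use assms in \<open>simp add: subspace_neg\<close>)
  ultimately show ?thesis by simp
qed

lemma positively_homogeneousI:
  fixes q :: "'v :: real_vector \<Rightarrow> real"
  assumes V: "subspace V" and "q 0 = 0"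
    and le: "\<And>x s. x \<in> V \<Longrightarrow> s > 0 \<Longrightarrow> q (s *\<^sub>R x) \<le> s * q x" and "x \<in> V" "t \<ge> 0"
  shows "q (t *\<^sub>R x) = t * q x"
proof (cases "t = 0")
  case False
  then have "t > 0" using \<open>t \<ge> 0\<close> by simp
  have "q ((1 / t) *\<^sub>R (t *\<^sub>R x)) \<le> (1 / t) * q (t *\<^sub>R x)"
    by (rule le) (use \<open>t > 0\<close> V \<open>x \<in> V\<close> in \<open>auto simp: subspace_scale\<close>)
  then have "t * q x \<le> q (t *\<^sub>R x)"
    using \<open>t > 0\<close> by (simp add: field_simps)
  then show ?thesis using le [OF \<open>x \<in> V\<close> \<open>t > 0\<close>] by simp
qed (simp add: \<open>q 0 = 0\<close>)

text \<open>In a chain any two functionals have a smaller one among them, which is what makes the pointwise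
  infimum subadditive. The bound \<open>- q (- x) \<le> q x\<close> keeps the infimum finite.\<close>

lemma sublinear_on_INF_chain:
  fixes C :: "('v :: real_vector \<Rightarrow> real) set"
  assumes "subspace V" "C \<noteq> {}" "\<And>p. p \<in> C \<Longrightarrow> sublinear_on V p"
    and chain: "\<And>p q. p \<in> C \<Longrightarrow> q \<in> C \<Longrightarrow> p \<le> q \<or> q \<le> p"
  shows "sublinear_on V (\<lambda>x. INF p\<in>C. p x)" "\<And>p x. p \<in> C \<Longrightarrow> x \<in> V \<Longrightarrow> (INF p\<in>C. p x) \<le> p x"
proof -
  define l where "l x = (INF p\<in>C. p x)" for x
  obtain p0 where "p0 \<in> C" using \<open>C \<noteq> {}\<close> by blast
  have bdd: "bdd_below ((\<lambda>p. p x) ` C)" if "x \<in> V" for x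
  proof (rule bdd_belowI2)
    fix p
    assume "p \<in> C"
    then consider "p (- x) \<le> p0 (- x)" | "p0 x \<le> p x"
      using chain [OF \<open>p0 \<in> C\<close> \<open>p \<in> C\<close>] by (auto simp: le_fun_def)
    then show "- p0 (- x) \<le> p x"
      using sublinear_on_neg_le [OF assms(1) assms(3) that, OF \<open>p \<in> C\<close>]
        sublinear_on_neg_le [OF assms(1) assms(3) that, OF \<open>p0 \<in> C\<close>] by cases linarith+
  qed
  have l_le: "l x \<le> p x" if "x \<in> V" "p \<in> C" for x p
    unfolding l_def by (rule cINF_lower) (use bdd that in auto)
  have le_l: "c \<le> l x" if "\<And>p. p \<in> C \<Longrightarrow> c \<le> p x" for c x
    unfolding l_def by (rule cINF_greatest) (use \<open>C \<noteq> {}\<close> that in auto)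
  have "l (x + y) \<le> l x + l y" if "x \<in> V" "y \<in> V" for x y
  proof -
    have xy: "x + y \<in> V" using assms(1) that by (simp add: subspace_add)
    have "l (x + y) \<le> p x + q y" if pq: "p \<in> C" "q \<in> C" for p q
    proof -
      obtain r where r: "r \<in> C" "r \<le> p" "r \<le> q"
        using chain [OF pq] pq by blast
      have "l (x + y) \<le> r (x + y)" using xy r by (intro l_le)
      also have "\<dots> \<le> r x + r y"
        using sublinear_onD(1) [OF assms(3)] r \<open>x \<in> V\<close> \<open>y \<in> V\<close> by blast
      also have "\<dots> \<le> p x + q y" using r by (intro add_mono) (auto simp: le_fun_def)
      finally show ?thesis .
    qed
    then have "l (x + y) - p x \<le> l y" if "p \<in> C" for p
      using that by (intro le_l) (metis add.commute diff_le_eq)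
    then have "l (x + y) - l y \<le> l x"
      by (intro le_l) (simp add: algebra_simps)
    then show ?thesis by simp
  qed
  moreover have "l (t *\<^sub>R x) = t * l x" if "x \<in> V" "t \<ge> 0" for x t
  proof -
    have le: "l (s *\<^sub>R y) \<le> s * l y" if "y \<in> V" "s > 0" for y s
    proof -
      have "l (s *\<^sub>R y) / s \<le> p y" if "p \<in> C" for p
        using l_le [of "s *\<^sub>R y" p] sublinear_onD(2) [OF assms(3) \<open>y \<in> V\<close>, of p s] that
          \<open>s > 0\<close> assms(1) \<open>y \<in> V\<close> by (simp add: subspace_scale field_simps)
      then have "l (s *\<^sub>R y) / s \<le> l y" by (rule le_l)
      then show ?thesis using \<open>s > 0\<close> by (simp add: field_simps)
    qed
    have "(\<lambda>p. p 0) ` C = {0 :: real}"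
      using \<open>C \<noteq> {}\<close> sublinear_onD(2) [OF assms(3) that(1), of _ 0] by force
    then show ?thesis
      using that le by (intro positively_homogeneousI [OF assms(1)]) (simp_all add: l_def)
  qed
  ultimately show "sublinear_on V (\<lambda>x. INF p\<in>C. p x)"
    unfolding sublinear_on_def l_def by blast
  show "(INF p\<in>C. p x) \<le> p x" if "p \<in> C" "x \<in> V" for p x
    using l_le [OF that(2,1)] by (simp add: l_def)
qed

text \<open>A sublinear functional \<open>m\<close> that is minimal among all sublinear functionals is additive, because
  \<open>x \<mapsto> inf (m (x + t a) - t m a)\<close>, the infimum being taken over \<open>t \<ge> 0\<close>, is a sublinear functional below it.\<close>

theorem hahn_banach:
  fixes q :: "'v :: real_vector \<Rightarrow> real"
  assumes V: "subspace V" and q: "sublinear_on V q"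
  shows "\<exists>f. (\<forall>x\<in>V. \<forall>y\<in>V. f (x + y) = f x + f y) \<and> (\<forall>x\<in>V. \<forall>t. f (t *\<^sub>R x) = t * f x) \<and>
    (\<forall>x\<in>V. f x \<le> q x)"
proof -
  define P where "P = {p. sublinear_on V p \<and> (\<forall>x. x \<notin> V \<longrightarrow> p x = 0)}"
  have restrict: "(\<lambda>x. if x \<in> V then p x else 0) \<in> P" if "sublinear_on V p" for p
    using that V by (auto simp: P_def sublinear_on_def subspace_add subspace_scale)
  have "\<exists>m\<in>P. m \<le> (\<lambda>x. if x \<in> V then q x else 0) \<and> (\<forall>p\<in>P. p \<le> m \<longrightarrow> p = m)"
  proof (rule pointwise_minimal_exists [OF restrict [OF q]])
    fix C
    assume C: "C \<subseteq> P" "C \<noteq> {}" "\<And>p q. p \<in> C \<Longrightarrow> q \<in> C \<Longrightarrow> p \<le> q \<or> q \<le> p"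
    then have sub: "\<And>p. p \<in> C \<Longrightarrow> sublinear_on V p"
      by (auto simp: P_def)
    note INF = sublinear_on_INF_chain [OF V C(2) sub C(3)]
    define l where "l x = (if x \<in> V then INF p\<in>C. p x else 0)" for x
    have "l \<in> P"
      unfolding l_def using restrict [OF INF(1)] by simp
    moreover have "\<forall>p\<in>C. l \<le> p"
      using C(1) INF(2) by (auto simp: l_def le_fun_def P_def)
    ultimately show "\<exists>l\<in>P. \<forall>p\<in>C. l \<le> p" by blast
  qed
  then obtain m where "m \<in> P" and mq: "m \<le> (\<lambda>x. if x \<in> V then q x else 0)"
    and min: "\<And>p. p \<in> P \<Longrightarrow> p \<le> m \<Longrightarrow> p = m" by blast
  then have m: "sublinear_on V m" by (simp add: P_def)
  have ge: "m x + m a \<le> m (x + a)" if "x \<in> V" "a \<in> V" for x a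
  proof -
    define A where "A y = (\<lambda>t. m (y + t *\<^sub>R a) - t * m a) ` {0..}" for y
    define r where "r y = (if y \<in> V then Inf (A y) else 0)" for y
    have bdd: "bdd_below (A y)" if "y \<in> V" for y
      unfolding A_def
    proof (rule bdd_belowI2)
      fix t :: real
      assume "t \<in> {0..}"
      have ya: "y + t *\<^sub>R a \<in> V" "- y \<in> V"
        using V \<open>y \<in> V\<close> \<open>a \<in> V\<close> by (auto intro!: subspace_add subspace_scale subspace_neg)
      have "m ((y + t *\<^sub>R a) + - y) \<le> m (y + t *\<^sub>R a) + m (- y)"
        by (rule sublinear_onD(1) [OF m ya])
      then show "- m (- y) \<le> m (y + t *\<^sub>R a) - t * m a"
        using sublinear_onD(2) [OF m \<open>a \<in> V\<close>, of t] \<open>t \<in> {0..}\<close> by simp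
    qed
    have r_le: "r y \<le> m (y + t *\<^sub>R a) - t * m a" if "y \<in> V" "t \<ge> 0" for y t
      using cInf_lower [OF _ bdd [OF that(1)], of "m (y + t *\<^sub>R a) - t * m a"] that
      by (auto simp: r_def A_def)
    have le_r: "c \<le> r y" if "y \<in> V" "\<And>t. t \<ge> 0 \<Longrightarrow> c \<le> m (y + t *\<^sub>R a) - t * m a" for c y
      using that by (auto simp: r_def A_def intro!: cInf_greatest)
    have "sublinear_on V r"
      unfolding sublinear_on_def
    proof (intro conjI ballI allI impI)
      fix y z
      assume yz: "y \<in> V" "z \<in> V"
      have "r (y + z) \<le> (m (y + s *\<^sub>R a) - s * m a) + (m (z + t *\<^sub>R a) - t * m a)"
        if "s \<ge> 0" "t \<ge> 0" for s t
      proof -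
        have "r (y + z) \<le> m (y + z + (s + t) *\<^sub>R a) - (s + t) * m a"
          using V yz that by (intro r_le) (auto simp: subspace_add)
        also have "y + z + (s + t) *\<^sub>R a = (y + s *\<^sub>R a) + (z + t *\<^sub>R a)"
          by (simp add: scaleR_add_left)
        also have "m \<dots> \<le> m (y + s *\<^sub>R a) + m (z + t *\<^sub>R a)"
          using V yz \<open>a \<in> V\<close>
          by (intro sublinear_onD(1) [OF m]) (auto intro!: subspace_add subspace_scale)
        finally show ?thesis by (simp add: algebra_simps)
      qed
      then have "r (y + z) - (m (y + s *\<^sub>R a) - s * m a) \<le> r z" if "s \<ge> 0" for s
        using yz that by (intro le_r) (auto simp: diff_le_eq add.commute)
      then have "r (y + z) - r z \<le> r y"
        using yz by (intro le_r) (auto simp: algebra_simps)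
      then show "r (y + z) \<le> r y + r z" by simp
    next
      fix y and s :: real
      assume y: "y \<in> V" and "s \<ge> 0"
      have le: "r (u *\<^sub>R z) \<le> u * r z" if z: "z \<in> V" and "u > 0" for z u
      proof -
        have "r (u *\<^sub>R z) / u \<le> m (z + t *\<^sub>R a) - t * m a" if "t \<ge> 0" for t
        proof -
          have "r (u *\<^sub>R z) \<le> m (u *\<^sub>R z + (u * t) *\<^sub>R a) - (u * t) * m a"
            using V z \<open>u > 0\<close> that by (intro r_le) (auto simp: subspace_scale)
          also have "u *\<^sub>R z + (u * t) *\<^sub>R a = u *\<^sub>R (z + t *\<^sub>R a)"
            by (simp add: scaleR_add_right)
          also have "m \<dots> = u * m (z + t *\<^sub>R a)"
            using V z \<open>a \<in> V\<close> \<open>u > 0\<close>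
            by (intro sublinear_onD(2) [OF m]) (auto intro!: subspace_add subspace_scale)
          finally show ?thesis using \<open>u > 0\<close> by (simp add: field_simps)
        qed
        then have "r (u *\<^sub>R z) / u \<le> r z" by (intro le_r z)
        then show ?thesis using \<open>u > 0\<close> by (simp add: field_simps)
      qed
      have "0 \<in> V" using V by (rule subspace_0)
      have "m 0 = 0" using sublinear_onD(2) [OF m y, of 0] by simp
      have "r 0 \<le> 0" using r_le [OF \<open>0 \<in> V\<close>, of 0] \<open>m 0 = 0\<close> by simp
      moreover have "0 \<le> r 0"
        by (rule le_r [OF \<open>0 \<in> V\<close>]) (simp add: sublinear_onD(2) [OF m \<open>a \<in> V\<close>])
      ultimately show "r (s *\<^sub>R y) = s * r y"
        using le y \<open>s \<ge> 0\<close> by (intro positively_homogeneousI [OF V]) simp_all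
    qed
    then have "r \<in> P" by (simp add: P_def r_def)
    moreover have "r \<le> m"
      using r_le [of _ 0] \<open>m \<in> P\<close> by (auto simp: le_fun_def r_def P_def)
    ultimately have "r = m" by (rule min)
    then show ?thesis using r_le [OF \<open>x \<in> V\<close>, of 1] by simp
  qed
  have add: "m (x + y) = m x + m y" if "x \<in> V" "y \<in> V" for x y
    using ge [OF that] sublinear_onD(1) [OF m that] by simp
  have "m (t *\<^sub>R x) = t * m x" if "x \<in> V" for x t
  proof (cases "t \<ge> 0")
    case True
    then show ?thesis by (rule sublinear_onD(2) [OF m that])
  next
    case False
    then have neg: "m ((- t) *\<^sub>R x) = - t * m x"
      using sublinear_onD(2) [OF m that, of "- t"] by simp
    have "m (t *\<^sub>R x + (- t) *\<^sub>R x) = m (t *\<^sub>R x) + m ((- t) *\<^sub>R x)"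
      using V that by (intro add subspace_scale)
    moreover have "m 0 = 0" using sublinear_onD(2) [OF m that, of 0] by simp
    ultimately show ?thesis using neg by (simp flip: scaleR_add_left)
  qed
  moreover have "m x \<le> q x" if "x \<in> V" for x
    using mq that by (auto simp: le_fun_def dest: spec [where x = x])
  ultimately show ?thesis using add by blast
qed

section \<open>Arveson's extension theorem\<close>

text \<open>Arveson's theorem is reduced to the Hahn-Banach theorem in the following space of functions. A
  completely positive map \<open>\<phi>\<close> corresponds to the functional \<open>x \<otimes> \<xi> \<otimes> \<eta> \<mapsto> \<langle>\<xi>, \<phi>(x) \<eta>\<rangle>\<close> on the tensor product of
  $B(H)$ with the finite rank operators, and complete positivity of \<open>\<phi>\<close> is positivity of this
  functional.\<close>

instantiation "fun" :: (type, real_vector) real_vector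
begin

definition scaleR_fun :: "real \<Rightarrow> ('a \<Rightarrow> 'b) \<Rightarrow> 'a \<Rightarrow> 'b"
  where "scaleR_fun r f = (\<lambda>x. r *\<^sub>R f x)"

instance
  by standard (auto simp: scaleR_fun_def fun_eq_iff scaleR_add_right scaleR_add_left)

end

lemma scaleR_fun_apply [simp]: "(r *\<^sub>R f) x = r *\<^sub>R f x"
  by (simp add: scaleR_fun_def)

lemma sum_fun_apply: "(\<Sum>i\<in>I. f i) x = (\<Sum>i\<in>I. f i x)"
  by (induction I rule: infinite_finite_induct) simp_all

definition clinear_map :: "('a :: complex_vector \<Rightarrow> 'a) \<Rightarrow> bool"
  where "clinear_map a \<longleftrightarrow> (\<forall>x y. a (x + y) = a x + a y) \<and> (\<forall>c x. a (c *\<^sub>C x) = c *\<^sub>C a x)"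

text \<open>The real part of an elementary tensor \<open>x \<otimes> \<xi> \<otimes> \<eta>\<close>, realised as a function of an arbitrary linear map \<open>a\<close> on
  \<open>H\<close>. The map \<open>a\<close> carries linearly independent vectors to arbitrary ones, so a real combination of such
  functions is pointwise nonnegative exactly if the tensor is represented by a matrix with positive
  real part. The value 0 at nonlinear \<open>a\<close> makes the bilinearity relations of the tensor product hold as
  equations between functions.\<close>

definition re_form :: "'a :: complex_hilbert bop \<Rightarrow> 'a \<Rightarrow> 'a \<Rightarrow> ('a \<Rightarrow> 'a) \<Rightarrow> real"
  where "re_form x \<xi> \<eta> = (\<lambda>a. if clinear_map a then Re (cinner (a \<xi>) (x $$ a \<eta>)) else 0)"

lemma re_form_simps:
  "re_form (x + y) \<xi> \<eta> = re_form x \<xi> \<eta> + re_form y \<xi> \<eta>"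
  "re_form (r *\<^sub>R x) \<xi> \<eta> = r *\<^sub>R re_form x \<xi> \<eta>"
  "re_form x (\<xi> + \<xi>') \<eta> = re_form x \<xi> \<eta> + re_form x \<xi>' \<eta>"
  "re_form x \<xi> (\<eta> + \<eta>') = re_form x \<xi> \<eta> + re_form x \<xi> \<eta>'"
  "re_form x (c *\<^sub>C \<xi>) \<eta> = re_form (cnj c *\<^sub>C x) \<xi> \<eta>"
  "re_form x \<xi> (c *\<^sub>C \<eta>) = re_form (c *\<^sub>C x) \<xi> \<eta>"
  by (auto simp: re_form_def fun_eq_iff clinear_map_def cinner_simps)

lemma coordinate_form:
  "(\<Sum>e\<in>F. \<Sum>e'\<in>F. cinner (\<alpha> e) ((\<Sum>i\<in>I. (cnj (x i e) * y i e') *\<^sub>C d i) $$ \<alpha> e')) =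
    (\<Sum>i\<in>I. cinner (\<Sum>e\<in>F. x i e *\<^sub>C \<alpha> e) (d i $$ (\<Sum>e\<in>F. y i e *\<^sub>C \<alpha> e)))"
proof -
  let ?t = "\<lambda>e e' i. cinner (x i e *\<^sub>C \<alpha> e) (d i $$ (y i e' *\<^sub>C \<alpha> e'))"
  have "(\<Sum>e\<in>F. \<Sum>e'\<in>F. cinner (\<alpha> e) ((\<Sum>i\<in>I. (cnj (x i e) * y i e') *\<^sub>C d i) $$ \<alpha> e')) =
      (\<Sum>e\<in>F. \<Sum>e'\<in>F. \<Sum>i\<in>I. ?t e e' i)"
    by (simp add: bop_apply_sum_left cinner_sum_right cinner_simps mult_ac)
  also have "\<dots> = (\<Sum>e\<in>F. \<Sum>i\<in>I. \<Sum>e'\<in>F. ?t e e' i)"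
    by (intro sum.cong refl sum.swap)
  also have "\<dots> = (\<Sum>i\<in>I. \<Sum>e\<in>F. \<Sum>e'\<in>F. ?t e e' i)"
    by (rule sum.swap)
  also have "\<dots> = (\<Sum>i\<in>I. cinner (\<Sum>e\<in>F. x i e *\<^sub>C \<alpha> e) (d i $$ (\<Sum>e\<in>F. y i e *\<^sub>C \<alpha> e)))"
    by (simp only: cinner_sum_left bop_apply_sum_right) (simp only: cinner_sum_right)
  finally show ?thesis .
qed

lemma hermitian_form:
  "(\<Sum>e\<in>F. \<Sum>e'\<in>F. cinner (\<alpha> e) ((G e e' + adj (G e' e)) $$ \<alpha> e')) =
    of_real (2 * Re (\<Sum>e\<in>F. \<Sum>e'\<in>F. cinner (\<alpha> e) (G e e' $$ \<alpha> e')))"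
proof -
  let ?S = "\<Sum>e\<in>F. \<Sum>e'\<in>F. cinner (\<alpha> e) (G e e' $$ \<alpha> e')"
  have "(\<Sum>e\<in>F. \<Sum>e'\<in>F. cinner (\<alpha> e) (adj (G e' e) $$ \<alpha> e')) =
      (\<Sum>e\<in>F. \<Sum>e'\<in>F. cnj (cinner (\<alpha> e') (G e' e $$ \<alpha> e)))"
    by (intro sum.cong refl) (metis cinner_adj_right cinner_commute)
  also have "\<dots> = cnj ?S"
    by (subst sum.swap) simp
  finally have "(\<Sum>e\<in>F. \<Sum>e'\<in>F. cinner (\<alpha> e) ((G e e' + adj (G e' e)) $$ \<alpha> e')) = ?S + cnj ?S"
    by (simp add: cinner_simps sum.distrib)
  then show ?thesis by (simp only: complex_add_cnj)
qed

text \<open>Positivity of the functional attached to \<open>\<phi>\<close> on tensors with entries in \<open>D\<close>. Coordinates with respect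
  to a Hamel basis turn the tensor into a matrix \<open>G\<close> over \<open>D\<close> indexed by basis vectors. Since a linear map
  may send the basis vectors anywhere, the hypothesis says that \<open>G + G\<^sup>*\<close> is positive; so is its image
  under \<open>\<phi>\<close>, which is then tested on the basis vectors themselves.\<close>

lemma ucp_re_form_nonneg:
  fixes \<phi> :: "'a :: complex_hilbert bop \<Rightarrow> 'a bop"
  assumes \<phi>: "ucp D \<phi>" and D: "operator_system D" and "finite I"
    and d: "\<And>i. i \<in> I \<Longrightarrow> d i \<in> D"
    and nonneg: "0 \<le> (\<Sum>i\<in>I. re_form (d i) (\<xi> i) (\<eta> i))"
  shows "0 \<le> Re (\<Sum>i\<in>I. cinner (\<xi> i) (\<phi> (d i) $$ \<eta> i))"
proof -
  have cD: "csubspace D" using D by (simp add: operator_system_def)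
  obtain E :: "'a set" where indep: "complex_vector.independent E"
    and span: "complex_vector.span E = UNIV"
    using complex_vector.basis_exists [of UNIV] by (metis top.extremum_uniqueI)
  define co where "co v e = complex_vector.representation E v e" for v e
  have co_add: "co (v + w) e = co v e + co w e" for v w e
    unfolding co_def using complex_vector.representation_add [OF indep] span by simp
  have co_scale: "co (c *\<^sub>C v) e = c * co v e" for c v e
    unfolding co_def using complex_vector.representation_scale [OF indep] span by simp
  define F where "F = (\<Union>i\<in>I. {e. co (\<xi> i) e \<noteq> 0} \<union> {e. co (\<eta> i) e \<noteq> 0})"
  have "finite F"
    unfolding F_def co_def using \<open>finite I\<close> complex_vector.finite_representation by auto
  have expand: "(\<Sum>e\<in>F. co v e *\<^sub>C e) = v" if "{e. co v e \<noteq> 0} \<subseteq> F" for v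
  proof -
    have "(\<Sum>e\<in>F. co v e *\<^sub>C e) = (\<Sum>e | co v e \<noteq> 0. co v e *\<^sub>C e)"
      by (rule sum.mono_neutral_right) (use \<open>finite F\<close> that in auto)
    also have "\<dots> = v"
      unfolding co_def using complex_vector.sum_nonzero_representation_eq [OF indep] span by simp
    finally show ?thesis .
  qed
  define G where "G e e' = (\<Sum>i\<in>I. (cnj (co (\<xi> i) e) * co (\<eta> i) e') *\<^sub>C d i)" for e e'
  have G: "G e e' \<in> D" "adj (G e e') \<in> D" for e e'
  proof -
    show "G e e' \<in> D"
      unfolding G_def using cD d
      by (intro complex_vector.subspace_sum complex_vector.subspace_scale)
    then show "adj (G e e') \<in> D" using D by (simp add: operator_system_def)
  qed
  have "pos_matrix F (\<lambda>e e'. G e e' + adj (G e' e))"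
  proof (rule pos_matrixI)
    fix \<alpha> :: "'a \<Rightarrow> 'a"
    define a where "a v = (\<Sum>e\<in>F. co v e *\<^sub>C \<alpha> e)" for v
    have "clinear_map a"
      by (auto simp: clinear_map_def a_def co_add co_scale scaleC_add_left sum.distrib
          complex_vector.scale_sum_right scaleC_scaleC)
    have "(\<Sum>e\<in>F. \<Sum>e'\<in>F. cinner (\<alpha> e) (G e e' $$ \<alpha> e')) =
        (\<Sum>i\<in>I. cinner (a (\<xi> i)) (d i $$ a (\<eta> i)))"
      unfolding G_def a_def by (rule coordinate_form)
    then have "Re (\<Sum>e\<in>F. \<Sum>e'\<in>F. cinner (\<alpha> e) (G e e' $$ \<alpha> e')) =
        (\<Sum>i\<in>I. re_form (d i) (\<xi> i) (\<eta> i)) a"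
      using \<open>clinear_map a\<close> by (simp add: sum_fun_apply re_form_def)
    also have "\<dots> \<ge> 0"
      using le_funD [OF nonneg, of a] by simp
    finally show "(\<Sum>e\<in>F. \<Sum>e'\<in>F. cinner (\<alpha> e) ((G e e' + adj (G e' e)) $$ \<alpha> e')) \<in> \<real>\<^sub>\<ge>\<^sub>0"
      unfolding hermitian_form by (simp only: nonneg_Reals_of_real_iff)
  qed
  then have "pos_matrix F (\<lambda>e e'. \<phi> (G e e' + adj (G e' e)))"
    using G cD \<open>finite F\<close>
    by (intro ucp_pos_matrix [OF \<phi>]) (auto intro: complex_vector.subspace_add)
  moreover have "\<phi> (G e e' + adj (G e' e)) = \<phi> (G e e') + adj (\<phi> (G e' e))" for e e'
    using G by (simp add: ucp_add [OF \<phi>] ucp_adj [OF \<phi> D])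
  ultimately have "pos_matrix F (\<lambda>e e'. \<phi> (G e e') + adj (\<phi> (G e' e)))"
    by simp
  from pos_matrixD [OF this, of "\<lambda>e. e"]
  have "0 \<le> Re (\<Sum>e\<in>F. \<Sum>e'\<in>F. cinner e (\<phi> (G e e') $$ e'))"
    unfolding hermitian_form by (simp only: nonneg_Reals_of_real_iff)
  also have "\<phi> (G e e') = (\<Sum>i\<in>I. (cnj (co (\<xi> i) e) * co (\<eta> i) e') *\<^sub>C \<phi> (d i))" for e e'
    unfolding G_def using cD d
    by (subst ucp_sum [OF \<phi> cD]) (auto simp: ucp_scaleC [OF \<phi>] complex_vector.subspace_scale)
  then have "(\<Sum>e\<in>F. \<Sum>e'\<in>F. cinner e (\<phi> (G e e') $$ e')) =
      (\<Sum>i\<in>I. cinner (\<Sum>e\<in>F. co (\<xi> i) e *\<^sub>C e) (\<phi> (d i) $$ (\<Sum>e\<in>F. co (\<eta> i) e *\<^sub>C e)))"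
    using coordinate_form [of "\<lambda>e. e" "\<lambda>i. co (\<xi> i)" "\<lambda>i. co (\<eta> i)" "\<lambda>i. \<phi> (d i)" I F] by simp
  also have "\<dots> = (\<Sum>i\<in>I. cinner (\<xi> i) (\<phi> (d i) $$ \<eta> i))"
  proof (rule sum.cong)
    fix i assume "i \<in> I"
    then have "{e. co (\<xi> i) e \<noteq> 0} \<subseteq> F" "{e. co (\<eta> i) e \<noteq> 0} \<subseteq> F"
      by (auto simp: F_def)
    then show "cinner (\<Sum>e\<in>F. co (\<xi> i) e *\<^sub>C e) (\<phi> (d i) $$ (\<Sum>e\<in>F. co (\<eta> i) e *\<^sub>C e)) =
        cinner (\<xi> i) (\<phi> (d i) $$ \<eta> i)"
      by (simp add: expand)
  qed simp
  finally show ?thesis .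
qed

text \<open>Tensors with entries in multiples of 1 dominate all others; this is the order unit property needed
  for extending positive functionals.\<close>

lemma re_form_le_diagonal:
  "re_form x \<xi> \<eta> \<le> re_form (norm x *\<^sub>R 1) \<xi> \<xi> + re_form (norm x *\<^sub>R 1) \<eta> \<eta>"
proof (rule le_funI)
  fix a :: "'a \<Rightarrow> 'a"
  have "Re (cinner (a \<xi>) (x $$ a \<eta>)) \<le> norm x * (norm (a \<xi>) * norm (a \<eta>))"
    using order_trans [OF complex_Re_le_cmod cmod_cinner_bop_le] by (simp add: mult.assoc)
  also have "\<dots> \<le> norm x * ((norm (a \<xi>))\<^sup>2 + (norm (a \<eta>))\<^sup>2)"
  proof (rule mult_left_mono)
    have "0 \<le> norm (a \<xi>) * norm (a \<eta>)" by simp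
    then show "norm (a \<xi>) * norm (a \<eta>) \<le> (norm (a \<xi>))\<^sup>2 + (norm (a \<eta>))\<^sup>2"
      using sum_squares_bound [of "norm (a \<xi>)" "norm (a \<eta>)"] by linarith
  qed simp
  finally show "re_form x \<xi> \<eta> a \<le> (re_form (norm x *\<^sub>R 1) \<xi> \<xi> + re_form (norm x *\<^sub>R 1) \<eta> \<eta>) a"
    by (simp add: re_form_def cinner_simps cinner_self distrib_left del: of_real_power)
qed

text \<open>Let \<open>q v\<close> be the infimum of the values of the functional of \<open>\<phi>\<close> on tensors over \<open>D\<close> that dominate \<open>v\<close>. A
  linear functional below \<open>q\<close> is positive and agrees with the functional of \<open>\<phi>\<close> over \<open>D\<close>. Its
  complexification defines bounded sesquilinear forms, hence the operators \<open>\<psi> x\<close>.\<close>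

theorem arveson_extension:
  fixes \<phi> :: "'a :: complex_hilbert bop \<Rightarrow> 'a bop"
  assumes \<phi>: "ucp D \<phi>" and D: "operator_system D"
  shows "\<exists>\<psi>. ucp UNIV \<psi> \<and> (\<forall>x\<in>D. \<psi> x = \<phi> x)"
proof -
  have cD: "csubspace D" "1 \<in> D" using D by (auto simp: operator_system_def)
  have D_scaleR: "r *\<^sub>R x \<in> D" if "x \<in> D" for r x
    using that cD by (simp add: bop_scaleR_scaleC complex_vector.subspace_scale)
  define V where "V = span (range (\<lambda>(x :: 'a bop, \<xi>, \<eta>). re_form x \<xi> \<eta>))"
  have V: "subspace V" by (simp add: V_def)
  have re_form_V: "re_form x \<xi> \<eta> \<in> V" for x \<xi> \<eta>
    unfolding V_def by (rule span_base) (auto intro: image_eqI [where x = "(x, \<xi>, \<eta>)"])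
  define K where "K l = (\<Sum>(d, \<xi>, \<eta>)\<leftarrow>l. re_form d \<xi> \<eta>)" for l :: "('a bop \<times> 'a \<times> 'a) list"
  define f where "f l = (\<Sum>(d, \<xi>, \<eta>)\<leftarrow>l. Re (cinner \<xi> (\<phi> d $$ \<eta>)))"
    for l :: "('a bop \<times> 'a \<times> 'a) list"
  define L where "L = {l :: ('a bop \<times> 'a \<times> 'a) list. set l \<subseteq> D \<times> UNIV}"
  have f_nonneg: "0 \<le> f l" if "l \<in> L" "0 \<le> K l" for l
  proof -
    have K: "K l = (\<Sum>i\<in>{0..<length l}. re_form (fst (l ! i)) (fst (snd (l ! i))) (snd (snd (l ! i))))"
      by (simp add: K_def sum_list_sum_nth case_prod_unfold)
    have "fst (l ! i) \<in> D" if "i < length l" for i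
      using \<open>l \<in> L\<close> nth_mem [OF that] by (auto simp: L_def)
    then have "0 \<le> Re (\<Sum>i\<in>{0..<length l}. cinner (fst (snd (l ! i))) (\<phi> (fst (l ! i)) $$ snd (snd (l ! i))))"
      by (intro ucp_re_form_nonneg [OF \<phi> D]) (use that(2) K in auto)
    then show ?thesis
      by (simp add: f_def sum_list_sum_nth case_prod_unfold)
  qed
  define sc where "sc t = map (\<lambda>(d :: 'a bop, \<xi> :: 'a, \<eta> :: 'a). (t *\<^sub>R d, \<xi>, \<eta>))" for t :: real
  have K_simps: "K [] = 0" "K (l @ l') = K l + K l'" "K (sc t l) = t *\<^sub>R K l" for l l' t
  proof -
    show "K (sc t l) = t *\<^sub>R K l"
      by (induction l) (auto simp: K_def sc_def re_form_simps scaleR_add_right fun_eq_iff distrib_left)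
  qed (simp_all add: K_def)
  have f_simps: "f [] = 0" "f (l @ l') = f l + f l'" for l l'
    by (simp_all add: f_def)
  have f_scale: "f (sc t l) = t * f l" if "l \<in> L" for l t
    using that by (induction l) (auto simp: f_def sc_def L_def bop_scaleR_scaleC
        ucp_scaleC [OF \<phi>] cinner_simps distrib_left)
  have L_simps: "[] \<in> L" "l \<in> L \<Longrightarrow> l' \<in> L \<Longrightarrow> l @ l' \<in> L" "l \<in> L \<Longrightarrow> sc t l \<in> L" for l l' t
    by (auto simp: L_def sc_def D_scaleR)
  have dominated: "\<exists>l\<in>L. v \<le> K l" if "v \<in> V" for v
    using that unfolding V_def
  proof (induction rule: span_induct_alt)
    case base
    show ?case by (rule bexI [of _ "[]"]) (simp_all add: L_simps K_simps)
  next
    case (step c k v)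
    then obtain x \<xi> \<eta> l where k: "k = re_form x \<xi> \<eta>" and l: "l \<in> L" "v \<le> K l" by auto
    define n where "n = norm (c *\<^sub>R x)"
    have "c *\<^sub>R k + v \<le> K [(n *\<^sub>R 1, \<xi>, \<xi>), (n *\<^sub>R 1, \<eta>, \<eta>)] + K l"
      using re_form_le_diagonal [of "c *\<^sub>R x" \<xi> \<eta>] l(2)
      by (auto simp: K_def k re_form_simps(2) n_def intro!: add_mono)
    also have "\<dots> = K ([(n *\<^sub>R 1, \<xi>, \<xi>), (n *\<^sub>R 1, \<eta>, \<eta>)] @ l)"
      by (simp only: K_simps)
    finally show ?case
      by (rule bexI) (use l cD D_scaleR in \<open>auto simp: L_def\<close>)
  qed
  define q where "q v = Inf (f ` {l \<in> L. v \<le> K l})" for v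
  have bdd: "bdd_below (f ` {l \<in> L. v \<le> K l})" if "v \<in> V" for v
  proof -
    have "- v \<in> V" using V that by (rule subspace_neg)
    then obtain l' where l': "l' \<in> L" "- v \<le> K l'"
      using dominated by blast
    show ?thesis
    proof (rule bdd_belowI2)
      fix l
      assume "l \<in> {l \<in> L. v \<le> K l}"
      then have "l \<in> L" and vl: "v \<le> K l" by auto
      have "0 \<le> K (l @ l')"
      proof (rule le_funI)
        show "0 a \<le> K (l @ l') a" for a
          using le_funD [OF vl, of a] le_funD [OF l'(2), of a] by (simp add: K_simps)
      qed
      then have "0 \<le> f (l @ l')"
        using \<open>l \<in> L\<close> l'(1) by (intro f_nonneg L_simps)
      then show "- f l' \<le> f l" by (simp add: f_simps)
    qed
  qed
  have q_le: "q v \<le> f l" if "v \<in> V" "l \<in> L" "v \<le> K l" for v l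
    unfolding q_def using bdd [OF that(1)] that by (intro cInf_lower) auto
  have le_q: "c \<le> q v" if "v \<in> V" "\<And>l. l \<in> L \<Longrightarrow> v \<le> K l \<Longrightarrow> c \<le> f l" for c v
    unfolding q_def using dominated [OF that(1)] that by (intro cInf_greatest) auto
  have "sublinear_on V q"
    unfolding sublinear_on_def
  proof (intro conjI ballI allI impI)
    fix v w
    assume vw: "v \<in> V" "w \<in> V"
    then have "v + w \<in> V" using V by (simp add: subspace_add)
    have "q (v + w) \<le> f l + f l'" if "l \<in> L" "v \<le> K l" "l' \<in> L" "w \<le> K l'" for l l'
      using q_le [OF \<open>v + w \<in> V\<close>, of "l @ l'"] that
      by (simp add: L_simps K_simps f_simps add_mono)
    then have "q (v + w) - f l \<le> q w" if "l \<in> L" "v \<le> K l" for l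
      using vw that by (intro le_q) (metis add.commute diff_le_eq)+
    then have "q (v + w) - q w \<le> q v"
      using vw by (intro le_q) (auto simp: algebra_simps)
    then show "q (v + w) \<le> q v + q w" by simp
  next
    fix v and t :: real
    assume v: "v \<in> V" and "t \<ge> 0"
    have le: "q (s *\<^sub>R w) \<le> s * q w" if w: "w \<in> V" and "s > 0" for w s
    proof -
      have "q (s *\<^sub>R w) / s \<le> f l" if l: "l \<in> L" "w \<le> K l" for l
      proof -
        have "s *\<^sub>R w \<le> K (sc s l)"
          using l(2) \<open>s > 0\<close> by (auto simp: K_simps le_fun_def)
        then have "q (s *\<^sub>R w) \<le> f (sc s l)"
          using V w l by (intro q_le) (auto simp: subspace_scale L_simps)
        then show ?thesis using \<open>s > 0\<close> l by (simp add: f_scale field_simps)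
      qed
      then have "q (s *\<^sub>R w) / s \<le> q w" by (intro le_q w)
      then show ?thesis using \<open>s > 0\<close> by (simp add: field_simps)
    qed
    have "0 \<in> V" using V by (rule subspace_0)
    have "q 0 \<le> 0" using q_le [OF \<open>0 \<in> V\<close>, of "[]"] by (simp add: L_simps K_simps f_simps)
    moreover have "0 \<le> q 0" using f_nonneg by (intro le_q \<open>0 \<in> V\<close>)
    ultimately have "q 0 = 0" by (rule antisym)
    then show "q (t *\<^sub>R v) = t * q v"
      using le v \<open>t \<ge> 0\<close> by (intro positively_homogeneousI [OF V])
  qed
  from hahn_banach [OF V this] obtain \<Lambda> where
    \<Lambda>_add: "\<And>v w. v \<in> V \<Longrightarrow> w \<in> V \<Longrightarrow> \<Lambda> (v + w) = \<Lambda> v + \<Lambda> w" and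
    \<Lambda>_scale: "\<And>v t. v \<in> V \<Longrightarrow> \<Lambda> (t *\<^sub>R v) = t * \<Lambda> v" and
    \<Lambda>_le: "\<And>v. v \<in> V \<Longrightarrow> \<Lambda> v \<le> q v"
    by blast
  have \<Lambda>_0: "\<Lambda> 0 = 0"
    using \<Lambda>_scale [of 0 0] V by (simp add: subspace_0)
  have \<Lambda>_nonneg: "0 \<le> \<Lambda> v" if "v \<in> V" "0 \<le> v" for v
  proof -
    have "- v \<in> V" "- v \<le> 0" using that V by (auto simp: subspace_neg le_fun_def)
    then have "\<Lambda> (- v) \<le> 0"
      using \<Lambda>_le [of "- v"] q_le [of "- v" "[]"] by (simp add: L_simps K_simps f_simps)
    then show ?thesis using \<Lambda>_scale [OF that(1), of "- 1"] by simp
  qed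
  define \<rho> where "\<rho> x \<xi> \<eta> = \<Lambda> (re_form x \<xi> \<eta>)" for x \<xi> \<eta>
  have \<rho>_simps:
    "\<rho> (x + y) \<xi> \<eta> = \<rho> x \<xi> \<eta> + \<rho> y \<xi> \<eta>"
    "\<rho> (r *\<^sub>R x) \<xi> \<eta> = r * \<rho> x \<xi> \<eta>"
    "\<rho> x (\<xi> + \<xi>') \<eta> = \<rho> x \<xi> \<eta> + \<rho> x \<xi>' \<eta>"
    "\<rho> x \<xi> (\<eta> + \<eta>') = \<rho> x \<xi> \<eta> + \<rho> x \<xi> \<eta>'"
    "\<rho> x (c *\<^sub>C \<xi>) \<eta> = \<rho> (cnj c *\<^sub>C x) \<xi> \<eta>"
    "\<rho> x \<xi> (c *\<^sub>C \<eta>) = \<rho> (c *\<^sub>C x) \<xi> \<eta>" for x y \<xi> \<xi>' \<eta> \<eta>' r c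
    by (simp_all add: \<rho>_def re_form_simps \<Lambda>_add \<Lambda>_scale re_form_V)
  have \<rho>_D: "\<rho> d \<xi> \<eta> = Re (cinner \<xi> (\<phi> d $$ \<eta>))" if "d \<in> D" for d \<xi> \<eta>
  proof -
    have le: "\<rho> d \<xi> \<eta> \<le> Re (cinner \<xi> (\<phi> d $$ \<eta>))" if "d \<in> D" for d
      using order_trans [OF \<Lambda>_le q_le, of "re_form d \<xi> \<eta>" "[(d, \<xi>, \<eta>)]"] that
      by (simp add: re_form_V L_def K_def f_def \<rho>_def)
    have "\<rho> (- d) \<xi> \<eta> = - \<rho> d \<xi> \<eta>" using \<rho>_simps(2) [of "- 1" d] by simp
    moreover have "\<phi> (- d) = - \<phi> d"
      using ucp_scaleC [OF \<phi> that, of "- 1"] by simp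
    moreover have "- d \<in> D" using that cD by (simp add: complex_vector.subspace_neg)
    ultimately show ?thesis
      using le [OF that] le [of "- d"] by (simp add: cinner_simps)
  qed
  \<comment> \<open>\<open>\<rho>\<close> is the real part of a complex-linear functional, which is recovered in the usual way.\<close>
  define g where "g x \<xi> \<eta> = Complex (\<rho> x \<xi> \<eta>) (- \<rho> (\<i> *\<^sub>C x) \<xi> \<eta>)" for x \<xi> \<eta>
  have \<rho>_complex: "\<rho> (c *\<^sub>C x) \<xi> \<eta> = Re c * \<rho> x \<xi> \<eta> + Im c * \<rho> (\<i> *\<^sub>C x) \<xi> \<eta>" for c x \<xi> \<eta>
  proof -
    have "c *\<^sub>C x = Re c *\<^sub>R x + Im c *\<^sub>R \<i> *\<^sub>C x"
      by (subst complex_eq [of c])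
        (simp add: scaleC_add_left bop_scaleR_scaleC scaleC_scaleC mult.commute)
    then show ?thesis by (simp add: \<rho>_simps)
  qed
  have g_add: "g (x + y) \<xi> \<eta> = g x \<xi> \<eta> + g y \<xi> \<eta>" "g x (\<xi> + \<xi>') \<eta> = g x \<xi> \<eta> + g x \<xi>' \<eta>"
    "g x \<xi> (\<eta> + \<eta>') = g x \<xi> \<eta> + g x \<xi> \<eta>'" for x y \<xi> \<xi>' \<eta> \<eta>'
    by (simp_all add: g_def \<rho>_simps scaleC_add_right complex_eq_iff)
  have g_scale: "g (c *\<^sub>C x) \<xi> \<eta> = c * g x \<xi> \<eta>" for c x \<xi> \<eta>
    by (simp add: g_def complex_eq_iff scaleC_scaleC \<rho>_complex [of c] \<rho>_complex [of "\<i> * c"]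
        algebra_simps)
  have "g x (c *\<^sub>C \<xi>) \<eta> = g (cnj c *\<^sub>C x) \<xi> \<eta>" "g x \<xi> (c *\<^sub>C \<eta>) = g (c *\<^sub>C x) \<xi> \<eta>" for c x \<xi> \<eta>
    by (simp_all add: g_def \<rho>_simps scaleC_scaleC mult.commute)
  then have g_sesq: "g x (c *\<^sub>C \<xi>) \<eta> = cnj c * g x \<xi> \<eta>" "g x \<xi> (c *\<^sub>C \<eta>) = c * g x \<xi> \<eta>" for c x \<xi> \<eta>
    by (simp_all add: g_scale)
  have g_D: "g d \<xi> \<eta> = cinner \<xi> (\<phi> d $$ \<eta>)" if "d \<in> D" for d \<xi> \<eta>
    using that cD by (simp add: g_def complex_eq_iff \<rho>_D complex_vector.subspace_scale
        ucp_scaleC [OF \<phi>] cinner_simps)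
  have g_pos: "(\<Sum>i\<in>I. \<Sum>j\<in>I. g (X i j) (\<xi> i) (\<xi> j)) \<in> \<real>\<^sub>\<ge>\<^sub>0"
    if "finite I" "pos_matrix I X" for I :: "'i set" and X \<xi>
  proof -
    have \<Lambda>_sum: "\<Lambda> (\<Sum>i\<in>J. v i) = (\<Sum>i\<in>J. \<Lambda> (v i))" if "\<And>i. v i \<in> V" for J :: "'i set" and v
      by (induction J rule: infinite_finite_induct)
        (simp_all only: sum.infinite sum.empty sum.insert \<Lambda>_0
          \<Lambda>_add [OF that subspace_sum [OF V that]] not_False_eq_True)
    have \<rho>_sum: "(\<Sum>i\<in>I. \<Sum>j\<in>I. \<rho> (Y i j) (\<xi> i) (\<xi> j)) =
        \<Lambda> (\<Sum>i\<in>I. \<Sum>j\<in>I. re_form (Y i j) (\<xi> i) (\<xi> j))" for Y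
      by (simp add: \<rho>_def \<Lambda>_sum re_form_V V subspace_sum)
    have form: "(\<Sum>i\<in>I. \<Sum>j\<in>I. re_form (c *\<^sub>C X i j) (\<xi> i) (\<xi> j)) a =
        (if clinear_map a then Re (c * (\<Sum>i\<in>I. \<Sum>j\<in>I. cinner (a (\<xi> i)) (X i j $$ a (\<xi> j)))) else 0)"
      for a c
      by (simp add: sum_fun_apply re_form_def cinner_simps sum_distrib_left)
    have pos: "(\<Sum>i\<in>I. \<Sum>j\<in>I. cinner (a (\<xi> i)) (X i j $$ a (\<xi> j))) \<in> \<real>\<^sub>\<ge>\<^sub>0" for a
      using pos_matrixD [OF that(2), of "\<lambda>i. a (\<xi> i)"] by simp
    have "0 \<le> (\<Sum>i\<in>I. \<Sum>j\<in>I. re_form (X i j) (\<xi> i) (\<xi> j))"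
    proof (rule le_funI)
      show "0 a \<le> (\<Sum>i\<in>I. \<Sum>j\<in>I. re_form (X i j) (\<xi> i) (\<xi> j)) a" for a
        using form [of 1 a] pos [of a]
        unfolding scaleC_one complex_nonneg_Reals_iff mult_1 by (simp only: zero_fun_apply) simp
    qed
    then have "0 \<le> (\<Sum>i\<in>I. \<Sum>j\<in>I. \<rho> (X i j) (\<xi> i) (\<xi> j))"
      unfolding \<rho>_sum by (intro \<Lambda>_nonneg subspace_sum V re_form_V)
    \<comment> \<open>Multiplying a positive tensor by \<open>\<i>\<close> gives one with vanishing real part.\<close>
    moreover have "(\<Sum>i\<in>I. \<Sum>j\<in>I. re_form (\<i> *\<^sub>C X i j) (\<xi> i) (\<xi> j)) = 0"
    proof
      show "(\<Sum>i\<in>I. \<Sum>j\<in>I. re_form (\<i> *\<^sub>C X i j) (\<xi> i) (\<xi> j)) a = 0 a" for a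
        using pos [of a] unfolding form complex_nonneg_Reals_iff by (simp del: Re_sum Im_sum)
    qed
    then have "(\<Sum>i\<in>I. \<Sum>j\<in>I. \<rho> (\<i> *\<^sub>C X i j) (\<xi> i) (\<xi> j)) = 0"
      unfolding \<rho>_sum by (simp add: \<Lambda>_0)
    ultimately show ?thesis
      by (simp add: complex_nonneg_Reals_iff g_def sum_negf)
  qed
  have g_bound: "cmod (g x \<xi> \<eta>) \<le> norm x * norm \<xi> * norm \<eta>" for x \<xi> \<eta>
  proof (rule block_form(2) [where b' = "g (adj x)"])
    show "complex_of_real (norm x * ((norm \<xi>)\<^sup>2 + (norm \<eta>)\<^sup>2)) + g x \<xi> \<eta> + g (adj x) \<eta> \<xi> \<in> \<real>\<^sub>\<ge>\<^sub>0" for \<xi> \<eta>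
    proof -
      define X where "X i j = (if i = j then norm x *\<^sub>R 1 else if j then x else adj x)" for i j
      have "pos_matrix UNIV X"
        unfolding X_def by (rule pos_matrix_norm_block) simp
      then have "(\<Sum>i\<in>UNIV. \<Sum>j\<in>UNIV. g (X i j) (if i then \<eta> else \<xi>) (if j then \<eta> else \<xi>)) \<in> \<real>\<^sub>\<ge>\<^sub>0"
        by (intro g_pos) auto
      moreover have "g (norm x *\<^sub>R 1) \<zeta> \<zeta> = of_real (norm x * (norm \<zeta>)\<^sup>2)" for \<zeta>
        using g_D [OF cD(2)] by (simp add: bop_scaleR_scaleC g_scale ucp_one [OF \<phi>] cinner_self)
      ultimately show ?thesis
        by (simp add: UNIV_bool X_def algebra_simps)
    qed
  qed (simp_all add: g_sesq)
  have "\<exists>T. \<forall>\<xi> \<eta>. cinner \<xi> (T $$ \<eta>) = g x \<xi> \<eta>" for x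
    by (rule bop_of_sesquilinear [where K = "norm x"]) (simp_all add: g_add g_sesq g_bound)
  then obtain \<psi> where \<psi>: "\<And>x \<xi> \<eta>. cinner \<xi> (\<psi> x $$ \<eta>) = g x \<xi> \<eta>"
    by metis
  have "\<psi> d = \<phi> d" if "d \<in> D" for d
    by (rule bop_eqI_cinner) (simp add: \<psi> g_D that)
  moreover have "ucp UNIV \<psi>"
  proof (rule ucpI)
    show "\<psi> 1 = 1" using calculation [OF cD(2)] by (simp add: ucp_one [OF \<phi>])
    show "\<psi> (x + y) = \<psi> x + \<psi> y" "\<psi> (c *\<^sub>C x) = c *\<^sub>C \<psi> x" for x y c
      by (rule bop_eqI_cinner, simp add: \<psi> cinner_simps g_add g_scale)+
    show "pos_matrix {..<n} (\<lambda>i j. \<psi> (X i j))" if "pos_matrix {..<n} X" for n :: nat and X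
      unfolding pos_matrix_def \<psi> using g_pos [OF _ that] by auto
  qed
  ultimately show ?thesis by blast
qed

section \<open>The norm of an operator matrix\<close>

abbreviation vnorm :: "nat \<Rightarrow> (nat \<Rightarrow> 'a :: complex_hilbert) \<Rightarrow> real"
  where "vnorm n \<xi> \<equiv> L2_set (\<lambda>i. norm (\<xi> i)) {..<n}"

definition mprod ::
    "nat \<Rightarrow> (nat \<times> nat \<Rightarrow> 'a :: complex_hilbert bop) \<Rightarrow> (nat \<times> nat \<Rightarrow> 'a bop) \<Rightarrow> nat \<times> nat \<Rightarrow> 'a bop"
  where "mprod n X Y = (\<lambda>(i, k)\<in>idx n. \<Sum>j<n. X (i, j) * Y (j, k))"

definition mstar :: "nat \<Rightarrow> (nat \<times> nat \<Rightarrow> 'a :: complex_hilbert bop) \<Rightarrow> nat \<times> nat \<Rightarrow> 'a bop"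
  where "mstar n X = (\<lambda>(i, j)\<in>idx n. adj (X (j, i)))"

lemma mprod_apply [simp]: "i < n \<Longrightarrow> k < n \<Longrightarrow> mprod n X Y (i, k) = (\<Sum>j<n. X (i, j) * Y (j, k))"
  by (simp add: mprod_def)

lemma mstar_apply [simp]: "i < n \<Longrightarrow> j < n \<Longrightarrow> mstar n X (i, j) = adj (X (j, i))"
  by (simp add: mstar_def)

lemma mat_map_apply [simp]: "i < n \<Longrightarrow> j < n \<Longrightarrow> mat_map n f X (i, j) = f (X (i, j))"
  by (simp add: compose_def)

lemma vnorm_self: "(\<Sum>i<n. cinner (\<xi> i) (\<xi> i)) = of_real ((vnorm n \<xi>)\<^sup>2)"
  by (simp add: cinner_self L2_set_def sum_nonneg)

lemma cmod_sum_cinner_le: "cmod (\<Sum>i<n. cinner (\<xi> i) (\<eta> i)) \<le> vnorm n \<xi> * vnorm n \<eta>"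
proof -
  have "cmod (\<Sum>i<n. cinner (\<xi> i) (\<eta> i)) \<le> (\<Sum>i<n. \<bar>norm (\<xi> i)\<bar> * \<bar>norm (\<eta> i)\<bar>)"
    by (rule sum_norm_le) (simp add: cmod_cinner_le)
  also have "\<dots> \<le> vnorm n \<xi> * vnorm n \<eta>"
    by (rule L2_set_mult_ineq)
  finally show ?thesis .
qed

lemma mat_apply_mprod:
  assumes "i < n"
  shows "mat_apply n (mprod n X Y) \<xi> i = mat_apply n X (mat_apply n Y \<xi>) i"
proof -
  have "mat_apply n (mprod n X Y) \<xi> i = (\<Sum>k<n. \<Sum>j<n. X (i, j) $$ Y (j, k) $$ \<xi> k)"
    using assms by (simp add: mat_apply_def bop_apply_sum_left)
  also have "\<dots> = mat_apply n X (mat_apply n Y \<xi>) i"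
    by (subst sum.swap) (simp add: mat_apply_def bop_apply_sum_right)
  finally show ?thesis .
qed

lemma cinner_mat_apply_mstar:
  "(\<Sum>i<n. cinner (mat_apply n (mstar n X) \<xi> i) (\<eta> i)) =
    (\<Sum>i<n. cinner (\<xi> i) (mat_apply n X \<eta> i))"
  by (simp add: mat_apply_def cinner_sum_left cinner_sum_right cinner_adj_left) (rule sum.swap)

lemma vnorm_mat_apply_le_sum:
  "vnorm n (mat_apply n X \<xi>) \<le> (\<Sum>i<n. \<Sum>j<n. norm (X (i, j))) * vnorm n \<xi>"
proof -
  have "vnorm n (mat_apply n X \<xi>) \<le> (\<Sum>i<n. norm (mat_apply n X \<xi> i))"
    by (rule L2_set_le_sum) simp
  also have "\<dots> \<le> (\<Sum>i<n. \<Sum>j<n. norm (X (i, j)) * vnorm n \<xi>)"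
    unfolding mat_apply_def
  proof (intro sum_mono sum_norm_le)
    fix i j
    assume "j \<in> {..<n}"
    then have "norm (\<xi> j) \<le> vnorm n \<xi>"
      by (intro member_le_L2_set) auto
    then show "norm (X (i, j) $$ \<xi> j) \<le> norm (X (i, j)) * vnorm n \<xi>"
      using order_trans [OF norm_bop_apply_le mult_left_mono] by (metis norm_ge_zero)
  qed
  finally show ?thesis by (simp add: sum_distrib_right)
qed

lemma mat_norm_leI:
  assumes "0 \<le> C" "\<And>\<xi>. vnorm n (mat_apply n X \<xi>) \<le> C * vnorm n \<xi>"
  shows "mat_norm n X \<le> C"
  unfolding mat_norm_def
proof (rule cSUP_least)
  show "{\<xi> :: nat \<Rightarrow> 'a. vnorm n \<xi> \<le> 1} \<noteq> {}"
    by (auto intro!: exI [of _ "\<lambda>_. 0"] simp: L2_set_def)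
  fix \<xi> :: "nat \<Rightarrow> 'a"
  assume "\<xi> \<in> {\<xi>. vnorm n \<xi> \<le> 1}"
  then have "C * vnorm n \<xi> \<le> C * 1"
    using assms(1) by (intro mult_left_mono) auto
  then show "vnorm n (mat_apply n X \<xi>) \<le> C"
    using assms(2) [of \<xi>] by simp
qed

lemma bdd_above_mat_norm:
  "bdd_above ((\<lambda>\<xi>. vnorm n (mat_apply n X \<xi>)) ` {\<xi>. vnorm n \<xi> \<le> 1})"
proof (rule bdd_aboveI2)
  let ?C = "\<Sum>i<n. \<Sum>j<n. norm (X (i, j))"
  fix \<xi> :: "nat \<Rightarrow> 'a"
  assume "\<xi> \<in> {\<xi>. vnorm n \<xi> \<le> 1}"
  then have "?C * vnorm n \<xi> \<le> ?C * 1"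
    by (intro mult_left_mono) (auto simp: sum_nonneg)
  then show "vnorm n (mat_apply n X \<xi>) \<le> ?C"
    using vnorm_mat_apply_le_sum [of n X \<xi>] by simp
qed

lemma mat_norm_nonneg: "0 \<le> mat_norm n X"
proof -
  have "vnorm n (mat_apply n X (\<lambda>_. 0)) \<le> mat_norm n X"
    unfolding mat_norm_def
    by (rule cSUP_upper [OF _ bdd_above_mat_norm]) (auto simp: L2_set_def)
  then show ?thesis using L2_set_nonneg order_trans by blast
qed

lemma vnorm_mat_apply_le: "vnorm n (mat_apply n X \<xi>) \<le> mat_norm n X * vnorm n \<xi>"
proof (cases "vnorm n \<xi> = 0")
  case True
  then show ?thesis using vnorm_mat_apply_le_sum [of n X \<xi>] by simp
next
  case False
  define t where "t = 1 / vnorm n \<xi>"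
  have "t > 0" using False by (simp add: t_def order_less_le)
  have scale: "vnorm n (\<lambda>i. t *\<^sub>R \<zeta> i) = t * vnorm n \<zeta>" for \<zeta> :: "nat \<Rightarrow> 'a"
    using \<open>t > 0\<close> by (simp add: L2_set_right_distrib)
  have "mat_apply n X (\<lambda>i. t *\<^sub>R \<xi> i) = (\<lambda>i. t *\<^sub>R mat_apply n X \<xi> i)"
    by (simp add: mat_apply_def scaleR_sum_right fun_eq_iff)
  moreover have "vnorm n (mat_apply n X (\<lambda>i. t *\<^sub>R \<xi> i)) \<le> mat_norm n X"
    unfolding mat_norm_def
    by (rule cSUP_upper [OF _ bdd_above_mat_norm])
      (use False in \<open>simp only: mem_Collect_eq scale, simp add: t_def\<close>)
  ultimately have "t * vnorm n (mat_apply n X \<xi>) \<le> mat_norm n X"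
    by (simp only: scale)
  then show ?thesis using \<open>t > 0\<close> False by (simp add: t_def field_simps)
qed

lemma mat_norm_le_sum: "mat_norm n X \<le> (\<Sum>i<n. \<Sum>j<n. norm (X (i, j)))"
  by (rule mat_norm_leI) (simp_all add: sum_nonneg vnorm_mat_apply_le_sum)

lemma norm_entry_le_mat_norm:
  fixes X :: "nat \<times> nat \<Rightarrow> 'a :: complex_hilbert bop"
  assumes "i < n" "j < n"
  shows "norm (X (i, j)) \<le> mat_norm n X"
proof (rule norm_bop_le [OF mat_norm_nonneg])
  fix x :: 'a
  define \<xi> :: "nat \<Rightarrow> 'a" where "\<xi> k = (if k = j then x else 0)" for k
  have "vnorm n \<xi> = sqrt (\<Sum>k<n. if k = j then (norm x)\<^sup>2 else 0)"
    unfolding L2_set_def \<xi>_def by (intro arg_cong [where f = sqrt] sum.cong) auto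
  then have "vnorm n \<xi> = norm x" using assms by simp
  have "mat_apply n X \<xi> i = (\<Sum>k<n. if k = j then X (i, j) $$ x else 0)"
    unfolding mat_apply_def \<xi>_def by (intro sum.cong) auto
  then have "norm (X (i, j) $$ x) = norm (mat_apply n X \<xi> i)"
    using assms by simp
  also have "\<dots> \<le> vnorm n (mat_apply n X \<xi>)"
    using assms by (intro member_le_L2_set [where f = "\<lambda>i. norm (mat_apply n X \<xi> i)"]) auto
  also have "\<dots> \<le> mat_norm n X * norm x"
    using vnorm_mat_apply_le [of n X \<xi>] \<open>vnorm n \<xi> = norm x\<close> by simp
  finally show "norm (X (i, j) $$ x) \<le> mat_norm n X * norm x" .
qed

lemma vnorm_cong: "(\<And>i. i < n \<Longrightarrow> \<xi> i = \<eta> i) \<Longrightarrow> vnorm n \<xi> = vnorm n \<eta>"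
  by (rule L2_set_cong) auto

lemma mat_norm_cong:
  assumes "\<And>i j. i < n \<Longrightarrow> j < n \<Longrightarrow> X (i, j) = Y (i, j)"
  shows "mat_norm n X = mat_norm n Y"
proof -
  have "vnorm n (mat_apply n X \<xi>) = vnorm n (mat_apply n Y \<xi>)" for \<xi>
    by (rule vnorm_cong) (simp add: mat_apply_def assms)
  then show ?thesis by (simp add: mat_norm_def)
qed

lemma vnorm_triangle: "vnorm n (\<lambda>i. \<xi> i + \<eta> i) \<le> vnorm n \<xi> + vnorm n \<eta>"
proof -
  have "vnorm n (\<lambda>i. \<xi> i + \<eta> i) \<le> L2_set (\<lambda>i. norm (\<xi> i) + norm (\<eta> i)) {..<n}"
    by (rule L2_set_mono) (simp_all add: norm_triangle_ineq)
  also have "\<dots> \<le> vnorm n \<xi> + vnorm n \<eta>"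
    by (rule L2_set_triangle_ineq)
  finally show ?thesis .
qed

lemma mat_norm_triangle:
  assumes "\<And>i j. i < n \<Longrightarrow> j < n \<Longrightarrow> Z (i, j) = X (i, j) + Y (i, j)"
  shows "mat_norm n Z \<le> mat_norm n X + mat_norm n Y"
proof (rule mat_norm_leI)
  show "0 \<le> mat_norm n X + mat_norm n Y" by (simp add: mat_norm_nonneg)
  fix \<xi>
  have "vnorm n (mat_apply n Z \<xi>) = vnorm n (\<lambda>i. mat_apply n X \<xi> i + mat_apply n Y \<xi> i)"
    by (rule vnorm_cong) (simp add: mat_apply_def assms sum.distrib)
  also have "\<dots> \<le> vnorm n (mat_apply n X \<xi>) + vnorm n (mat_apply n Y \<xi>)"
    by (rule vnorm_triangle)
  also have "\<dots> \<le> (mat_norm n X + mat_norm n Y) * vnorm n \<xi>"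
    using vnorm_mat_apply_le [of n X \<xi>] vnorm_mat_apply_le [of n Y \<xi>] by (simp add: algebra_simps)
  finally show "vnorm n (mat_apply n Z \<xi>) \<le> (mat_norm n X + mat_norm n Y) * vnorm n \<xi>" .
qed

lemma mat_norm_scaleC:
  assumes "\<And>i j. i < n \<Longrightarrow> j < n \<Longrightarrow> Z (i, j) = c *\<^sub>C X (i, j)"
  shows "mat_norm n Z = cmod c * mat_norm n X"
proof -
  have le: "mat_norm n Z \<le> cmod c * mat_norm n X"
    if "\<And>i j. i < n \<Longrightarrow> j < n \<Longrightarrow> Z (i, j) = c *\<^sub>C X (i, j)"
    for c and X Z :: "nat \<times> nat \<Rightarrow> 'a bop"
  proof (rule mat_norm_leI)
    show "0 \<le> cmod c * mat_norm n X" by (simp add: mat_norm_nonneg)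
    fix \<xi>
    have "vnorm n (mat_apply n Z \<xi>) = vnorm n (\<lambda>i. c *\<^sub>C mat_apply n X \<xi> i)"
      by (rule vnorm_cong) (simp add: mat_apply_def that complex_vector.scale_sum_right)
    also have "\<dots> = cmod c * vnorm n (mat_apply n X \<xi>)"
      by (simp add: norm_scaleC L2_set_right_distrib)
    also have "\<dots> \<le> cmod c * (mat_norm n X * vnorm n \<xi>)"
      by (intro mult_left_mono vnorm_mat_apply_le) simp
    finally show "vnorm n (mat_apply n Z \<xi>) \<le> cmod c * mat_norm n X * vnorm n \<xi>"
      by (simp add: mult.assoc)
  qed
  have le_c: "mat_norm n Z \<le> cmod c * mat_norm n X"
    by (rule le) (rule assms)
  show ?thesis
  proof (cases "c = 0")
    case True
    then show ?thesis using le_c mat_norm_nonneg [of n Z] by simp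
  next
    case False
    have "mat_norm n X \<le> cmod (inverse c) * mat_norm n Z"
      by (rule le) (simp add: assms scaleC_scaleC False scaleC_one)
    then show ?thesis
      using le_c False by (simp add: norm_inverse norm_divide field_simps)
  qed
qed

lemma mat_norm_mprod: "mat_norm n (mprod n X Y) \<le> mat_norm n X * mat_norm n Y"
proof (rule mat_norm_leI)
  fix \<xi>
  have "vnorm n (mat_apply n (mprod n X Y) \<xi>) = vnorm n (mat_apply n X (mat_apply n Y \<xi>))"
    by (rule vnorm_cong) (rule mat_apply_mprod)
  also have "\<dots> \<le> mat_norm n X * vnorm n (mat_apply n Y \<xi>)"
    by (rule vnorm_mat_apply_le)
  also have "\<dots> \<le> mat_norm n X * (mat_norm n Y * vnorm n \<xi>)"
    by (intro mult_left_mono vnorm_mat_apply_le mat_norm_nonneg)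
  finally show "vnorm n (mat_apply n (mprod n X Y) \<xi>) \<le> mat_norm n X * mat_norm n Y * vnorm n \<xi>"
    by (simp add: mult.assoc)
qed (simp add: mat_norm_nonneg)

lemma mat_norm_mstar_le: "mat_norm n (mstar n X) \<le> mat_norm n X"
proof (rule mat_norm_leI [OF mat_norm_nonneg])
  fix \<xi>
  define \<eta> where "\<eta> = mat_apply n (mstar n X) \<xi>"
  have "(vnorm n \<eta>)\<^sup>2 = cmod (\<Sum>i<n. cinner (\<xi> i) (mat_apply n X \<eta> i))"
  proof -
    have "(\<Sum>i<n. cinner (\<xi> i) (mat_apply n X \<eta> i)) = of_real ((vnorm n \<eta>)\<^sup>2)"
      using cinner_mat_apply_mstar [of n X \<xi> \<eta>] unfolding \<eta>_def [symmetric] vnorm_self by simp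
    then show ?thesis by (simp only: norm_of_real) simp
  qed
  also have "\<dots> \<le> vnorm n \<xi> * (mat_norm n X * vnorm n \<eta>)"
    by (rule order_trans [OF cmod_sum_cinner_le]) (intro mult_left_mono vnorm_mat_apply_le, simp)
  finally have "vnorm n \<eta> * vnorm n \<eta> \<le> (mat_norm n X * vnorm n \<xi>) * vnorm n \<eta>"
    by (simp add: power2_eq_square mult_ac)
  then show "vnorm n \<eta> \<le> mat_norm n X * vnorm n \<xi>"
    using mult_nonneg_nonneg [OF mat_norm_nonneg L2_set_nonneg]
    by (cases "vnorm n \<eta> = 0") (auto simp: order_less_le)
qed

lemma qform_diagonal:
  "qform {..<n} (\<lambda>i j. if i = j then c *\<^sub>R 1 else 0) \<xi> = of_real (c * (vnorm n \<xi>)\<^sup>2)"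
proof -
  have "(\<Sum>j<n. cinner (\<xi> i) ((if i = j then c *\<^sub>R 1 else 0) $$ \<xi> j)) = c * cinner (\<xi> i) (\<xi> i)"
    if "i < n" for i
  proof -
    have "(\<Sum>j<n. cinner (\<xi> i) ((if i = j then c *\<^sub>R 1 else 0) $$ \<xi> j)) =
        (\<Sum>j<n. if i = j then c * cinner (\<xi> i) (\<xi> i) else 0)"
      by (intro sum.cong) (auto simp: cinner_simps)
    then show ?thesis using that by simp
  qed
  then show ?thesis
    using vnorm_self [where n = n and \<xi> = \<xi>] by (simp flip: sum_distrib_left)
qed

lemma qform_gram_diff:
  "qform {..<n} (\<lambda>i j. Z i j - (\<Sum>k<n. adj (X (k, i)) * X (k, j))) \<xi> =
    qform {..<n} Z \<xi> - of_real ((vnorm n (mat_apply n X \<xi>))\<^sup>2)"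
  unfolding vnorm_self [symmetric] mat_apply_def gram_form [where T = "\<lambda>k i. X (k, i)", symmetric]
  by (simp add: cinner_simps sum_subtractf)

lemma pos_matrix_mat_norm:
  assumes "mat_norm n X \<le> M"
  shows "pos_matrix {..<n} (\<lambda>i j. (if i = j then M\<^sup>2 *\<^sub>R 1 else 0) - (\<Sum>k<n. adj (X (k, i)) * X (k, j)))"
proof (rule pos_matrixI)
  fix \<xi> :: "nat \<Rightarrow> 'a"
  have "0 \<le> M" using mat_norm_nonneg assms by (rule order_trans)
  have "vnorm n (mat_apply n X \<xi>) \<le> M * vnorm n \<xi>"
    using order_trans [OF vnorm_mat_apply_le mult_right_mono [OF assms L2_set_nonneg]] .
  then have "(vnorm n (mat_apply n X \<xi>))\<^sup>2 \<le> (M * vnorm n \<xi>)\<^sup>2"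
    by (intro power_mono) auto
  then show "qform {..<n} (\<lambda>i j. (if i = j then M\<^sup>2 *\<^sub>R 1 else 0) - (\<Sum>k<n. adj (X (k, i)) * X (k, j))) \<xi>
      \<in> \<real>\<^sub>\<ge>\<^sub>0"
    unfolding qform_gram_diff [where X = X] qform_diagonal
    by (simp only: of_real_diff [symmetric] nonneg_Reals_of_real_iff power_mult_distrib diff_ge_0_iff_ge)
qed

text \<open>The Schwarz inequality \<open>\<phi>(X)\<^sup>* \<phi>(X) \<le> \<phi>(X\<^sup>* X)\<close> for the matrix amplification of \<open>\<phi>\<close>. Together with
  \<open>X\<^sup>* X \<le> \<parallel>X\<parallel>\<^sup>2\<close> it gives the two norm estimates that follow.\<close>

lemma ucp_mat_schwarz:
  assumes \<phi>: "ucp UNIV \<phi>"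
  shows "(vnorm n (mat_apply n (mat_map n \<phi> X) \<xi>))\<^sup>2 \<le>
    Re (\<Sum>i<n. cinner (\<xi> i) (mat_apply n (mat_map n \<phi> (mprod n (mstar n X) X)) \<xi> i))"
proof -
  have "qform {..<n} (\<lambda>i j. \<Sum>k<n. \<phi> (adj (X (k, i)) * X (k, j)) - adj (\<phi> (X (k, i))) * \<phi> (X (k, j))) \<xi> \<in> \<real>\<^sub>\<ge>\<^sub>0"
    by (rule pos_matrixD, rule ucp_schwarz [OF \<phi>]) auto
  also have "qform {..<n} (\<lambda>i j. \<Sum>k<n. \<phi> (adj (X (k, i)) * X (k, j)) - adj (\<phi> (X (k, i))) * \<phi> (X (k, j))) \<xi> =
      qform {..<n} (\<lambda>i j. \<Sum>k<n. \<phi> (adj (X (k, i)) * X (k, j))) \<xi> -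
      qform {..<n} (\<lambda>i j. \<Sum>k<n. adj (\<phi> (X (k, i))) * \<phi> (X (k, j))) \<xi>"
    by (simp add: sum_subtractf cinner_simps)
  also have "qform {..<n} (\<lambda>i j. \<Sum>k<n. adj (\<phi> (X (k, i))) * \<phi> (X (k, j))) \<xi> =
      (\<Sum>k<n. cinner (mat_apply n (mat_map n \<phi> X) \<xi> k) (mat_apply n (mat_map n \<phi> X) \<xi> k))"
    by (simp add: gram_form [where T = "\<lambda>k i. \<phi> (X (k, i))"] mat_apply_def)
  also have "\<dots> = of_real ((vnorm n (mat_apply n (mat_map n \<phi> X) \<xi>))\<^sup>2)"
    by (rule vnorm_self)
  also have "qform {..<n} (\<lambda>i j. \<Sum>k<n. \<phi> (adj (X (k, i)) * X (k, j))) \<xi> =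
      (\<Sum>i<n. cinner (\<xi> i) (mat_apply n (mat_map n \<phi> (mprod n (mstar n X) X)) \<xi> i))"
    by (simp add: mat_apply_def cinner_sum_right ucp_sum [OF \<phi>])
  finally show ?thesis
    by (simp add: complex_nonneg_Reals_iff del: of_real_power Re_sum)
qed

lemma mat_norm_sq_le_ucp:
  assumes \<phi>: "ucp UNIV \<phi>"
  shows "(mat_norm n (mat_map n \<phi> X))\<^sup>2 \<le> mat_norm n (mat_map n \<phi> (mprod n (mstar n X) X))"
    (is "_ \<le> ?M")
proof -
  have "mat_norm n (mat_map n \<phi> X) \<le> sqrt ?M"
  proof (rule mat_norm_leI)
    fix \<xi>
    let ?\<eta> = "mat_apply n (mat_map n \<phi> (mprod n (mstar n X) X)) \<xi>"
    have "(vnorm n (mat_apply n (mat_map n \<phi> X) \<xi>))\<^sup>2 \<le> Re (\<Sum>i<n. cinner (\<xi> i) (?\<eta> i))"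
      by (rule ucp_mat_schwarz [OF \<phi>])
    also have "\<dots> \<le> cmod (\<Sum>i<n. cinner (\<xi> i) (?\<eta> i))"
      by (rule complex_Re_le_cmod)
    also have "\<dots> \<le> vnorm n \<xi> * vnorm n ?\<eta>"
      by (rule cmod_sum_cinner_le)
    also have "\<dots> \<le> vnorm n \<xi> * (?M * vnorm n \<xi>)"
      by (intro mult_left_mono vnorm_mat_apply_le) simp
    also have "\<dots> = (sqrt ?M * vnorm n \<xi>)\<^sup>2"
      by (simp add: power_mult_distrib mat_norm_nonneg) (simp add: power2_eq_square mult_ac)
    finally show "vnorm n (mat_apply n (mat_map n \<phi> X) \<xi>) \<le> sqrt ?M * vnorm n \<xi>"
      by (rule power2_le_imp_le) (simp add: mat_norm_nonneg)
  qed (simp add: mat_norm_nonneg)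
  then have "(mat_norm n (mat_map n \<phi> X))\<^sup>2 \<le> (sqrt ?M)\<^sup>2"
    by (intro power_mono mat_norm_nonneg)
  then show ?thesis by (simp add: mat_norm_nonneg)
qed

lemma mat_norm_ucp_le:
  assumes \<phi>: "ucp UNIV \<phi>"
  shows "mat_norm n (mat_map n \<phi> X) \<le> mat_norm n X"
proof (rule mat_norm_leI [OF mat_norm_nonneg])
  fix \<xi> :: "nat \<Rightarrow> 'a"
  let ?M = "mat_norm n X"
  let ?Z = "\<lambda>i j. (if i = j then ?M\<^sup>2 *\<^sub>R 1 else 0) :: 'a bop"
  have \<phi>_Z: "\<phi> (?Z i j) = ?Z i j" for i j
    using ucp_scaleC [OF \<phi>, of 1] ucp_one [OF \<phi>] ucp_zero [OF \<phi>] by (simp add: bop_scaleR_scaleC)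
  have "pos_matrix {..<n} (\<lambda>i j. \<phi> (?Z i j - (\<Sum>k<n. adj (X (k, i)) * X (k, j))))"
    by (rule ucp_pos_matrix [OF \<phi> _ pos_matrix_mat_norm]) auto
  then have "pos_matrix {..<n} (\<lambda>i j. ?Z i j - \<phi> (\<Sum>k<n. adj (X (k, i)) * X (k, j)))"
    by (simp add: ucp_diff [OF \<phi>] \<phi>_Z)
  from pos_matrixD [OF this, of \<xi>]
  have "0 \<le> Re (qform {..<n} (\<lambda>i j. ?Z i j - \<phi> (\<Sum>k<n. adj (X (k, i)) * X (k, j))) \<xi>)"
    by (simp only: complex_nonneg_Reals_iff)
  also have "qform {..<n} (\<lambda>i j. ?Z i j - \<phi> (\<Sum>k<n. adj (X (k, i)) * X (k, j))) \<xi> =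
      qform {..<n} ?Z \<xi> -
      (\<Sum>i<n. cinner (\<xi> i) (mat_apply n (mat_map n \<phi> (mprod n (mstar n X) X)) \<xi> i))"
    by (simp add: mat_apply_def cinner_sum_right cinner_simps sum_subtractf)
  also have "qform {..<n} ?Z \<xi> = of_real (?M\<^sup>2 * (vnorm n \<xi>)\<^sup>2)"
    by (rule qform_diagonal)
  finally have "(vnorm n (mat_apply n (mat_map n \<phi> X) \<xi>))\<^sup>2 \<le> ?M\<^sup>2 * (vnorm n \<xi>)\<^sup>2"
    using ucp_mat_schwarz [OF \<phi>, of n X \<xi>] by (simp del: Re_sum of_real_mult of_real_power)
  then have "(vnorm n (mat_apply n (mat_map n \<phi> X) \<xi>))\<^sup>2 \<le> (?M * vnorm n \<xi>)\<^sup>2"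
    by (simp add: power_mult_distrib)
  then show "vnorm n (mat_apply n (mat_map n \<phi> X) \<xi>) \<le> ?M * vnorm n \<xi>"
    by (rule power2_le_imp_le) (simp add: mat_norm_nonneg)
qed

section \<open>The Choi-Effros product\<close>

text \<open>On the range of a unital completely positive projection \<open>\<theta>\<close> of $B(H)$ the product
  \<open>(a, b) \<mapsto> \<theta> (a b)\<close> is associative, because \<open>\<theta> (b \<theta>(x)) = \<theta> (b x)\<close> and \<open>\<theta> (\<theta>(x) b) = \<theta> (x b)\<close> for \<open>b\<close> in the
  range.\<close>

locale ucp_projection =
  fixes \<theta> :: "'a :: complex_hilbert bop \<Rightarrow> 'a bop"
  assumes ucp: "ucp UNIV \<theta>" and idem: "\<theta> (\<theta> x) = \<theta> x"
begin

lemma theta_add: "\<theta> (x + y) = \<theta> x + \<theta> y"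
  using ucp_add [OF ucp] by simp

lemma theta_diff: "\<theta> (x - y) = \<theta> x - \<theta> y"
  using ucp_diff [OF ucp] by simp

lemma theta_scaleC: "\<theta> (c *\<^sub>C x) = c *\<^sub>C \<theta> x"
  using ucp_scaleC [OF ucp] by simp

lemma theta_one: "\<theta> 1 = 1"
  using ucp_one [OF ucp] .

lemma theta_zero: "\<theta> 0 = 0"
  using ucp_zero [OF ucp] by simp

lemma theta_sum: "\<theta> (\<Sum>i\<in>I. f i) = (\<Sum>i\<in>I. \<theta> (f i))"
  using ucp_sum [OF ucp] by simp

lemma theta_adj: "\<theta> (adj x) = adj (\<theta> x)"
  using ucp_adj [OF ucp operator_system_UNIV] by simp

lemma theta_norm_le: "norm (\<theta> x) \<le> norm x"
  using ucp_norm_le [OF ucp operator_system_UNIV] by simp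

text \<open>For fixed \<open>b\<close>, the Schwarz inequality for the pair \<open>b\<^sup>*, x\<close> becomes, after another application
  of \<open>\<theta>\<close>, the positivity of a \<open>2 \<times> 2\<close> matrix whose first diagonal entry vanishes.\<close>

lemma fixed_left:
  assumes "\<theta> b = b"
  shows "\<theta> (b * \<theta> x) = \<theta> (b * x)"
proof -
  define T where "T i = (if i then x else adj b)" for i
  have T: "\<theta> (T False) = adj b" "\<theta> (T True) = \<theta> x"
    by (simp_all add: T_def theta_adj assms)
  have "pos_matrix UNIV (\<lambda>i j. \<Sum>k\<in>{()}. \<theta> (adj (T i) * T j) - adj (\<theta> (T i)) * \<theta> (T j))"
    by (rule ucp_schwarz [OF ucp]) auto
  then have "pos_matrix UNIV (\<lambda>i j. \<theta> (\<theta> (adj (T i) * T j) - adj (\<theta> (T i)) * \<theta> (T j)))"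
    by (intro ucp_pos_matrix [OF ucp]) auto
  then have "pos_matrix UNIV (\<lambda>i j. \<theta> (adj (T i) * T j) - \<theta> (adj (\<theta> (T i)) * \<theta> (T j)))"
    by (simp add: theta_diff idem)
  then have "\<theta> (adj (T False) * T True) - \<theta> (adj (\<theta> (T False)) * \<theta> (T True)) = 0"
    by (rule pos_matrix_zero_corner) (simp add: T, simp add: T_def)
  then show ?thesis by (simp add: T) (simp add: T_def)
qed

lemma fixed_right:
  assumes "\<theta> b = b"
  shows "\<theta> (\<theta> x * b) = \<theta> (x * b)"
  using fixed_left [of "adj b" "adj x"] assms
  by (metis theta_adj adj_adj adj_mult)

end

definition choi_effros_cstar ::
    "('a :: complex_hilbert bop \<Rightarrow> 'a bop) \<Rightarrow> 'a bop set \<Rightarrow> 'a bop cstar"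
  where "choi_effros_cstar \<theta> D =
    \<lparr>carrier = D, mult = (\<lambda>x y. \<theta> (x * y)), one = 1, zero = 0, add = (+), smult = (*\<^sub>C),
     star = adj, cnorm = norm\<rparr>"

text \<open>For \<open>\<theta> = id\<close> these are the norm-closed *-subalgebras of $B(H)$, so that results about the
  Choi-Effros product apply in particular to $B(H)$ itself.\<close>

definition closed_star_algebra ::
    "('a :: complex_hilbert bop \<Rightarrow> 'a bop) \<Rightarrow> 'a bop set \<Rightarrow> bool"
  where "closed_star_algebra \<theta> D \<longleftrightarrow> csubspace D \<and> (\<forall>x\<in>D. \<forall>y\<in>D. \<theta> (x * y) \<in> D) \<and>
    (\<forall>x\<in>D. adj x \<in> D) \<and> closed D"

locale choi_effros_algebra = ucp_projection +
  fixes D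
  assumes closed_star_algebra: "closed_star_algebra \<theta> D" and one_D: "1 \<in> D"
    and fixed: "x \<in> D \<Longrightarrow> \<theta> x = x"
begin

abbreviation "B \<equiv> choi_effros_cstar \<theta> D"

lemma subspace_D: "csubspace D"
  using closed_star_algebra by (simp add: closed_star_algebra_def)

lemma D_simps [simp]:
  "x \<in> D \<Longrightarrow> y \<in> D \<Longrightarrow> x + y \<in> D" "x \<in> D \<Longrightarrow> y \<in> D \<Longrightarrow> x - y \<in> D" "x \<in> D \<Longrightarrow> - x \<in> D"
  "x \<in> D \<Longrightarrow> c *\<^sub>C x \<in> D" "0 \<in> D" "1 \<in> D"
  "x \<in> D \<Longrightarrow> y \<in> D \<Longrightarrow> \<theta> (x * y) \<in> D" "x \<in> D \<Longrightarrow> adj x \<in> D"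
  using closed_star_algebra one_D
  by (auto simp: closed_star_algebra_def complex_vector.subspace_add complex_vector.subspace_diff
      complex_vector.subspace_neg complex_vector.subspace_scale complex_vector.subspace_0)

lemma D_sum: "(\<And>i. i \<in> I \<Longrightarrow> f i \<in> D) \<Longrightarrow> (\<Sum>i\<in>I. f i) \<in> D"
  using subspace_D by (intro complex_vector.subspace_sum)

lemma operator_system_D: "operator_system D"
  using subspace_D by (auto simp: operator_system_def)

lemma B_simps [simp]:
  "carrier B = D" "mult B = (\<lambda>x y. \<theta> (x * y))" "\<one>\<^bsub>B\<^esub> = 1" "\<zero>\<^bsub>B\<^esub> = 0" "add B = (+)"
  "smult B = (*\<^sub>C)" "star B = adj" "cnorm B = norm"
  by (simp_all add: choi_effros_cstar_def)

lemma assoc: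
  assumes "x \<in> D" "y \<in> D" "z \<in> D"
  shows "\<theta> (\<theta> (x * y) * z) = \<theta> (x * y * z)" "\<theta> (x * \<theta> (y * z)) = \<theta> (x * y * z)"
  using assms by (simp_all add: fixed_right fixed_left fixed mult.assoc)

lemma ring_B: "ring B"
proof (rule ringI)
  show "abelian_group B"
    by (rule abelian_groupI)
      (auto simp: add.assoc add.commute intro: bexI [where x = "- _"])
  show "monoid B"
    by (rule monoidI) (simp_all add: assoc fixed)
qed (simp_all add: distrib_left distrib_right theta_add)

lemma minus_B [simp]: "x \<in> D \<Longrightarrow> y \<in> D \<Longrightarrow> x \<ominus>\<^bsub>B\<^esub> y = x - y"
proof -
  interpret ring B by (rule ring_B)
  assume "x \<in> D" "y \<in> D"
  then have "\<ominus>\<^bsub>B\<^esub> y = - y"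
    by (intro minus_equality) auto
  then show ?thesis by (simp add: a_minus_def)
qed

lemma finsum_B [simp]: "f ` I \<subseteq> D \<Longrightarrow> finsum B f I = sum f I"
proof (induction I rule: infinite_finite_induct)
  interpret ring B by (rule ring_B)
  case (infinite I)
  then show ?case by (simp add: finsum_infinite)
next
  interpret ring B by (rule ring_B)
  case empty
  then show ?case by simp
next
  interpret ring B by (rule ring_B)
  case (insert i I)
  then show ?case by (subst finsum_insert) auto
qed

text \<open>The C*-identity: contractivity of \<open>\<theta>\<close> gives one inequality and the Schwarz inequality the other.\<close>

lemma norm_theta_star_mult:
  assumes "x \<in> D"
  shows "norm (\<theta> (adj x * x)) = (norm x)\<^sup>2"
proof (rule antisym)
  show "norm (\<theta> (adj x * x)) \<le> (norm x)\<^sup>2"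
    using theta_norm_le [of "adj x * x"] by (simp add: norm_adj_mult_self)
  have "pos_matrix {()} (\<lambda>i j. \<Sum>k\<in>{()}. \<theta> (adj x * x) - adj (\<theta> x) * \<theta> x)"
    by (rule ucp_schwarz [OF ucp]) auto
  then have pos: "cinner \<xi> ((\<theta> (adj x * x) - adj x * x) $$ \<xi>) \<in> \<real>\<^sub>\<ge>\<^sub>0" for \<xi>
    using pos_matrixD [of "{()}" _ "\<lambda>_. \<xi>"] assms by (fastforce simp: fixed)
  have "norm x \<le> sqrt (norm (\<theta> (adj x * x)))"
  proof (rule norm_bop_le)
    fix \<xi>
    have "(norm (x $$ \<xi>))\<^sup>2 \<le> Re (cinner \<xi> (\<theta> (adj x * x) $$ \<xi>))"
      using pos [of \<xi>]
      by (simp add: complex_nonneg_Reals_iff cinner_simps cinner_adj_right cinner_self del: of_real_power)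
    also have "\<dots> \<le> norm (\<theta> (adj x * x)) * norm \<xi> * norm \<xi>"
      using complex_Re_le_cmod cmod_cinner_bop_le by (rule order_trans)
    also have "\<dots> = (sqrt (norm (\<theta> (adj x * x))) * norm \<xi>)\<^sup>2"
      by (simp add: power_mult_distrib) (simp add: power2_eq_square)
    finally show "norm (x $$ \<xi>) \<le> sqrt (norm (\<theta> (adj x * x))) * norm \<xi>"
      by (rule power2_le_imp_le) simp
  qed simp
  then have "(norm x)\<^sup>2 \<le> (sqrt (norm (\<theta> (adj x * x))))\<^sup>2"
    by (intro power_mono) auto
  then show "(norm x)\<^sup>2 \<le> norm (\<theta> (adj x * x))" by simp
qed

lemma D_limit:
  assumes "\<And>k :: nat. X k \<in> D" "X \<longlonglongrightarrow> x"
  shows "x \<in> D"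
proof -
  have "closed D" using closed_star_algebra by (simp add: closed_star_algebra_def)
  then show ?thesis using assms by (rule closed_sequentially)
qed

theorem unital_cstar_algebra_B: "unital_cstar_algebra B"
proof (intro unital_cstar_algebra.intro unital_cstar_algebra_axioms.intro ring_B)
  fix X :: "nat \<Rightarrow> 'a bop"
  assume X: "\<And>k. X k \<in> carrier B"
    and cauchy: "\<And>e. e > 0 \<Longrightarrow> \<exists>N. \<forall>k\<ge>N. \<forall>l\<ge>N. cnorm B (X k \<ominus>\<^bsub>B\<^esub> X l) < e"
  have "Cauchy X"
    using cauchy X unfolding Cauchy_def dist_norm by simp
  then obtain x where x: "X \<longlonglongrightarrow> x"
    using convergent_eq_Cauchy by blast
  then have "x \<in> D" by (rule D_limit [rotated]) (use X in simp)
  then show "\<exists>x\<in>carrier B. (\<lambda>k. cnorm B (X k \<ominus>\<^bsub>B\<^esub> x)) \<longlonglongrightarrow> 0"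
    using x X by (auto intro!: bexI [of _ x] simp: tendsto_norm_zero_iff LIM_zero_iff)
next
  show "cnorm B (x \<otimes>\<^bsub>B\<^esub> y) \<le> cnorm B x * cnorm B y" for x y
    using order_trans [OF theta_norm_le norm_mult_ineq] by simp
qed (simp_all add: scaleC_add_right scaleC_add_left scaleC_scaleC scaleC_one bop_scaleC_mult theta_scaleC
    adj_add adj_scaleC theta_adj [symmetric] adj_mult norm_triangle_ineq norm_bop_scaleC
    norm_theta_star_mult)

end

section \<open>Matrices over the Choi-Effros algebra\<close>

context choi_effros_algebra
begin

abbreviation "M n \<equiv> mat_cstar n B (mat_norm n)"

lemma M_carrier [simp]: "carrier (M n) = idx n \<rightarrow>\<^sub>E D"
  by (simp add: mat_cstar_def)

lemma M_entry: "X \<in> idx n \<rightarrow>\<^sub>E D \<Longrightarrow> i < n \<Longrightarrow> j < n \<Longrightarrow> X (i, j) \<in> D"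
  by auto

lemma restrict_idxI:
  assumes "\<And>i j. i < n \<Longrightarrow> j < n \<Longrightarrow> f (i, j) \<in> D"
  shows "restrict f (idx n) \<in> idx n \<rightarrow>\<^sub>E D"
proof (rule PiE_I)
  show "restrict f (idx n) ij \<in> D" if "ij \<in> idx n" for ij
    using that assms [of "fst ij" "snd ij"] by (cases ij) simp
  show "restrict f (idx n) ij = undefined" if "ij \<notin> idx n" for ij
    using that by (simp only: restrict_def if_False)
qed

lemma M_eqI:
  assumes "X \<in> idx n \<rightarrow>\<^sub>E D" "Y \<in> idx n \<rightarrow>\<^sub>E D"
    "\<And>i j. i < n \<Longrightarrow> j < n \<Longrightarrow> X (i, j) = Y (i, j)"
  shows "X = Y"
  by (rule PiE_ext [OF assms(1,2)]) (use assms(3) in \<open>simp only: split_paired_all mem_Sigma_iff lessThan_iff\<close>)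

lemma M_mult:
  assumes "X \<in> idx n \<rightarrow>\<^sub>E D" "Y \<in> idx n \<rightarrow>\<^sub>E D"
  shows "X \<otimes>\<^bsub>M n\<^esub> Y = mat_map n \<theta> (mprod n X Y)"
proof -
  have "finsum B (\<lambda>j. \<theta> (X (i, j) * Y (j, k))) {..<n} = \<theta> (\<Sum>j<n. X (i, j) * Y (j, k))"
    if "i < n" "k < n" for i k
  proof -
    have "\<theta> (X (i, j) * Y (j, k)) \<in> D" if "j < n" for j
      by (rule D_simps) (use assms \<open>i < n\<close> \<open>k < n\<close> that in \<open>simp_all only: M_entry\<close>)
    then show ?thesis
      by (subst finsum_B) (auto simp only: theta_sum lessThan_iff)
  qed
  then have "(\<lambda>(i, k)\<in>idx n. finsum B (\<lambda>j. \<theta> (X (i, j) * Y (j, k))) {..<n}) =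
      (\<lambda>(i, k)\<in>idx n. \<theta> (\<Sum>j<n. X (i, j) * Y (j, k)))"
    by (intro restrict_ext) (simp only: mem_Sigma_iff lessThan_iff split_paired_all prod.case)
  also have "\<dots> = mat_map n \<theta> (mprod n X Y)"
    by (intro ext) (simp add: compose_def mprod_def restrict_def split: prod.split)
  finally show ?thesis
    by (simp add: mat_cstar_def del: finsum_B)
qed

lemma M_mult_apply:
  "X \<in> idx n \<rightarrow>\<^sub>E D \<Longrightarrow> Y \<in> idx n \<rightarrow>\<^sub>E D \<Longrightarrow> i < n \<Longrightarrow> k < n \<Longrightarrow>
    (X \<otimes>\<^bsub>M n\<^esub> Y) (i, k) = (\<Sum>j<n. \<theta> (X (i, j) * Y (j, k)))"
  by (simp add: M_mult theta_sum)

lemma M_mult_closed: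
  assumes "X \<in> idx n \<rightarrow>\<^sub>E D" "Y \<in> idx n \<rightarrow>\<^sub>E D"
  shows "X \<otimes>\<^bsub>M n\<^esub> Y \<in> idx n \<rightarrow>\<^sub>E D"
proof (rule PiE_I)
  fix ij
  assume "ij \<in> idx n"
  then show "(X \<otimes>\<^bsub>M n\<^esub> Y) ij \<in> D"
  proof (cases ij)
    case (Pair i k)
    have "\<theta> (X (i, j) * Y (j, k)) \<in> D" if "j < n" for j
      by (rule D_simps) (use assms that \<open>ij \<in> idx n\<close> Pair in \<open>simp_all add: M_entry\<close>)
    then show ?thesis
      using assms \<open>ij \<in> idx n\<close> Pair by (simp add: M_mult_apply) (rule D_sum, simp)
  qed
next
  fix ij
  assume "ij \<notin> idx n"
  then show "(X \<otimes>\<^bsub>M n\<^esub> Y) ij = undefined"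
    by (auto simp: mat_cstar_def)
qed

lemma M_apply:
  "i < n \<Longrightarrow> j < n \<Longrightarrow> (X \<oplus>\<^bsub>M n\<^esub> Y) (i, j) = X (i, j) + Y (i, j)"
  "i < n \<Longrightarrow> j < n \<Longrightarrow> (c \<odot>\<^bsub>M n\<^esub> X) (i, j) = c *\<^sub>C X (i, j)"
  "i < n \<Longrightarrow> j < n \<Longrightarrow> star (M n) X (i, j) = adj (X (j, i))"
  "i < n \<Longrightarrow> j < n \<Longrightarrow> \<one>\<^bsub>M n\<^esub> (i, j) = (if i = j then 1 else 0)"
  "i < n \<Longrightarrow> j < n \<Longrightarrow> \<zero>\<^bsub>M n\<^esub> (i, j) = 0"
  by (simp_all add: mat_cstar_def)

lemma M_closed:
  "X \<in> idx n \<rightarrow>\<^sub>E D \<Longrightarrow> Y \<in> idx n \<rightarrow>\<^sub>E D \<Longrightarrow> X \<oplus>\<^bsub>M n\<^esub> Y \<in> idx n \<rightarrow>\<^sub>E D"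
  "X \<in> idx n \<rightarrow>\<^sub>E D \<Longrightarrow> c \<odot>\<^bsub>M n\<^esub> X \<in> idx n \<rightarrow>\<^sub>E D"
  "X \<in> idx n \<rightarrow>\<^sub>E D \<Longrightarrow> star (M n) X \<in> idx n \<rightarrow>\<^sub>E D"
  "\<one>\<^bsub>M n\<^esub> \<in> idx n \<rightarrow>\<^sub>E D" "\<zero>\<^bsub>M n\<^esub> \<in> idx n \<rightarrow>\<^sub>E D"
  by (simp_all only: mat_cstar_def cstar.simps module.simps ring.simps monoid.simps partial_object.simps B_simps)
    (rule restrict_idxI; simp add: M_entry [where n = n])+

text \<open>Associativity passes to matrices because \<open>\<theta>\<close> may be applied to, or dropped from, any partial product
  of elements of \<open>D\<close> without changing the outer \<open>\<theta>\<close>.\<close>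

lemma M_assoc:
  assumes X: "X \<in> idx n \<rightarrow>\<^sub>E D" and Y: "Y \<in> idx n \<rightarrow>\<^sub>E D" and Z: "Z \<in> idx n \<rightarrow>\<^sub>E D"
  shows "X \<otimes>\<^bsub>M n\<^esub> Y \<otimes>\<^bsub>M n\<^esub> Z = X \<otimes>\<^bsub>M n\<^esub> (Y \<otimes>\<^bsub>M n\<^esub> Z)"
proof (rule M_eqI)
  fix i l
  assume il: "i < n" "l < n"
  have "(X \<otimes>\<^bsub>M n\<^esub> Y \<otimes>\<^bsub>M n\<^esub> Z) (i, l) =
      (\<Sum>k<n. \<theta> ((\<Sum>j<n. \<theta> (X (i, j) * Y (j, k))) * Z (k, l)))"
    using il by (simp add: M_mult_apply M_mult_closed X Y Z)
  also have "\<dots> = (\<Sum>k<n. \<Sum>j<n. \<theta> (X (i, j) * Y (j, k) * Z (k, l)))"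
    using il by (simp add: sum_distrib_right theta_sum assoc(1) M_entry [OF X] M_entry [OF Y] M_entry [OF Z])
  also have "\<dots> = (\<Sum>j<n. \<Sum>k<n. \<theta> (X (i, j) * Y (j, k) * Z (k, l)))"
    by (rule sum.swap)
  also have "\<dots> = (\<Sum>j<n. \<theta> (X (i, j) * (\<Sum>k<n. \<theta> (Y (j, k) * Z (k, l)))))"
    using il by (simp add: sum_distrib_left theta_sum assoc(2) M_entry [OF X] M_entry [OF Y] M_entry [OF Z])
  also have "\<dots> = (X \<otimes>\<^bsub>M n\<^esub> (Y \<otimes>\<^bsub>M n\<^esub> Z)) (i, l)"
    using il by (simp add: M_mult_apply M_mult_closed X Y Z)
  finally show "(X \<otimes>\<^bsub>M n\<^esub> Y \<otimes>\<^bsub>M n\<^esub> Z) (i, l) = (X \<otimes>\<^bsub>M n\<^esub> (Y \<otimes>\<^bsub>M n\<^esub> Z)) (i, l)" .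
qed (simp_all add: M_mult_closed X Y Z)

lemma ring_M: "ring (M n)"
proof (rule ringI)
  show "abelian_group (M n)"
  proof (rule abelian_groupI, unfold M_carrier)
    fix X
    assume X: "X \<in> idx n \<rightarrow>\<^sub>E D"
    define Y where "Y = (\<lambda>ij\<in>idx n. - X ij)"
    have "Y \<in> idx n \<rightarrow>\<^sub>E D" 
      unfolding Y_def by (rule restrict_idxI) (simp add: M_entry [OF X])
    moreover have "Y (i, j) = - X (i, j)" if "i < n" "j < n" for i j
      using that by (simp add: Y_def)
    ultimately have "Y \<oplus>\<^bsub>M n\<^esub> X = \<zero>\<^bsub>M n\<^esub>"
      by (intro M_eqI [where n = n]) (simp_all add: M_apply M_closed X)
    with \<open>Y \<in> idx n \<rightarrow>\<^sub>E D\<close>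
    show "\<exists>Y\<in>idx n \<rightarrow>\<^sub>E D. Y \<oplus>\<^bsub>M n\<^esub> X = \<zero>\<^bsub>M n\<^esub>" by blast
  next
    fix X Y Z
    assume "X \<in> idx n \<rightarrow>\<^sub>E D" "Y \<in> idx n \<rightarrow>\<^sub>E D" "Z \<in> idx n \<rightarrow>\<^sub>E D"
    then show "X \<oplus>\<^bsub>M n\<^esub> Y \<oplus>\<^bsub>M n\<^esub> Z = X \<oplus>\<^bsub>M n\<^esub> (Y \<oplus>\<^bsub>M n\<^esub> Z)"
      "X \<oplus>\<^bsub>M n\<^esub> Y = Y \<oplus>\<^bsub>M n\<^esub> X" "\<zero>\<^bsub>M n\<^esub> \<oplus>\<^bsub>M n\<^esub> X = X"
      by - (rule M_eqI [where n = n], simp_all add: M_closed M_apply add_ac)+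
  qed (simp_all add: M_closed)
  show "monoid (M n)"
  proof (rule monoidI, unfold M_carrier)
    fix X
    assume X: "X \<in> idx n \<rightarrow>\<^sub>E D"
    have "(\<Sum>j<n. \<theta> ((if i = j then 1 else 0) * X (j, k))) = X (i, k)"
      "(\<Sum>j<n. \<theta> (X (i, j) * (if j = k then 1 else 0))) = X (i, k)" if "i < n" "k < n" for i k
    proof -
      have "(\<Sum>j<n. \<theta> ((if i = j then 1 else 0) * X (j, k))) = (\<Sum>j<n. if i = j then X (i, k) else 0)"
        using that by (intro sum.cong) (auto simp: fixed M_entry [OF X] theta_zero)
      then show "(\<Sum>j<n. \<theta> ((if i = j then 1 else 0) * X (j, k))) = X (i, k)"
        using that by simp
      have "(\<Sum>j<n. \<theta> (X (i, j) * (if j = k then 1 else 0))) = (\<Sum>j<n. if j = k then X (i, k) else 0)"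
        using that by (intro sum.cong) (auto simp: fixed M_entry [OF X] theta_zero)
      then show "(\<Sum>j<n. \<theta> (X (i, j) * (if j = k then 1 else 0))) = X (i, k)"
        using that by simp
    qed
    note unit = this
    show "\<one>\<^bsub>M n\<^esub> \<otimes>\<^bsub>M n\<^esub> X = X" "X \<otimes>\<^bsub>M n\<^esub> \<one>\<^bsub>M n\<^esub> = X"
      by - (rule M_eqI [where n = n], simp_all add: M_mult_closed M_closed M_mult_apply M_apply X unit)+
  qed (simp_all add: M_mult_closed M_closed M_assoc)
  fix X Y Z
  assume "X \<in> carrier (M n)" "Y \<in> carrier (M n)" "Z \<in> carrier (M n)"
  then show "(X \<oplus>\<^bsub>M n\<^esub> Y) \<otimes>\<^bsub>M n\<^esub> Z = X \<otimes>\<^bsub>M n\<^esub> Z \<oplus>\<^bsub>M n\<^esub> Y \<otimes>\<^bsub>M n\<^esub> Z"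
    "Z \<otimes>\<^bsub>M n\<^esub> (X \<oplus>\<^bsub>M n\<^esub> Y) = Z \<otimes>\<^bsub>M n\<^esub> X \<oplus>\<^bsub>M n\<^esub> Z \<otimes>\<^bsub>M n\<^esub> Y"
    by - (rule M_eqI [where n = n], simp_all add: M_mult_closed M_closed M_mult_apply M_apply distrib_left
        distrib_right theta_add sum.distrib)+
qed

lemma minus_M_apply:
  assumes "X \<in> idx n \<rightarrow>\<^sub>E D" "Y \<in> idx n \<rightarrow>\<^sub>E D" "i < n" "j < n"
  shows "(X \<ominus>\<^bsub>M n\<^esub> Y) (i, j) = X (i, j) - Y (i, j)"
proof -
  interpret ring "M n" by (rule ring_M)
  define Z where "Z = (\<lambda>ij\<in>idx n. - Y ij)"
  have "Z \<in> idx n \<rightarrow>\<^sub>E D" 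
    unfolding Z_def by (rule restrict_idxI) (simp add: M_entry [OF assms(2)])
  moreover have Z_apply: "Z (i, j) = - Y (i, j)" if "i < n" "j < n" for i j
    using that by (simp add: Z_def)
  ultimately have "Z \<oplus>\<^bsub>M n\<^esub> Y = \<zero>\<^bsub>M n\<^esub>"
    by (intro M_eqI [where n = n]) (simp_all add: M_apply M_closed assms)
  with \<open>Z \<in> idx n \<rightarrow>\<^sub>E D\<close> have "\<ominus>\<^bsub>M n\<^esub> Y = Z"
    using assms by (intro minus_equality) auto
  then show ?thesis using assms by (simp add: a_minus_def M_apply Z_apply)
qed

lemma cnorm_M [simp]: "cnorm (M n) = mat_norm n"
  by (simp add: mat_cstar_def)

lemma star_M: "star (M n) X = mstar n X"
  by (auto simp: mat_cstar_def mstar_def fun_eq_iff)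

lemma M_fixed: "X \<in> idx n \<rightarrow>\<^sub>E D \<Longrightarrow> mat_norm n (mat_map n \<theta> X) = mat_norm n X"
  by (rule mat_norm_cong) (simp add: fixed M_entry)

text \<open>The norm that $B(H^n)$ induces on matrices over \<open>D\<close> is the C*-norm for the Choi-Effros product,
  because the amplification of \<open>\<theta>\<close> is contractive and satisfies the Schwarz inequality.\<close>

theorem unital_cstar_algebra_M: "unital_cstar_algebra (M n)"
proof (intro unital_cstar_algebra.intro unital_cstar_algebra_axioms.intro ring_M;
    unfold M_carrier cnorm_M)
  fix X :: "nat \<Rightarrow> nat \<times> nat \<Rightarrow> 'a bop"
  assume X: "\<And>k. X k \<in> idx n \<rightarrow>\<^sub>E D"
    and cauchy: "\<And>e. e > 0 \<Longrightarrow> \<exists>N. \<forall>k\<ge>N. \<forall>l\<ge>N. mat_norm n (X k \<ominus>\<^bsub>M n\<^esub> X l) < e"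
  have "\<exists>x\<in>D. (\<lambda>k. X k (i, j)) \<longlonglongrightarrow> x" if ij: "i < n" "j < n" for i j
  proof -
    have "Cauchy (\<lambda>k. X k (i, j))"
    proof (rule metric_CauchyI)
      fix e :: real
      assume "e > 0"
      then obtain N where N: "\<And>k l. k \<ge> N \<Longrightarrow> l \<ge> N \<Longrightarrow> mat_norm n (X k \<ominus>\<^bsub>M n\<^esub> X l) < e"
        using cauchy by blast
      have "dist (X k (i, j)) (X l (i, j)) < e" if "k \<ge> N" "l \<ge> N" for k l
        using N [OF that] norm_entry_le_mat_norm [OF ij, of "X k \<ominus>\<^bsub>M n\<^esub> X l"]
        by (simp add: dist_norm minus_M_apply X ij)
      then show "\<exists>N. \<forall>k\<ge>N. \<forall>l\<ge>N. dist (X k (i, j)) (X l (i, j)) < e" by blast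
    qed
    then obtain x where x: "(\<lambda>k. X k (i, j)) \<longlonglongrightarrow> x"
      using convergent_eq_Cauchy by blast
    then have "x \<in> D"
      by (rule D_limit [rotated]) (rule M_entry [OF X ij])
    then show ?thesis using x by blast
  qed
  then obtain L where L: "\<And>i j. i < n \<Longrightarrow> j < n \<Longrightarrow> L i j \<in> D"
    "\<And>i j. i < n \<Longrightarrow> j < n \<Longrightarrow> (\<lambda>k. X k (i, j)) \<longlonglongrightarrow> L i j"
    by metis
  define x where "x = (\<lambda>(i, j)\<in>idx n. L i j)"
  have x: "x \<in> idx n \<rightarrow>\<^sub>E D" unfolding x_def by (rule restrict_idxI) (simp add: L)
  have "(\<lambda>k. mat_norm n (X k \<ominus>\<^bsub>M n\<^esub> x)) \<longlonglongrightarrow> 0"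
  proof (rule tendsto_sandwich [OF _ _ tendsto_const])
    show "\<forall>\<^sub>F k in sequentially. 0 \<le> mat_norm n (X k \<ominus>\<^bsub>M n\<^esub> x)"
      by (simp add: mat_norm_nonneg)
    show "\<forall>\<^sub>F k in sequentially. mat_norm n (X k \<ominus>\<^bsub>M n\<^esub> x) \<le>
        (\<Sum>i<n. \<Sum>j<n. norm (X k (i, j) - L i j))"
    proof (rule always_eventually, rule allI)
      show "mat_norm n (X k \<ominus>\<^bsub>M n\<^esub> x) \<le> (\<Sum>i<n. \<Sum>j<n. norm (X k (i, j) - L i j))" for k
        using mat_norm_le_sum [of n "X k \<ominus>\<^bsub>M n\<^esub> x"]
        by (simp add: minus_M_apply X x) (simp add: x_def)
    qed
    have "(\<lambda>k. \<Sum>i<n. \<Sum>j<n. norm (X k (i, j) - L i j)) \<longlonglongrightarrow> (\<Sum>i<n. \<Sum>j<n. 0)"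
      using L(2) by (intro tendsto_sum tendsto_norm_zero LIM_zero) auto
    then show "(\<lambda>k. \<Sum>i<n. \<Sum>j<n. norm (X k (i, j) - L i j)) \<longlonglongrightarrow> 0" by simp
  qed
  then show "\<exists>x\<in>idx n \<rightarrow>\<^sub>E D. (\<lambda>k. mat_norm n (X k \<ominus>\<^bsub>M n\<^esub> x)) \<longlonglongrightarrow> 0"
    using x by blast
next
  fix X
  assume X: "X \<in> idx n \<rightarrow>\<^sub>E D"
  show "mat_norm n X = 0 \<longleftrightarrow> X = \<zero>\<^bsub>M n\<^esub>"
  proof
    assume "mat_norm n X = 0"
    then have "X (i, j) = 0" if "i < n" "j < n" for i j
      using norm_entry_le_mat_norm [OF that, of X] by simp
    then show "X = \<zero>\<^bsub>M n\<^esub>"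
      using X by - (rule M_eqI [where n = n], simp_all add: M_closed M_apply)
  next
    assume "X = \<zero>\<^bsub>M n\<^esub>"
    then show "mat_norm n X = 0"
      using mat_norm_le_sum [of n X] mat_norm_nonneg [of n X] by (simp add: M_apply)
  qed
  show "mat_norm n (star (M n) X \<otimes>\<^bsub>M n\<^esub> X) = (mat_norm n X)\<^sup>2"
  proof (rule antisym)
    have eq: "star (M n) X \<otimes>\<^bsub>M n\<^esub> X = mat_map n \<theta> (mprod n (mstar n X) X)"
      using M_mult [OF M_closed(3) [OF X] X] by (simp add: star_M)
    show "(mat_norm n X)\<^sup>2 \<le> mat_norm n (star (M n) X \<otimes>\<^bsub>M n\<^esub> X)"
      using mat_norm_sq_le_ucp [OF ucp, of n X] by (simp only: eq M_fixed [OF X])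
    have "mat_norm n (mprod n (mstar n X) X) \<le> mat_norm n (mstar n X) * mat_norm n X"
      by (rule mat_norm_mprod)
    also have "\<dots> \<le> mat_norm n X * mat_norm n X"
      by (intro mult_right_mono mat_norm_mstar_le mat_norm_nonneg)
    finally show "mat_norm n (star (M n) X \<otimes>\<^bsub>M n\<^esub> X) \<le> (mat_norm n X)\<^sup>2"
      unfolding eq power2_eq_square using mat_norm_ucp_le [OF ucp] by (rule order_trans [rotated])
  qed
  show "mat_norm n (a \<odot>\<^bsub>M n\<^esub> X) = cmod a * mat_norm n X" for a
    by (rule mat_norm_scaleC) (simp add: M_apply)
  show "star (M n) (star (M n) X) = X" "(a + b) \<odot>\<^bsub>M n\<^esub> X = a \<odot>\<^bsub>M n\<^esub> X \<oplus>\<^bsub>M n\<^esub> b \<odot>\<^bsub>M n\<^esub> X"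
    "a \<odot>\<^bsub>M n\<^esub> (b \<odot>\<^bsub>M n\<^esub> X) = (a * b) \<odot>\<^bsub>M n\<^esub> X" "1 \<odot>\<^bsub>M n\<^esub> X = X"
    "star (M n) (a \<odot>\<^bsub>M n\<^esub> X) = cnj a \<odot>\<^bsub>M n\<^esub> star (M n) X" for a b
    using X by - (rule M_eqI [where n = n], simp_all add: M_closed M_apply scaleC_add_left scaleC_scaleC scaleC_one
        adj_scaleC)+
next
  fix X Y
  assume XY: "X \<in> idx n \<rightarrow>\<^sub>E D" "Y \<in> idx n \<rightarrow>\<^sub>E D"
  show "mat_norm n (X \<otimes>\<^bsub>M n\<^esub> Y) \<le> mat_norm n X * mat_norm n Y"
    unfolding M_mult [OF XY] using mat_norm_ucp_le [OF ucp] mat_norm_mprod by (rule order_trans)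
  show "mat_norm n (X \<oplus>\<^bsub>M n\<^esub> Y) \<le> mat_norm n X + mat_norm n Y"
    by (rule mat_norm_triangle) (simp add: M_apply)
  show "star (M n) (X \<oplus>\<^bsub>M n\<^esub> Y) = star (M n) X \<oplus>\<^bsub>M n\<^esub> star (M n) Y"
    "a \<odot>\<^bsub>M n\<^esub> (X \<oplus>\<^bsub>M n\<^esub> Y) = a \<odot>\<^bsub>M n\<^esub> X \<oplus>\<^bsub>M n\<^esub> a \<odot>\<^bsub>M n\<^esub> Y" for a
    using XY by - (rule M_eqI [where n = n], simp_all add: M_closed M_apply scaleC_add_right adj_add)+
  show "a \<odot>\<^bsub>M n\<^esub> X \<otimes>\<^bsub>M n\<^esub> Y = a \<odot>\<^bsub>M n\<^esub> (X \<otimes>\<^bsub>M n\<^esub> Y)"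
    "X \<otimes>\<^bsub>M n\<^esub> (a \<odot>\<^bsub>M n\<^esub> Y) = a \<odot>\<^bsub>M n\<^esub> (X \<otimes>\<^bsub>M n\<^esub> Y)" for a
    using XY by - (rule M_eqI [where n = n], simp_all add: M_closed M_mult_closed M_mult_apply M_apply bop_scaleC_mult
        theta_scaleC complex_vector.scale_sum_right)+
  show "star (M n) (X \<otimes>\<^bsub>M n\<^esub> Y) = star (M n) Y \<otimes>\<^bsub>M n\<^esub> star (M n) X"
    using XY by - (rule M_eqI [where n = n], simp_all add: M_closed M_mult_closed M_mult_apply M_apply adj_sum
        adj_mult theta_adj [symmetric])+
qed (simp_all add: M_closed)

end

section \<open>Square roots and positivity of *-homomorphisms\<close>

text \<open>The coefficients of the binomial series of \<open>\<surd>(1 - t)\<close>.\<close>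

definition sqrt_coeff :: "nat \<Rightarrow> real"
  where "sqrt_coeff k = ((1 / 2) gchoose k) * (- 1) ^ k"

lemma gbinomial_alternating_Suc:
  "real (Suc k) * ((a gchoose Suc k) * (- 1) ^ Suc k) = (real k - a) * ((a gchoose k) * (- 1) ^ k)"
proof -
  have "real (Suc k) * (a gchoose Suc k) = (a - real k) * (a gchoose k)"
    using gbinomial_mult_1 [of a k] by (simp add: algebra_simps)
  then have "- ((- 1) ^ k) * (real (Suc k) * (a gchoose Suc k)) =
      - ((- 1) ^ k) * ((a - real k) * (a gchoose k))"
    by (rule arg_cong)
  then show ?thesis by (simp add: algebra_simps)
qed

lemma sqrt_coeff_nonpos: "sqrt_coeff (Suc k) \<le> 0"
proof (induction k)
  case 0
  then show ?case by (simp add: sqrt_coeff_def)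
next
  case (Suc k)
  have "real (Suc (Suc k)) * sqrt_coeff (Suc (Suc k)) = (real (Suc k) - 1 / 2) * sqrt_coeff (Suc k)"
    unfolding sqrt_coeff_def by (rule gbinomial_alternating_Suc)
  also have "\<dots> \<le> 0"
    using Suc by (intro mult_nonneg_nonpos) auto
  finally show ?case by (simp add: mult_le_0_iff)
qed

text \<open>All coefficients but the first are nonpositive and the partial sums are nonnegative, so the partial
  sums of the absolute values are at most 2.\<close>

lemma summable_sqrt_coeff: "summable (\<lambda>k. \<bar>sqrt_coeff k\<bar>)"
proof (rule bounded_imp_summable)
  fix m
  have "0 \<le> (- 1) ^ m * ((1 / 2 :: real) - 1 gchoose m)" (is "0 \<le> ?d m")
  proof (induction m)
    case (Suc m)
    have "real (Suc m) * ?d (Suc m) = (real m + 1 / 2) * ?d m"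
      using gbinomial_alternating_Suc [of m "(1 / 2 :: real) - 1"] by (simp add: mult_ac)
    also have "\<dots> \<ge> 0"
      by (rule mult_nonneg_nonneg) (simp, rule Suc)
    finally have "0 \<le> real (Suc m) * ?d (Suc m)" .
    moreover have "0 \<le> x" if "0 \<le> real (Suc m) * x" for x
      using that by (simp add: zero_le_mult_iff)
    ultimately show ?case by blast
  qed simp
  then have "0 \<le> (\<Sum>k\<le>m. sqrt_coeff k)"
    unfolding sqrt_coeff_def gbinomial_sum_lower_neg .
  moreover have "\<bar>sqrt_coeff k\<bar> = (if k = 0 then 2 else 0) - sqrt_coeff k" for k
    using sqrt_coeff_nonpos [of "k - 1"] by (cases k) (simp_all add: sqrt_coeff_def [of 0])
  then have "(\<Sum>k\<le>m. \<bar>sqrt_coeff k\<bar>) = 2 - (\<Sum>k\<le>m. sqrt_coeff k)"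
    by (simp add: sum_subtractf)
  ultimately show "(\<Sum>k\<le>m. \<bar>sqrt_coeff k\<bar>) \<le> 2" by simp
qed simp

lemma sqrt_coeff_convolution:
  "(\<Sum>i\<le>m. sqrt_coeff i * sqrt_coeff (m - i)) = (if m = 0 then 1 else if m = 1 then - 1 else 0)"
proof -
  have "(\<Sum>i\<le>m. sqrt_coeff i * sqrt_coeff (m - i)) =
      (\<Sum>i\<le>m. (- 1) ^ m * (((1 / 2) gchoose i) * ((1 / 2) gchoose (m - i))))"
    by (intro sum.cong) (auto simp: sqrt_coeff_def mult_ac simp flip: power_add)
  also have "\<dots> = (- 1) ^ m * (((1 / 2) + (1 / 2)) gchoose m)"
    unfolding sum_distrib_left [symmetric] atMost_atLeast0 gbinomial_Vandermonde ..
  also have "((1 / 2) + (1 / 2) :: real) gchoose m = real (1 choose m)"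
    by (simp add: binomial_gbinomial)
  finally show ?thesis
    by (cases "m \<le> 1") (auto simp: le_Suc_eq binomial_eq_0)
qed

context choi_effros_algebra
begin

lemma mat_norm_one_le: "mat_norm n \<one>\<^bsub>M n\<^esub> \<le> 1"
proof (rule mat_norm_leI)
  fix \<xi>
  have "mat_apply n \<one>\<^bsub>M n\<^esub> \<xi> i = \<xi> i" if "i < n" for i
  proof -
    have "mat_apply n \<one>\<^bsub>M n\<^esub> \<xi> i = (\<Sum>j<n. if i = j then \<xi> i else 0)"
      unfolding mat_apply_def using that by (intro sum.cong) (auto simp: M_apply)
    then show ?thesis using that by simp
  qed
  then have "vnorm n (mat_apply n \<one>\<^bsub>M n\<^esub> \<xi>) = vnorm n \<xi>"
    by (rule vnorm_cong)
  then show "vnorm n (mat_apply n \<one>\<^bsub>M n\<^esub> \<xi>) \<le> 1 * vnorm n \<xi>" by simp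
qed simp

text \<open>The binomial series of \<open>\<surd>(1 - Y)\<close> converges absolutely for \<open>\<parallel>Y\<parallel> \<le> 1\<close>, and it is squared by the Cauchy
  product. Convergence is taken entry by entry, which suffices because the entries of a matrix are
  bounded by its norm.\<close>

lemma square_root_exists:
  assumes Y: "Y \<in> idx n \<rightarrow>\<^sub>E D" and herm: "star (M n) Y = Y" and norm: "mat_norm n Y \<le> 1"
  shows "\<exists>R\<in>idx n \<rightarrow>\<^sub>E D. star (M n) R = R \<and>
    (\<forall>i<n. \<forall>j<n. (\<Sum>l<n. \<theta> (R (i, l) * R (l, j))) = (if i = j then 1 else 0) - Y (i, j))"
proof -
  interpret M: unital_cstar_algebra "M n" by (rule unital_cstar_algebra_M)
  define P where "P k = Y [^]\<^bsub>M n\<^esub> k" for k :: nat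
  have P: "P k \<in> idx n \<rightarrow>\<^sub>E D" for k
    using M.nat_pow_closed Y by (simp add: P_def)
  have P_norm: "mat_norm n (P k) \<le> 1" for k
  proof (induction k)
    case 0
    then show ?case by (simp add: P_def mat_norm_one_le)
  next
    case (Suc k)
    have "mat_norm n (P (Suc k)) \<le> mat_norm n (P k) * mat_norm n Y"
      using M.cnorm_mult [of "P k" Y] P [of k] Y by (simp add: P_def)
    also have "\<dots> \<le> 1 * 1"
      using Suc norm by (intro mult_mono mat_norm_nonneg) auto
    finally show ?case by simp
  qed
  have P_star: "star (M n) (P k) = P k" for k
  proof (induction k)
    case 0
    show ?case by (rule M_eqI [where n = n]) (simp_all add: P_def M_closed M_apply)
  next
    case (Suc k)
    have "star (M n) (P (Suc k)) = star (M n) Y \<otimes>\<^bsub>M n\<^esub> star (M n) (P k)"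
      using M.star_mult [of "P k" Y] P [of k] Y by (simp add: P_def)
    also have "\<dots> = P (Suc k)"
      using Suc M.nat_pow_Suc2 [of Y k] Y by (simp add: herm P_def)
    finally show ?case .
  qed
  have P_mult: "(\<Sum>l<n. \<theta> (P a (i, l) * P b (l, j))) = P (a + b) (i, j)" if "i < n" "j < n" for a b i j
    using M.nat_pow_mult [of Y a b] M_mult_apply [OF P [of a] P [of b] that] Y
    by (simp add: P_def)
  have P_entry: "norm (P k (i, j)) \<le> 1" if "i < n" "j < n" for k i j
    using norm_entry_le_mat_norm [OF that, of "P k"] P_norm [of k] by linarith
  have summable: "summable (\<lambda>k. norm (sqrt_coeff k *\<^sub>R P k (i, j)))" if "i < n" "j < n" for i j
  proof (rule summable_comparison_test' [OF summable_sqrt_coeff])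
    show "norm (norm (sqrt_coeff k *\<^sub>R P k (i, j))) \<le> \<bar>sqrt_coeff k\<bar>" for k
      using P_entry [OF that] by (simp add: mult_left_le)
  qed
  define R where "R = (\<lambda>ij\<in>idx n. \<Sum>k. sqrt_coeff k *\<^sub>R P k ij)"
  have R_sums: "(\<lambda>k. sqrt_coeff k *\<^sub>R P k (i, j)) sums R (i, j)" if "i < n" "j < n" for i j
    using summable_sums [OF summable_norm_cancel [OF summable [OF that]]] that by (simp add: R_def)
  have "R (i, j) \<in> D" if "i < n" "j < n" for i j
  proof (rule D_limit)
    show "(\<lambda>m. \<Sum>k<m. sqrt_coeff k *\<^sub>R P k (i, j)) \<longlonglongrightarrow> R (i, j)"
      using R_sums [OF that] by (simp add: sums_def)
    show "(\<Sum>k<m. sqrt_coeff k *\<^sub>R P k (i, j)) \<in> D" for m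
      by (rule D_sum) (simp add: bop_scaleR_scaleC M_entry [OF P that])
  qed
  then have "restrict R (idx n) \<in> idx n \<rightarrow>\<^sub>E D"
    by (intro restrict_idxI)
  then have R: "R \<in> idx n \<rightarrow>\<^sub>E D"
    by (simp only: R_def restrict_restrict Int_absorb)
  have "star (M n) R = R"
  proof (rule M_eqI)
    fix i j
    assume ij: "i < n" "j < n"
    have "(\<lambda>k. adj (sqrt_coeff k *\<^sub>R P k (j, i))) sums adj (R (j, i))"
      by (rule bounded_linear.sums [OF bounded_linear_adj R_sums [OF ij(2,1)]])
    moreover have "adj (P k (j, i)) = P k (i, j)" for k
      using M_apply(3) [OF ij, of "P k"] P_star [of k] by simp
    ultimately have "(\<lambda>k. sqrt_coeff k *\<^sub>R P k (i, j)) sums adj (R (j, i))"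
      by (simp add: bop_scaleR_scaleC adj_scaleC)
    then show "star (M n) R (i, j) = R (i, j)"
      using R_sums [OF ij] ij by (simp add: M_apply sums_unique2)
  qed (simp_all add: R M_closed)
  moreover have "(\<Sum>l<n. \<theta> (R (i, l) * R (l, j))) = (if i = j then 1 else 0) - Y (i, j)"
    if ij: "i < n" "j < n" for i j
  proof -
    have "(\<lambda>m. \<theta> (\<Sum>a\<le>m. (sqrt_coeff a *\<^sub>R P a (i, l)) * (sqrt_coeff (m - a) *\<^sub>R P (m - a) (l, j))))
        sums \<theta> (R (i, l) * R (l, j))" if "l < n" for l
      using Cauchy_product_sums [OF summable [OF \<open>i < n\<close> that] summable [OF that \<open>j < n\<close>]]
        sums_unique [OF R_sums [OF \<open>i < n\<close> that]] sums_unique [OF R_sums [OF that \<open>j < n\<close>]]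
      by (intro bounded_linear.sums [OF ucp_bounded_linear [OF ucp]]) simp
    then have "(\<lambda>m. \<Sum>l<n. \<theta> (\<Sum>a\<le>m. (sqrt_coeff a *\<^sub>R P a (i, l)) *
        (sqrt_coeff (m - a) *\<^sub>R P (m - a) (l, j)))) sums (\<Sum>l<n. \<theta> (R (i, l) * R (l, j)))"
      by (intro sums_sum) auto
    also have "(\<lambda>m. \<Sum>l<n. \<theta> (\<Sum>a\<le>m. (sqrt_coeff a *\<^sub>R P a (i, l)) *
        (sqrt_coeff (m - a) *\<^sub>R P (m - a) (l, j)))) =
      (\<lambda>m. if m \<in> {0, 1} then (if m = 0 then 1 else - 1 :: real) *\<^sub>R P m (i, j) else 0)"
    proof
      fix m
      have "(\<Sum>l<n. \<theta> (\<Sum>a\<le>m. (sqrt_coeff a *\<^sub>R P a (i, l)) *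
          (sqrt_coeff (m - a) *\<^sub>R P (m - a) (l, j)))) =
        (\<Sum>l<n. \<Sum>a\<le>m. (sqrt_coeff a * sqrt_coeff (m - a)) *\<^sub>R \<theta> (P a (i, l) * P (m - a) (l, j)))"
        by (simp add: theta_sum bop_scaleR_scaleC theta_scaleC bop_scaleC_mult scaleC_scaleC mult.commute)
      also have "\<dots> = (\<Sum>a\<le>m. (sqrt_coeff a * sqrt_coeff (m - a)) *\<^sub>R
          (\<Sum>l<n. \<theta> (P a (i, l) * P (m - a) (l, j))))"
        by (subst sum.swap) (simp add: scaleR_sum_right)
      also have "\<dots> = (\<Sum>a\<le>m. (sqrt_coeff a * sqrt_coeff (m - a)) *\<^sub>R P m (i, j))"
        by (intro sum.cong) (simp_all add: P_mult ij)
      also have "\<dots> = (if m = 0 then 1 else if m = 1 then - 1 else 0) *\<^sub>R P m (i, j)"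
        by (simp only: scaleR_sum_left [symmetric] sqrt_coeff_convolution)
      finally show "(\<Sum>l<n. \<theta> (\<Sum>a\<le>m. (sqrt_coeff a *\<^sub>R P a (i, l)) *
          (sqrt_coeff (m - a) *\<^sub>R P (m - a) (l, j)))) =
        (if m \<in> {0, 1} then (if m = 0 then 1 else - 1 :: real) *\<^sub>R P m (i, j) else 0)"
        by auto
    qed
    finally have "(\<Sum>l<n. \<theta> (R (i, l) * R (l, j))) =
        (\<Sum>m\<in>{0, 1}. (if m = 0 then 1 else - 1 :: real) *\<^sub>R P m (i, j))"
      by (rule sums_unique2 [OF _ sums_If_finite_set]) simp
    also have "\<dots> = (if i = j then 1 else 0) - Y (i, j)"
      using Y ij M.nat_pow_Suc [of Y 0] M.l_one [of Y] by (simp add: P_def M_apply)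
    finally show ?thesis .
  qed
  ultimately show ?thesis using R by blast
qed

end

text \<open>A sesquilinear form with real diagonal values is hermitian; its entries are recovered from vectors
  supported in one coordinate.\<close>

lemma pos_matrix_hermitian:
  assumes pos: "pos_matrix I X" and "finite I" "i \<in> I" "j \<in> I"
  shows "adj (X i j) = X j i"
proof -
  define Q where "Q \<xi> \<eta> = (\<Sum>i\<in>I. \<Sum>j\<in>I. cinner (\<xi> i) (X i j $$ \<eta> j))" for \<xi> \<eta>
  have Q_add: "Q (\<lambda>i. \<xi> i + \<zeta> i) \<eta> = Q \<xi> \<eta> + Q \<zeta> \<eta>" "Q \<xi> (\<lambda>i. \<eta> i + \<zeta> i) = Q \<xi> \<eta> + Q \<xi> \<zeta>"
    for \<xi> \<eta> \<zeta> by (simp_all add: Q_def cinner_simps sum.distrib)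
  have Q_scale: "Q (\<lambda>i. c *\<^sub>C \<xi> i) \<eta> = cnj c * Q \<xi> \<eta>" "Q \<xi> (\<lambda>i. c *\<^sub>C \<eta> i) = c * Q \<xi> \<eta>"
    for c \<xi> \<eta> by (simp_all add: Q_def cinner_simps sum_distrib_left)
  have real: "Im (Q \<xi> \<xi>) = 0" for \<xi>
    using pos_matrixD [OF pos, of \<xi>] unfolding Q_def complex_nonneg_Reals_iff by blast
  have herm: "Q \<eta> \<xi> = cnj (Q \<xi> \<eta>)" for \<xi> \<eta>
    using real [of "\<lambda>i. \<xi> i + \<eta> i"] real [of "\<lambda>i. \<xi> i + \<i> *\<^sub>C \<eta> i"] real [of \<xi>] real [of \<eta>]
    by (simp add: Q_add Q_scale complex_eq_iff)
  define \<delta> where "\<delta> k x l = (if l = k then x else 0)" for k :: 'a and x :: 'b and l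
  have Q_delta: "Q (\<delta> k x) (\<delta> l y) = cinner x (X k l $$ y)" if "k \<in> I" "l \<in> I" for k l x y
  proof -
    have "Q (\<delta> k x) (\<delta> l y) = (\<Sum>i\<in>I. \<Sum>j\<in>I. if j = l then (if i = k then cinner x (X k l $$ y) else 0) else 0)"
      unfolding Q_def \<delta>_def by (intro sum.cong) auto
    then show ?thesis using that assms(2) by simp
  qed
  show ?thesis
  proof (rule bop_eqI_cinner)
    fix x y
    have "cinner x (X j i $$ y) = cnj (cinner y (X i j $$ x))"
      using herm [of "\<delta> j x" "\<delta> i y"] assms by (simp add: Q_delta)
    then show "cinner x (adj (X i j) $$ y) = cinner x (X j i $$ y)"
      by (metis cinner_adj_right cinner_commute)
  qed
qed

text \<open>For a self-adjoint matrix the norm is bounded by the numerical radius: polarise the form at \<open>\<xi>\<close>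
  and \<open>Y \<xi>\<close>.\<close>

lemma mat_norm_le_one_of_form:
  fixes Y :: "nat \<times> nat \<Rightarrow> 'a :: complex_hilbert bop"
  assumes herm: "\<And>i j. i < n \<Longrightarrow> j < n \<Longrightarrow> adj (Y (i, j)) = Y (j, i)"
    and form: "\<And>\<xi>. \<bar>Re (\<Sum>i<n. cinner (\<xi> i) (mat_apply n Y \<xi> i))\<bar> \<le> (vnorm n \<xi>)\<^sup>2"
  shows "mat_norm n Y \<le> 1"
proof (rule mat_norm_leI)
  fix \<xi> :: "nat \<Rightarrow> 'a"
  define \<eta> where "\<eta> = mat_apply n Y \<xi>"
  define F where "F \<xi> \<zeta> = Re (\<Sum>i<n. cinner (\<xi> i) (mat_apply n Y \<zeta> i))" for \<xi> \<zeta>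
  have Y_add: "mat_apply n Y (\<lambda>i. \<xi> i + \<zeta> i) i = mat_apply n Y \<xi> i + mat_apply n Y \<zeta> i"
    "mat_apply n Y (\<lambda>i. \<xi> i - \<zeta> i) i = mat_apply n Y \<xi> i - mat_apply n Y \<zeta> i" for \<xi> \<zeta> i
    by (simp_all add: mat_apply_def sum.distrib sum_subtractf)
  have v2: "(vnorm n \<zeta>)\<^sup>2 = Re (\<Sum>i<n. cinner (\<zeta> i) (\<zeta> i))" for \<zeta> :: "nat \<Rightarrow> 'a"
    unfolding vnorm_self by simp
  have "F \<xi> \<eta> = Re (\<Sum>i<n. cinner (mat_apply n (mstar n Y) \<xi> i) (\<eta> i))"
    unfolding F_def cinner_mat_apply_mstar ..
  also have "(\<Sum>i<n. cinner (mat_apply n (mstar n Y) \<xi> i) (\<eta> i)) = (\<Sum>i<n. cinner (\<eta> i) (\<eta> i))"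
    by (intro sum.cong) (simp_all add: \<eta>_def mat_apply_def herm)
  finally have F1: "F \<xi> \<eta> = (vnorm n \<eta>)\<^sup>2" by (simp only: v2)
  have F2: "F \<eta> \<xi> = (vnorm n \<eta>)\<^sup>2" by (simp only: F_def v2 \<eta>_def)
  have "F (\<lambda>i. \<xi> i + \<eta> i) (\<lambda>i. \<xi> i + \<eta> i) - F (\<lambda>i. \<xi> i - \<eta> i) (\<lambda>i. \<xi> i - \<eta> i) =
      2 * F \<xi> \<eta> + 2 * F \<eta> \<xi>"
    by (simp add: F_def Y_add cinner_simps sum.distrib sum_subtractf)
  moreover have "F (\<lambda>i. \<xi> i + \<eta> i) (\<lambda>i. \<xi> i + \<eta> i) \<le> (vnorm n (\<lambda>i. \<xi> i + \<eta> i))\<^sup>2"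
    "- F (\<lambda>i. \<xi> i - \<eta> i) (\<lambda>i. \<xi> i - \<eta> i) \<le> (vnorm n (\<lambda>i. \<xi> i - \<eta> i))\<^sup>2"
    using form [of "\<lambda>i. \<xi> i + \<eta> i"] form [of "\<lambda>i. \<xi> i - \<eta> i"] by (simp_all add: F_def abs_le_iff)
  moreover have "(vnorm n (\<lambda>i. \<xi> i + \<eta> i))\<^sup>2 + (vnorm n (\<lambda>i. \<xi> i - \<eta> i))\<^sup>2 =
      2 * (vnorm n \<xi>)\<^sup>2 + 2 * (vnorm n \<eta>)\<^sup>2"
    unfolding v2 by (simp add: cinner_simps sum.distrib sum_subtractf)
  ultimately have "(vnorm n \<eta>)\<^sup>2 \<le> (vnorm n \<xi>)\<^sup>2"
    using F1 F2 by linarith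
  then have "vnorm n \<eta> \<le> vnorm n \<xi>"
    by (rule power2_le_imp_le) simp
  then show "vnorm n (mat_apply n Y \<xi>) \<le> 1 * vnorm n \<xi>"
    by (simp add: \<eta>_def)
qed simp

context choi_effros_algebra
begin

text \<open>A positive matrix over \<open>D\<close>, with positivity meant in $B(H^n)$, is a multiple of the
  square of a self-adjoint matrix for the Choi-Effros product: scaled suitably it has the form \<open>1 - Y\<close> with \<open>\<parallel>Y\<parallel> \<le> 1\<close>.\<close>

lemma factorization:
  assumes X: "\<And>i j. i < n \<Longrightarrow> j < n \<Longrightarrow> X i j \<in> D" and pos: "pos_matrix {..<n} X"
  shows "\<exists>c\<ge>0. \<exists>R\<in>idx n \<rightarrow>\<^sub>E D. star (M n) R = R \<and>
    (\<forall>i<n. \<forall>j<n. X i j = c *\<^sub>R (\<Sum>l<n. \<theta> (R (i, l) * R (l, j))))"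
proof -
  define Z where "Z = (\<lambda>(i, j)\<in>idx n. X i j)"
  \<comment> \<open>Any bound for the norm would do; the summand 1 makes it nonzero.\<close>
  define c where "c = mat_norm n Z + 1"
  have "c > 0" using mat_norm_nonneg [of n Z] by (simp add: c_def)
  define Y where "Y = (\<lambda>(i, j)\<in>idx n. (if i = j then 1 else 0) - (1 / c) *\<^sub>R X i j)"
  have Y: "Y \<in> idx n \<rightarrow>\<^sub>E D"
    unfolding Y_def by (rule restrict_idxI) (simp add: X bop_scaleR_scaleC)
  have herm: "adj (Y (i, j)) = Y (j, i)" if "i < n" "j < n" for i j
    using pos_matrix_hermitian [OF pos, of i j] that
    by (auto simp: Y_def adj_diff bop_scaleR_scaleC adj_scaleC)
  have "\<bar>Re (\<Sum>i<n. cinner (\<xi> i) (mat_apply n Y \<xi> i))\<bar> \<le> (vnorm n \<xi>)\<^sup>2" for \<xi>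
  proof -
    define q where "q = Re (\<Sum>i<n. cinner (\<xi> i) (mat_apply n Z \<xi> i))"
    have "mat_apply n Y \<xi> i = \<xi> i - (1 / c) *\<^sub>R mat_apply n Z \<xi> i" if "i < n" for i
    proof -
      have "mat_apply n Y \<xi> i = (\<Sum>j<n. (if i = j then \<xi> i else 0) - (1 / c) *\<^sub>R (X i j $$ \<xi> j))"
        unfolding mat_apply_def using that by (intro sum.cong) (auto simp: Y_def)
      then show ?thesis
        using that by (simp add: sum_subtractf mat_apply_def Z_def scaleR_sum_right)
    qed
    then have "(\<Sum>i<n. cinner (\<xi> i) (mat_apply n Y \<xi> i)) =
        (\<Sum>i<n. cinner (\<xi> i) (\<xi> i)) - of_real (1 / c) * (\<Sum>i<n. cinner (\<xi> i) (mat_apply n Z \<xi> i))"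
      by (simp add: cinner_simps sum_subtractf sum_distrib_left)
    then have "Re (\<Sum>i<n. cinner (\<xi> i) (mat_apply n Y \<xi> i)) = (vnorm n \<xi>)\<^sup>2 - q / c"
      unfolding vnorm_self by (simp add: q_def del: Re_sum)
    moreover have "0 \<le> q"
    proof -
      have "(\<Sum>i<n. cinner (\<xi> i) (mat_apply n Z \<xi> i)) = qform {..<n} X \<xi>"
        by (simp add: mat_apply_def cinner_sum_right Z_def)
      then show ?thesis
        using pos_matrixD [OF pos, of \<xi>] by (simp add: q_def complex_nonneg_Reals_iff del: Re_sum Im_sum)
    qed
    moreover have "q \<le> c * (vnorm n \<xi>)\<^sup>2"
    proof -
      have "q \<le> vnorm n \<xi> * vnorm n (mat_apply n Z \<xi>)"
        unfolding q_def using complex_Re_le_cmod cmod_sum_cinner_le by (rule order_trans)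
      also have "\<dots> \<le> vnorm n \<xi> * (mat_norm n Z * vnorm n \<xi>)"
        by (intro mult_left_mono vnorm_mat_apply_le) simp
      also have "\<dots> \<le> c * (vnorm n \<xi>)\<^sup>2"
        by (simp add: c_def power2_eq_square algebra_simps)
      finally show ?thesis .
    qed
    ultimately have "0 \<le> q / c" "q / c \<le> (vnorm n \<xi>)\<^sup>2"
      and "Re (\<Sum>i<n. cinner (\<xi> i) (mat_apply n Y \<xi> i)) = (vnorm n \<xi>)\<^sup>2 - q / c"
      using \<open>c > 0\<close> by (simp_all add: field_simps del: Re_sum)
    then show ?thesis by linarith
  qed
  then have "mat_norm n Y \<le> 1"
    using herm by (rule mat_norm_le_one_of_form [rotated])
  moreover have "star (M n) Y = Y"
    using Y herm by - (rule M_eqI [where n = n], simp_all add: M_closed M_apply)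
  ultimately obtain R where R: "R \<in> idx n \<rightarrow>\<^sub>E D" "star (M n) R = R"
    "\<And>i j. i < n \<Longrightarrow> j < n \<Longrightarrow> (\<Sum>l<n. \<theta> (R (i, l) * R (l, j))) = (if i = j then 1 else 0) - Y (i, j)"
    using square_root_exists [OF Y] by blast
  have "X i j = c *\<^sub>R (\<Sum>l<n. \<theta> (R (i, l) * R (l, j)))" if "i < n" "j < n" for i j
    using R(3) [OF that] that \<open>c > 0\<close> by (simp add: Y_def)
  then show ?thesis
    using R \<open>c > 0\<close> by (intro exI [of _ c]) auto
qed

text \<open>Squares are mapped to squares. In particular *-homomorphisms are contractive, hence continuous.\<close>

theorem star_hom_ucp:
  assumes "\<pi> \<in> star_hom B (bop_cstar\<lparr>carrier := A\<rparr>)"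
  shows "ucp D \<pi>"
proof -
  have \<pi>_ring: "\<pi> \<in> ring_hom B (bop_cstar\<lparr>carrier := A\<rparr>)"
    using assms by (simp add: star_hom_def)
  have \<pi>_one: "\<pi> 1 = 1"
    using ring_hom_one [OF \<pi>_ring] by (simp add: bop_cstar_def)
  have \<pi>_add: "\<pi> (x + y) = \<pi> x + \<pi> y" and \<pi>_mult: "\<pi> (\<theta> (x * y)) = \<pi> x * \<pi> y"
    if "x \<in> D" "y \<in> D" for x y
    using ring_hom_add [OF \<pi>_ring, of x y] ring_hom_mult [OF \<pi>_ring, of x y] that
    by (simp_all add: bop_cstar_def)
  have \<pi>_scale: "\<pi> (c *\<^sub>C x) = c *\<^sub>C \<pi> x" and \<pi>_adj: "\<pi> (adj x) = adj (\<pi> x)" if "x \<in> D" for c x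
    using assms that by (simp_all add: star_hom_def bop_cstar_def)
  have \<pi>_sum: "\<pi> (\<Sum>i\<in>I. f i) = (\<Sum>i\<in>I. \<pi> (f i))" if "\<And>i. i \<in> I \<Longrightarrow> f i \<in> D" for I :: "nat set" and f
    using that
  proof (induction I rule: infinite_finite_induct)
    case (insert i I)
    then show ?case by (simp add: \<pi>_add D_sum)
  qed (use \<pi>_scale [of 0 0] in simp_all)
  show ?thesis
  proof (rule ucpI)
    fix n and X :: "nat \<Rightarrow> nat \<Rightarrow> 'a bop"
    assume pos: "pos_matrix {..<n} X" and X: "\<And>i j. i < n \<Longrightarrow> j < n \<Longrightarrow> X i j \<in> D"
    obtain c R where c: "c \<ge> 0" and R: "R \<in> idx n \<rightarrow>\<^sub>E D" "star (M n) R = R"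
      and XR: "\<And>i j. i < n \<Longrightarrow> j < n \<Longrightarrow> X i j = c *\<^sub>R (\<Sum>l<n. \<theta> (R (i, l) * R (l, j)))"
      using factorization [OF X pos] by blast
    have "\<pi> (X i j) = c *\<^sub>R (\<Sum>l<n. adj (\<pi> (R (l, i))) * \<pi> (R (l, j)))" if ij: "i < n" "j < n" for i j
    proof -
      have prod: "\<theta> (R (i, l) * R (l, j)) \<in> D" if "l < n" for l
        using R(1) that ij by (intro D_simps) (auto intro: M_entry)
      then have "(\<Sum>l<n. \<theta> (R (i, l) * R (l, j))) \<in> D"
        by (intro D_sum) simp
      then have "\<pi> (X i j) = c *\<^sub>R \<pi> (\<Sum>l<n. \<theta> (R (i, l) * R (l, j)))"
        by (simp add: XR ij bop_scaleR_scaleC \<pi>_scale)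
      also have "\<pi> (\<Sum>l<n. \<theta> (R (i, l) * R (l, j))) = (\<Sum>l<n. \<pi> (\<theta> (R (i, l) * R (l, j))))"
        by (rule \<pi>_sum) (simp add: prod)
      also have "\<pi> (\<theta> (R (i, l) * R (l, j))) = adj (\<pi> (R (l, i))) * \<pi> (R (l, j))" if "l < n" for l
        using R that ij M_apply(3) [of i n l R] by (simp add: \<pi>_mult M_entry flip: \<pi>_adj)
      then have "(\<Sum>l<n. \<pi> (\<theta> (R (i, l) * R (l, j)))) = (\<Sum>l<n. adj (\<pi> (R (l, i))) * \<pi> (R (l, j)))"
        by simp
      finally show ?thesis .
    qed
    then show "pos_matrix {..<n} (\<lambda>i j. \<pi> (X i j))"
      using pos_matrix_scaleR [OF pos_matrix_gram [where T = "\<lambda>l i. \<pi> (R (l, i))"] c, of "{..<n}" "{..<n}"]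
      by (subst pos_matrix_cong) auto
  qed (simp_all add: \<pi>_one \<pi>_add \<pi>_scale)
qed

end

section \<open>Generated subalgebras\<close>

context choi_effros_algebra
begin

text \<open>Convergence in the abstract algebra is convergence in operator norm, and \<open>D\<close> is closed.\<close>

lemma cstar_subalgebra_iff:
  "cstar_subalgebra E B \<longleftrightarrow> E \<subseteq> D \<and> closed_star_algebra \<theta> E"
proof
  assume E: "cstar_subalgebra E B"
  then have "E \<subseteq> D" by (simp add: cstar_subalgebra_def)
  moreover have "csubspace E"
    using E by (auto simp: cstar_subalgebra_def intro!: complex_vector.subspaceI)
  moreover have "closed E"
    unfolding closed_sequential_limits
  proof (intro allI impI, elim conjE)
    fix X x
    assume X: "\<forall>k. X k \<in> E" "X \<longlonglongrightarrow> x"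
    then have XD: "\<And>k. X k \<in> D" using \<open>E \<subseteq> D\<close> by blast
    then have "x \<in> D" using X(2) by (rule D_limit)
    moreover have "(\<lambda>k. cnorm B (X k \<ominus>\<^bsub>B\<^esub> x)) \<longlonglongrightarrow> 0"
      using X(2) XD \<open>x \<in> D\<close> by (simp add: tendsto_norm_zero_iff LIM_zero_iff)
    ultimately show "x \<in> E"
      using E X(1) unfolding cstar_subalgebra_def by (simp only: B_simps)
  qed
  ultimately show "E \<subseteq> D \<and> closed_star_algebra \<theta> E"
    using E by (auto simp: cstar_subalgebra_def closed_star_algebra_def)
next
  assume E: "E \<subseteq> D \<and> closed_star_algebra \<theta> E"
  then have cE: "csubspace E" and "closed E" by (auto simp: closed_star_algebra_def)
  have "x \<in> E" if "x \<in> D" "\<And>k. X k \<in> E" "(\<lambda>k. cnorm B (X k \<ominus>\<^bsub>B\<^esub> x)) \<longlonglongrightarrow> 0" for X x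
  proof -
    have "X k \<ominus>\<^bsub>B\<^esub> x = X k - x" for k
      using E that by (intro minus_B) auto
    then have "X \<longlonglongrightarrow> x"
      using that(3) by (simp add: tendsto_norm_zero_iff LIM_zero_iff)
    then show ?thesis using \<open>closed E\<close> that(2) closed_sequentially by blast
  qed
  then show "cstar_subalgebra E B"
    using E complex_vector.subspace_0 [OF cE] complex_vector.subspace_add [OF cE]
      complex_vector.subspace_scale [OF cE]
    unfolding cstar_subalgebra_def closed_star_algebra_def B_simps by blast
qed

lemma generated:
  assumes "S \<subseteq> D"
  shows generated_algebra: "closed_star_algebra \<theta> (cstar_generated B S)"
    and generated_subset: "cstar_generated B S \<subseteq> D"
    and generated_superset: "S \<subseteq> cstar_generated B S"
    and generated_least: "\<And>E. closed_star_algebra \<theta> E \<Longrightarrow> E \<subseteq> D \<Longrightarrow> S \<subseteq> E \<Longrightarrow> cstar_generated B S \<subseteq> E"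
proof -
  let ?\<E> = "{E. E \<subseteq> D \<and> closed_star_algebra \<theta> E \<and> S \<subseteq> E}"
  have eq: "cstar_generated B S = \<Inter> ?\<E>"
    by (simp add: cstar_generated_def cstar_subalgebra_iff conj_assoc)
  have D: "D \<in> ?\<E>" using assms closed_star_algebra by simp
  show "cstar_generated B S \<subseteq> D" "S \<subseteq> cstar_generated B S"
    unfolding eq using D by blast+
  show "cstar_generated B S \<subseteq> E" if "closed_star_algebra \<theta> E" "E \<subseteq> D" "S \<subseteq> E" for E
    unfolding eq using that by blast
  have "csubspace (\<Inter> ?\<E>)"
    by (rule complex_vector.subspace_Inter) (auto simp: closed_star_algebra_def)
  moreover have "closed (\<Inter> ?\<E>)"
    by (rule closed_Inter) (auto simp: closed_star_algebra_def)
  ultimately show "closed_star_algebra \<theta> (cstar_generated B S)"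
    unfolding eq closed_star_algebra_def [of _ "\<Inter> _"] by (auto simp: closed_star_algebra_def)
qed

end

interpretation bop: choi_effros_algebra "\<lambda>x. x" "UNIV :: 'a :: complex_hilbert bop set"
  by unfold_locales (simp_all add: ucp_id closed_star_algebra_def)

lemma bop_cstar_eq: "bop_cstar\<lparr>carrier := D\<rparr> = choi_effros_cstar (\<lambda>x. x) D"
  by (simp add: bop_cstar_def choi_effros_cstar_def)

lemma cstar_of_eq: "cstar_of S = cstar_generated (choi_effros_cstar (\<lambda>x. x) UNIV) S"
  by (simp add: cstar_of_def bop_cstar_def choi_effros_cstar_def)

lemma cstar_of_least: "closed_star_algebra (\<lambda>x. x) E \<Longrightarrow> S \<subseteq> E \<Longrightarrow> cstar_of S \<subseteq> E"
  unfolding cstar_of_eq by (rule bop.generated_least) auto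

lemma closed_star_algebra_cstar_of: "closed_star_algebra (\<lambda>x. x) (cstar_of S)"
  unfolding cstar_of_eq by (rule bop.generated_algebra) simp

section \<open>The C*-envelope inside the range of a projection\<close>

context ucp_projection
begin

lemma tendsto_theta: "(X \<longlongrightarrow> x) F \<Longrightarrow> ((\<lambda>k. \<theta> (X k)) \<longlongrightarrow> \<theta> x) F"
  by (rule bounded_linear.tendsto [OF ucp_bounded_linear [OF ucp]])

lemma range_iff: "x \<in> range \<theta> \<longleftrightarrow> \<theta> x = x"
  using idem by (metis rangeE rangeI)

lemma choi_effros_algebra_range: "choi_effros_algebra \<theta> (range \<theta>)"
proof
  have "closed (range \<theta>)"
    unfolding closed_sequential_limits range_iff
  proof (intro allI impI, elim conjE)
    fix X x
    assume X: "\<forall>k. \<theta> (X k) = X k" "X \<longlonglongrightarrow> x"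
    have "(\<lambda>k. \<theta> (X k)) \<longlonglongrightarrow> \<theta> x" using X(2) by (rule tendsto_theta)
    then show "\<theta> x = x" using X by (simp add: LIMSEQ_unique)
  qed
  moreover have "csubspace (range \<theta>)"
    by (rule complex_vector.subspaceI)
      (simp_all only: range_iff theta_zero theta_add theta_scaleC)
  ultimately show "closed_star_algebra \<theta> (range \<theta>)"
    by (auto simp: closed_star_algebra_def simp flip: theta_adj)
  show "1 \<in> range \<theta>" by (simp only: range_iff theta_one)
  show "\<theta> x = x" if "x \<in> range \<theta>" for x using that by (simp only: range_iff)
qed

lemma ce_assoc: "\<theta> (\<theta> (\<theta> x * \<theta> y) * \<theta> z) = \<theta> (\<theta> x * \<theta> (\<theta> y * \<theta> z))"
proof -
  have "\<theta> (\<theta> (\<theta> x * \<theta> y) * \<theta> z) = \<theta> (\<theta> x * (\<theta> y * \<theta> z))"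
    using fixed_right [of "\<theta> z" "\<theta> x * \<theta> y"] by (simp only: idem mult.assoc)
  also have "\<dots> = \<theta> (\<theta> x * \<theta> (\<theta> y * \<theta> z))"
    by (rule fixed_left [symmetric]) (rule idem)
  finally show ?thesis .
qed

end

text \<open>Although \<open>\<theta>\<close> need not be multiplicative on $B(H)$, it is multiplicative from the C*-algebra
  generated by its fixed points to the Choi-Effros algebra: the elements \<open>a\<close> for which \<open>\<theta>\<close> respects all
  products \<open>a x\<close> and \<open>x a\<close> form a closed *-algebra. The homomorphism \<open>\<pi>\<close> then inverts \<open>\<theta>\<close>, because this holds
  on the generators and both maps are multiplicative and continuous.\<close>

lemma cstar_of_theta:
  assumes "ucp_projection \<theta>" and B: "choi_effros_algebra \<theta> B" and "S \<subseteq> B"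
    and \<pi>: "\<pi> \<in> star_hom (choi_effros_cstar \<theta> B) (choi_effros_cstar (\<lambda>x. x) A)"
    and \<pi>_S: "\<And>s. s \<in> S \<Longrightarrow> \<pi> s = s"
    and a: "a \<in> cstar_of S"
  shows "\<theta> a \<in> B" "\<pi> (\<theta> a) = a"
proof -
  interpret ucp_projection \<theta> by fact
  interpret B: choi_effros_algebra \<theta> B by fact
  have \<pi>_ucp: "ucp B \<pi>"
    by (rule B.star_hom_ucp [where A = A]) (simp add: bop_cstar_eq \<pi>)
  note \<pi>_norm = ucp_norm_le [OF \<pi>_ucp B.operator_system_D]
  have \<pi>_ring: "\<pi> \<in> ring_hom (choi_effros_cstar \<theta> B) (choi_effros_cstar (\<lambda>x. x) A)"
    using \<pi> by (simp add: star_hom_def)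
  have \<pi>_mult: "\<pi> (\<theta> (x * y)) = \<pi> x * \<pi> y" if "x \<in> B" "y \<in> B" for x y
    using ring_hom_mult [OF \<pi>_ring, of x y] that by (simp add: choi_effros_cstar_def)
  define E where "E = {a. \<theta> a \<in> B \<and> \<pi> (\<theta> a) = a \<and>
    (\<forall>x. \<theta> (a * x) = \<theta> (\<theta> a * \<theta> x)) \<and> (\<forall>x. \<theta> (x * a) = \<theta> (\<theta> x * \<theta> a))}"
  have "closed_star_algebra (\<lambda>x. x) E"
    unfolding closed_star_algebra_def
  proof (intro conjI ballI)
    show "csubspace E"
      by (rule complex_vector.subspaceI)
        (auto simp: E_def theta_zero theta_add theta_scaleC distrib_left distrib_right
          bop_scaleC_mult ucp_zero [OF \<pi>_ucp] ucp_add [OF \<pi>_ucp] ucp_scaleC [OF \<pi>_ucp])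
  next
    fix a b
    assume "a \<in> E" "b \<in> E"
    then have a: "\<theta> a \<in> B" "\<pi> (\<theta> a) = a" "\<And>x. \<theta> (a * x) = \<theta> (\<theta> a * \<theta> x)"
        "\<And>x. \<theta> (x * a) = \<theta> (\<theta> x * \<theta> a)"
      and b: "\<theta> b \<in> B" "\<pi> (\<theta> b) = b" "\<And>x. \<theta> (b * x) = \<theta> (\<theta> b * \<theta> x)"
        "\<And>x. \<theta> (x * b) = \<theta> (\<theta> x * \<theta> b)"
      by (auto simp: E_def)
    have "\<theta> (a * b) \<in> B" "\<pi> (\<theta> (a * b)) = a * b"
      using a(1,2) b(1,2) by (simp_all add: a(3) [of b] \<pi>_mult)
    moreover have "\<theta> (a * b * x) = \<theta> (\<theta> (a * b) * \<theta> x)" for x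
    proof -
      have "\<theta> (a * b * x) = \<theta> (\<theta> a * \<theta> (\<theta> b * \<theta> x))"
        using a(3) [of "b * x"] b(3) [of x] by (simp add: mult.assoc)
      also have "\<dots> = \<theta> (\<theta> (a * b) * \<theta> x)"
        by (simp only: a(3) [of b] ce_assoc)
      finally show ?thesis .
    qed
    moreover have "\<theta> (x * (a * b)) = \<theta> (\<theta> x * \<theta> (a * b))" for x
    proof -
      have "\<theta> (x * (a * b)) = \<theta> (\<theta> (\<theta> x * \<theta> a) * \<theta> b)"
        using b(4) [of "x * a"] a(4) [of x] by (simp add: mult.assoc)
      also have "\<dots> = \<theta> (\<theta> x * \<theta> (a * b))"
        by (simp only: a(3) [of b] ce_assoc)
      finally show ?thesis .
    qed
    ultimately show "a * b \<in> E" by (simp add: E_def)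
  next
    fix a
    assume "a \<in> E"
    then have a: "\<theta> a \<in> B" "\<pi> (\<theta> a) = a" "\<And>x. \<theta> (a * x) = \<theta> (\<theta> a * \<theta> x)"
        "\<And>x. \<theta> (x * a) = \<theta> (\<theta> x * \<theta> a)"
      by (auto simp: E_def)
    have "\<theta> (adj a * x) = \<theta> (\<theta> (adj a) * \<theta> x)" for x
      using arg_cong [OF a(4) [of "adj x"], of adj] by (simp add: adj_mult flip: theta_adj)
    moreover have "\<theta> (x * adj a) = \<theta> (\<theta> x * \<theta> (adj a))" for x
      using arg_cong [OF a(3) [of "adj x"], of adj] by (simp add: adj_mult flip: theta_adj)
    moreover have "\<pi> (\<theta> (adj a)) = adj a"
      using ucp_adj [OF \<pi>_ucp B.operator_system_D a(1)] a(2) by (simp add: theta_adj)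
    moreover have "\<theta> (adj a) \<in> B"
      using a(1) by (simp add: theta_adj)
    ultimately show "adj a \<in> E" by (simp add: E_def)
  next
    show "closed E"
      unfolding closed_sequential_limits
    proof (intro allI impI, elim conjE)
      fix X a
      assume X: "\<forall>k. X k \<in> E" and lim: "X \<longlonglongrightarrow> a"
      have XE: "\<theta> (X k) \<in> B" "\<pi> (\<theta> (X k)) = X k" "\<And>x. \<theta> (X k * x) = \<theta> (\<theta> (X k) * \<theta> x)"
        "\<And>x. \<theta> (x * X k) = \<theta> (\<theta> x * \<theta> (X k))" for k
        using X by (auto simp: E_def)
      note lim' = tendsto_theta [OF lim]
      have "\<theta> a \<in> B"
        by (rule B.D_limit [OF XE(1) lim'])
      moreover have "\<theta> (a * x) = \<theta> (\<theta> a * \<theta> x)" for x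
      proof (rule LIMSEQ_unique)
        show "(\<lambda>k. \<theta> (X k * x)) \<longlonglongrightarrow> \<theta> (a * x)"
          by (intro tendsto_theta tendsto_mult lim tendsto_const)
        show "(\<lambda>k. \<theta> (X k * x)) \<longlonglongrightarrow> \<theta> (\<theta> a * \<theta> x)"
          unfolding XE(3) by (intro tendsto_theta tendsto_mult lim tendsto_const)
      qed
      moreover have "\<theta> (x * a) = \<theta> (\<theta> x * \<theta> a)" for x
      proof (rule LIMSEQ_unique)
        show "(\<lambda>k. \<theta> (x * X k)) \<longlonglongrightarrow> \<theta> (x * a)"
          by (intro tendsto_theta tendsto_mult lim tendsto_const)
        show "(\<lambda>k. \<theta> (x * X k)) \<longlonglongrightarrow> \<theta> (\<theta> x * \<theta> a)"
          unfolding XE(4) by (intro tendsto_theta tendsto_mult lim tendsto_const)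
      qed
      moreover have "\<pi> (\<theta> a) = a"
      proof (rule LIMSEQ_unique [OF _ lim])
        have le: "norm (X k - \<pi> (\<theta> a)) \<le> norm (\<theta> (X k) - \<theta> a)" for k
        proof -
          have "\<pi> (\<theta> (X k) - \<theta> a) = X k - \<pi> (\<theta> a)"
            using ucp_diff [OF \<pi>_ucp B.subspace_D XE(1) \<open>\<theta> a \<in> B\<close>] by (simp add: XE(2))
          then show ?thesis
            using \<pi>_norm [of "\<theta> (X k) - \<theta> a"] XE(1) \<open>\<theta> a \<in> B\<close> by simp
        qed
        have null: "(\<lambda>k. norm (\<theta> (X k) - \<theta> a)) \<longlonglongrightarrow> 0"
          by (intro tendsto_norm_zero LIM_zero lim')
        have "(\<lambda>k. X k - \<pi> (\<theta> a)) \<longlonglongrightarrow> 0"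
          by (rule Lim_null_comparison [OF always_eventually null]) (rule allI, rule le)
        then show "X \<longlonglongrightarrow> \<pi> (\<theta> a)"
          by (simp only: LIM_zero_iff)
      qed
      ultimately show "a \<in> E" by (simp add: E_def)
    qed
  qed
  moreover have "S \<subseteq> E"
  proof
    fix s
    assume "s \<in> S"
    then have "s \<in> B" using \<open>S \<subseteq> B\<close> by blast
    then have "\<theta> s = s" by (rule B.fixed)
    then show "s \<in> E"
      using \<open>s \<in> B\<close> \<pi>_S [OF \<open>s \<in> S\<close>] by (simp add: E_def fixed_left fixed_right)
  qed
  ultimately have "a \<in> E"
    using a cstar_of_least by blast
  then show "\<theta> a \<in> B" "\<pi> (\<theta> a) = a"
    by (simp_all add: E_def)
qed

text \<open>The subalgebra of the Choi-Effros algebra generated by \<open>S\<close>, with the operators themselves as its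
  elements, is a C*-extension whose embedding of \<open>S\<close> is the inclusion.\<close>

lemma cstar_extension_choi_effros:
  assumes S: "operator_system S" and \<theta>: "S_projection S \<theta>"
  defines "B \<equiv> cstar_generated (choi_effros_cstar \<theta> (range \<theta>)) S"
  shows "choi_effros_algebra \<theta> B" "S \<subseteq> B" "cstar_extension S (choi_effros_cstar \<theta> B) (\<lambda>s. s)"
proof -
  interpret ucp_projection \<theta>
    using \<theta> S_projectionD(2) [OF \<theta>] by unfold_locales (simp_all add: S_projection_def)
  interpret R: choi_effros_algebra \<theta> "range \<theta>"
    by (rule choi_effros_algebra_range)
  have "S \<subseteq> range \<theta>"
    using \<theta> by (auto simp: S_projection_def range_iff)
  note gen = R.generated [OF this, folded B_def]
  have "1 \<in> S" using S by (simp add: operator_system_def)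
  show "S \<subseteq> B" by (rule gen(3))
  interpret B: choi_effros_algebra \<theta> B
  proof unfold_locales
    show "closed_star_algebra \<theta> B" by (rule gen(1))
    show "1 \<in> B" using gen(3) \<open>1 \<in> S\<close> by blast
    show "\<theta> x = x" if "x \<in> B" for x
      using gen(2) that by (intro R.fixed) blast
  qed
  show "choi_effros_algebra \<theta> B" by (rule B.choi_effros_algebra_axioms)
  have "cstar_generated B.B S = B"
  proof (rule antisym)
    show "cstar_generated B.B S \<subseteq> B"
      by (rule B.generated_subset [OF gen(3)])
    show "B \<subseteq> cstar_generated B.B S"
      using B.generated [OF gen(3)] gen(2) by (intro gen(4)) auto
  qed
  moreover have "unital_complete_isometry S B.B (\<lambda>s. s)"
    unfolding unital_complete_isometry_def
  proof (intro conjI allI impI)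
    show "\<exists>p. unital_cstar_algebra (mat_cstar n B.B p) \<and>
        (\<forall>X\<in>idx n \<rightarrow>\<^sub>E S. p (mat_map n (\<lambda>s. s) X) = mat_norm n X)" for n
      using B.unital_cstar_algebra_M by (intro exI [of _ "mat_norm n"]) (auto intro: mat_norm_cong)
  qed (use gen(3) in auto)
  ultimately show "cstar_extension S B.B (\<lambda>s. s)"
    using B.unital_cstar_algebra_B by (simp add: cstar_extension_def)
qed

section \<open>Abnormalities and the C*-expanse\<close>

text \<open>Following \<open>\<theta>\<close> by a map \<open>\<phi>\<close> that fixes \<open>S\<close> moves the range of \<open>\<theta>\<close> to another copy of it: by rigidity \<open>\<theta>\<close> is
  inverse to \<open>\<phi>\<close> on the copy. If \<open>\<psi>\<close> lies below \<open>\<phi> \<theta>\<close>, then \<open>\<psi> = \<phi> \<theta> \<psi> \<phi> \<theta>\<close>, and rigidity for \<open>\<psi> \<phi>\<close> reduces this to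
  \<open>\<phi> \<theta>\<close>.\<close>

lemma minimal_S_projection_transport:
  assumes \<theta>: "minimal_S_projection S \<theta>" and \<phi>: "\<phi> \<in> ucp_fixing S"
  shows "minimal_S_projection S (\<lambda>x. \<phi> (\<theta> x))"
proof -
  have \<theta>S: "S_projection S \<theta>" using \<theta> by (simp add: minimal_S_projection_def)
  note rigid = minimal_S_projection_rigid [OF \<theta>]
  have proj: "S_projection S (\<lambda>x. \<phi> (\<theta> x))"
    by (rule S_projectionI [OF ucp_fixing_compose [OF \<phi> S_projectionD(1) [OF \<theta>S]]])
      (simp add: rigid [OF \<phi>])
  moreover have "\<psi> = (\<lambda>x. \<phi> (\<theta> x))" if \<psi>: "S_projection S \<psi>" "\<psi> \<prec> (\<lambda>x. \<phi> (\<theta> x))" for \<psi>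
  proof
    fix x
    have \<psi>_eq: "\<psi> (\<phi> (\<theta> x)) = \<psi> x" "\<phi> (\<theta> (\<psi> x)) = \<psi> x" for x
      using \<psi>(2) by (auto simp: proj_le_def fun_eq_iff)
    have "(\<lambda>x. \<psi> (\<phi> x)) \<in> ucp_fixing S"
      by (rule ucp_fixing_compose [OF S_projectionD(1) [OF \<psi>(1)] \<phi>])
    then have "\<theta> (\<psi> (\<phi> (\<theta> x))) = \<theta> x" by (rule rigid)
    then show "\<psi> x = \<phi> (\<theta> x)" using \<psi>_eq by metis
  qed
  ultimately show ?thesis by (simp add: minimal_S_projection_def)
qed

text \<open>The envelope property yields a *-homomorphism \<open>\<pi>\<close> from the copy of the generated algebra in the range
  of \<open>\<theta>\<close> back to \<open>C\<^sup>*(S)\<close>, inverse to \<open>\<theta>\<close>. For \<open>\<phi>\<close> in \<open>E\<close> the map \<open>\<phi> \<pi>\<close> extends to some \<open>\<psi>\<close> on $B(H)$, and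
  \<open>\<psi> \<theta> = \<phi>\<close> on \<open>C\<^sup>*(S)\<close>. So \<open>\<psi> \<theta>\<close> is the required minimal projection, and rigidity of \<open>\<theta>\<close> turns
  \<open>\<theta> \<psi> \<theta> = \<theta>\<close> into \<open>\<theta> \<phi> = \<theta>\<close> on \<open>C\<^sup>*(S)\<close>.\<close>

lemma envelope_abnormality:
  assumes S: "operator_system S"
    and env: "cstar_envelope S (bop_cstar\<lparr>carrier := cstar_of S\<rparr>) (\<lambda>s. s)"
    and \<theta>: "minimal_S_projection S \<theta>"
    and a: "a \<in> cstar_of S"
  shows "\<theta> a = 0 \<Longrightarrow> a = 0"
    and "ucp (cstar_of S) \<phi> \<Longrightarrow> \<forall>s\<in>S. \<phi> s = s \<Longrightarrow> \<theta> (\<phi> a) = \<theta> a"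
    and "ucp (cstar_of S) \<phi> \<Longrightarrow> \<forall>s\<in>S. \<phi> s = s \<Longrightarrow>
      \<exists>\<omega>. minimal_S_projection S \<omega> \<and> \<omega> a = \<phi> a"
proof -
  let ?A = "cstar_of S"
  have \<theta>S: "S_projection S \<theta>" using \<theta> by (simp add: minimal_S_projection_def)
  interpret ucp_projection \<theta>
    using \<theta>S S_projectionD(2) [OF \<theta>S] by unfold_locales (simp_all add: S_projection_def)
  define B where "B = cstar_generated (choi_effros_cstar \<theta> (range \<theta>)) S"
  note ext = cstar_extension_choi_effros [OF S \<theta>S, folded B_def]
  interpret B: choi_effros_algebra \<theta> B by (rule ext(1))
  obtain \<pi> where \<pi>: "\<pi> \<in> star_hom (choi_effros_cstar \<theta> B) (bop_cstar\<lparr>carrier := ?A\<rparr>)"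
    and \<pi>_onto: "\<pi> ` carrier (choi_effros_cstar \<theta> B) = carrier (bop_cstar\<lparr>carrier := ?A\<rparr>)"
    and \<pi>_S: "\<And>s. s \<in> S \<Longrightarrow> \<pi> s = s"
    using conjunct2 [OF env [unfolded cstar_envelope_def], rule_format, OF ext(3)] by blast
  have \<theta>A: "\<theta> a \<in> B" "\<pi> (\<theta> a) = a" if "a \<in> ?A" for a
    using cstar_of_theta [OF ucp_projection_axioms ext(1,2) \<pi> [unfolded bop_cstar_eq] \<pi>_S that] by auto
  have \<pi>_ucp: "ucp B \<pi>" by (rule B.star_hom_ucp [OF \<pi>])
  show "a = 0" if "\<theta> a = 0"
    using \<theta>A(2) [OF a] that ucp_zero [OF \<pi>_ucp] by simp
  assume \<phi>: "ucp ?A \<phi>" "\<forall>s\<in>S. \<phi> s = s"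
  have "ucp B (\<lambda>b. \<phi> (\<pi> b))"
    using \<pi>_onto by (intro ucp_compose [OF \<pi>_ucp \<phi>(1)]) (auto simp: choi_effros_cstar_def)
  then obtain \<psi> where \<psi>: "ucp UNIV \<psi>" "\<And>b. b \<in> B \<Longrightarrow> \<psi> b = \<phi> (\<pi> b)"
    using arveson_extension [OF _ B.operator_system_D] by blast
  have \<psi>S: "\<psi> \<in> ucp_fixing S"
    using \<psi> ext(2) \<pi>_S \<phi>(2) by (auto simp: ucp_fixing_def)
  have \<psi>\<theta>: "\<psi> (\<theta> a) = \<phi> a"
    using \<psi>(2) \<theta>A [OF a] by simp
  show "\<theta> (\<phi> a) = \<theta> a"
    using minimal_S_projection_rigid [OF \<theta> \<psi>S, of a] by (simp add: \<psi>\<theta>)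
  show "\<exists>\<omega>. minimal_S_projection S \<omega> \<and> \<omega> a = \<phi> a"
    using minimal_S_projection_transport [OF \<theta> \<psi>S] \<psi>\<theta> by blast
qed

theorem theorem3:
  fixes S :: "'h :: complex_hilbert bop set"
    and \<theta> :: "'h bop \<Rightarrow> 'h bop"
  assumes "operator_system S"
    and "cstar_envelope S (bop_cstar\<lparr>carrier := cstar_of S\<rparr>) (\<lambda>s. s)"
    and "minimal_S_projection S \<theta>"
  shows "cspan (Ab S) = CstarEx S \<inter> \<theta> -` {0}"
proof -
  let ?A = "cstar_of S"
  note env = envelope_abnormality [OF assms]
  have "S_projection S \<theta>" using assms(3) by (simp add: minimal_S_projection_def)
  then interpret ucp_projection \<theta>
    using S_projectionD(2) by unfold_locales (auto simp: S_projection_def)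
  have subA: "csubspace ?A"
    using closed_star_algebra_cstar_of [of S] by (simp add: closed_star_algebra_def)
  have sub_ker: "csubspace (\<theta> -` {0})"
    by (rule complex_vector.subspaceI) (auto simp: theta_zero theta_add theta_scaleC)
  have Ab_ker: "cspan (Ab S) \<subseteq> \<theta> -` {0}"
    by (rule complex_vector.span_minimal [OF _ sub_ker]) (auto simp: Ab_def theta_diff env(2))
  have Ex: "\<omega> a \<in> CstarEx S" if "minimal_S_projection S \<omega>" "a \<in> ?A" for \<omega> a
    unfolding CstarEx_def by (rule complex_vector.span_base) (use that in blast)
  have sub_Ex: "csubspace (CstarEx S)"
    by (simp add: CstarEx_def)
  have "\<phi> a \<in> CstarEx S" if "a \<in> ?A" "ucp ?A \<phi>" "\<forall>s\<in>S. \<phi> s = s" for a \<phi>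
    using env(3) [OF that] Ex [OF _ that(1)] by metis
  moreover from this have "a \<in> CstarEx S" if "a \<in> ?A" for a
    using that ucp_id [of ?A] by blast
  ultimately have "Ab S \<subseteq> CstarEx S"
    by (auto simp: Ab_def intro: complex_vector.subspace_diff [OF sub_Ex])
  then have "cspan (Ab S) \<subseteq> CstarEx S"
    using sub_Ex by (rule complex_vector.span_minimal)
  moreover have "x \<in> cspan (Ab S)" if x: "x \<in> CstarEx S" "\<theta> x = 0" for x
  proof -
    \<comment> \<open>Modulo abnormalities every element \<open>\<omega> a\<close> of the expanse equals \<open>a\<close>.\<close>
    have "\<exists>a\<in>?A. x - a \<in> cspan (Ab S)"
      using x(1) unfolding CstarEx_def
    proof (induction rule: complex_vector.span_induct_alt)
      case base
      then show ?case
        using complex_vector.subspace_0 [OF subA] complex_vector.span_zero by force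
    next
      case (step c y z)
      then obtain \<omega> a b where \<omega>: "minimal_S_projection S \<omega>" and a: "a \<in> ?A" "y = \<omega> a"
        and b: "b \<in> ?A" "z - b \<in> cspan (Ab S)" by blast
      have "\<omega> \<in> ucp_fixing S"
        using \<omega> by (intro S_projectionD(1)) (simp add: minimal_S_projection_def)
      then have "ucp ?A \<omega>" "\<forall>s\<in>S. \<omega> s = s"
        by (auto simp: ucp_fixing_def intro: ucp_subset)
      then have "y - a \<in> Ab S" using a by (auto simp: Ab_def)
      then have "c *\<^sub>C (y - a) + (z - b) \<in> cspan (Ab S)"
        by (rule complex_vector.span_add [OF complex_vector.span_scale
              [OF complex_vector.span_base] b(2)])
      moreover have "c *\<^sub>C (y - a) + (z - b) = c *\<^sub>C y + z - (c *\<^sub>C a + b)"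
        by (simp add: complex_vector.scale_right_diff_distrib)
      moreover have "c *\<^sub>C a + b \<in> ?A"
        using a(1) b(1) subA
        by (intro complex_vector.subspace_add complex_vector.subspace_scale)
      ultimately show ?case by metis
    qed
    then obtain a where a: "a \<in> ?A" "x - a \<in> cspan (Ab S)" by blast
    then have "\<theta> (x - a) = 0" using Ab_ker by auto
    then have "\<theta> a = 0" using x(2) by (simp add: theta_diff)
    then have "a = 0" by (rule env(1) [OF a(1)])
    then show ?thesis using a(2) by simp
  qed
  ultimately show ?thesis using Ab_ker by blast
qed

end
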